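(* Let $0<s<1$. Assume that $f\in C^0(\mathbb{R}^+)\cap C^2(\mathbb{R}^+_* )$ is nondecreasing, convex, $f>0$ in $\mathbb{R}^+_*$, and that the limit $q_0=\lim_{t\to 0^+}q(t)$ exists in $\overline{\mathbb{R}}$, where $q(t)=\dfrac{(f'(t))^2}{f(t)f''(t)}$ if $f(t)f''(t)\neq 0$ and $q(t)=+\infty$ if $f(t)f''(t)=0$. Let $p_0$ be the conjugate exponent of $q_0$, i.e. $\frac{1}{p_0}+\frac{1}{q_0}=1$. Then the problem $$(-\Delta)^s u=f(u)\quad\text{in }\mathbb{R}^N$$ has no nontrivial bounded nonnegative stable solution if one of the following conditions is satisfied: (1) $N<10s$; (2) $N=10s$ and $p_0<+\infty$; (3) $N>10s$ and $p_0<p_c(N,s)$, where $$p_c(N,s)=\frac{(N-2s)^2-4sN+8s\sqrt{s(N-s)}}{(N-10s)(N-2s)}.$$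
   Context: $\mathbb{R}^+=[0,\infty)$, $\mathbb{R}^+_*=(0,\infty)$, $\overline{\mathbb{R}}=\mathbb{R}\cup\{\pm\infty\}$; $N\ge 1$ is an integer. In the relation $\frac1{p_0}+\frac1{q_0}=1$ the usual conventions apply ($p_0=1$ if $q_0=+\infty$, $p_0=+\infty$ if $q_0=1$). The fractional Laplacian is $$(-\Delta)^s u(x)=c_{N,s}\lim_{\epsilon\to0}\int_{\mathbb{R}^N\setminus B_\epsilon(x)}\frac{u(x)-u(y)}{|x-y|^{N+2s}}\,dy,$$ where $c_{N,s}>0$ is the usual normalization constant and $B_\epsilon(x)$ is the ball of center $x$ and radius $\epsilon$. Let $$\mathcal{L}_s(\mathbb{R}^N)=\Big\{u:\mathbb{R}^N\to\mathbb{R}:\ \int_{\mathbb{R}^N}\frac{|u(y)|}{(1+|y|)^{N+2s}}\,dy<\infty\Big\}.$$ Solutions are understood pointwise and belong to $C^{2\sigma}(\mathbb{R}^N)\cap\mathcal{L}_s(\mathbb{R}^N)$ for some $\sigma>s$. "Nontrivial" means not identically zero. A solution $u$ of $(-\Delta)^s u=f(u)$ is called stable if $$\int_{\mathbb{R}^N}f'(u)\phi^2\,dx\le\frac{c_{N,s}}{2}\int_{\mathbb{R}^N}\int_{\mathbb{R}^N}\frac{(\phi(x)-\phi(y))^2}{|x-y|^{N+2s}}\,dy\,dx\quad\text{for all }\phi\in C_c^\infty(\mathbb{R}^N).$$ (A nontrivial nonnegative solution is positive everywhere by the strong maximum principle, so $f'(u)$ is well defined.) *)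

theory Defs
  imports "HOL-Analysis.Analysis"
begin

section \<open>Function spaces on Euclidean space\<close>

definition partial :: "'a::euclidean_space \<Rightarrow> ('a \<Rightarrow> real) \<Rightarrow> 'a \<Rightarrow> real" where
  "partial i u = (\<lambda>x. frechet_derivative u (at x) i)"

text \<open>\<open>C_k k u\<close>: the function \<open>u\<close> is \<open>k\<close> times continuously differentiable on the whole space.\<close>

primrec C_k :: "nat \<Rightarrow> ('a::euclidean_space \<Rightarrow> real) \<Rightarrow> bool" where
  "C_k 0 u \<longleftrightarrow> continuous_on UNIV u"
| "C_k (Suc k) u \<longleftrightarrow> u differentiable_on UNIV \<and> (\<forall>i\<in>Basis. C_k k (partial i u))"

definition locally_Hoelder :: "real \<Rightarrow> ('a::euclidean_space \<Rightarrow> real) \<Rightarrow> bool" where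
  "locally_Hoelder \<alpha> v \<longleftrightarrow>
     (\<forall>K. compact K \<longrightarrow> (\<exists>C. \<forall>x\<in>K. \<forall>y\<in>K. \<bar>v x - v y\<bar> \<le> C * dist x y powr \<alpha>))"

text \<open>
  The space \<open>C\<^sup>\<beta>\<close> for real \<open>\<beta> \<ge> 0\<close> is \<open>C\<^sup>k\<^sup>,\<^sup>\<alpha>\<close> with \<open>k = \<lfloor>\<beta>\<rfloor>\<close> and \<open>\<alpha> = \<beta> - k\<close>, in the
  local sense (no bounds at infinity). The list \<open>is\<close> is a multi-index of order \<open>k\<close>. For
  integer \<open>\<beta>\<close> the exponent is \<open>0\<close>, the Hoelder condition only asks for boundedness on
  compact sets, and the space is the classical \<open>C\<^sup>k\<close>.
\<close>

definition C_real :: "real \<Rightarrow> ('a::euclidean_space \<Rightarrow> real) set" where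
  "C_real \<beta> = {u. C_k (nat \<lfloor>\<beta>\<rfloor>) u \<and>
     (\<forall>is. set is \<subseteq> Basis \<and> length is = nat \<lfloor>\<beta>\<rfloor> \<longrightarrow>
        locally_Hoelder (\<beta> - real_of_int \<lfloor>\<beta>\<rfloor>) (foldr partial is u))}"

definition test_functions :: "('a::euclidean_space \<Rightarrow> real) set" where
  "test_functions = {\<phi>. (\<forall>k. C_k k \<phi>) \<and> compact (closure {x. \<phi> x \<noteq> 0})}"

definition L_space :: "real \<Rightarrow> ('a::euclidean_space \<Rightarrow> real) set" where
  "L_space s = {u. u \<in> borel_measurable lebesgue \<and>
     integrable lebesgue (\<lambda>y. \<bar>u y\<bar> / (1 + norm y) powr (real DIM('a) + 2 * s))}"


section \<open>The fractional Laplacian\<close>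

text \<open>
  The usual normalization, for which \<open>(-\<Delta>)\<^sup>s\<close> is the Fourier multiplier \<open>|\<xi>|\<^sup>2\<^sup>s\<close>.
\<close>

definition frac_const :: "nat \<Rightarrow> real \<Rightarrow> real" where
  "frac_const N s =
     4 powr s * s * Gamma (real N / 2 + s) / (pi powr (real N / 2) * Gamma (1 - s))"

text \<open>
  \<open>has_frac_laplacian s u x v\<close>: the principal value defining \<open>(-\<Delta>)\<^sup>s u(x)\<close> exists and equals \<open>v\<close>.
\<close>

definition has_frac_laplacian ::
    "real \<Rightarrow> ('a::euclidean_space \<Rightarrow> real) \<Rightarrow> 'a \<Rightarrow> real \<Rightarrow> bool" where
  "has_frac_laplacian s u x v \<longleftrightarrow>
     (\<forall>\<epsilon>>0. set_integrable lebesgue (- ball x \<epsilon>)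
        (\<lambda>y. (u x - u y) / norm (x - y) powr (real DIM('a) + 2 * s))) \<and>
     ((\<lambda>\<epsilon>. frac_const DIM('a) s *
        (LINT y:- ball x \<epsilon>|lebesgue. (u x - u y) / norm (x - y) powr (real DIM('a) + 2 * s)))
      \<longlongrightarrow> v) (at_right 0)"

definition is_solution :: "real \<Rightarrow> (real \<Rightarrow> real) \<Rightarrow> ('a::euclidean_space \<Rightarrow> real) \<Rightarrow> bool" where
  "is_solution s f u \<longleftrightarrow>
     (\<exists>\<sigma>>s. u \<in> C_real (2 * \<sigma>)) \<and> u \<in> L_space s \<and> (\<forall>x. has_frac_laplacian s u x (f (u x)))"

text \<open>
  Only meant for positive \<open>u\<close>: for a nonlinearity given on \<open>[0,\<infinity>)\<close>, the value of \<open>deriv f\<close> at \<open>0\<close>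
  has no meaning.
\<close>

definition is_stable :: "real \<Rightarrow> (real \<Rightarrow> real) \<Rightarrow> ('a::euclidean_space \<Rightarrow> real) \<Rightarrow> bool" where
  "is_stable s f u \<longleftrightarrow> (\<forall>\<phi>\<in>test_functions.
     (LINT x|lebesgue. deriv f (u x) * (\<phi> x)\<^sup>2) \<le>
     frac_const DIM('a) s / 2 *
       (LINT x|lebesgue. LINT y|lebesgue.
          (\<phi> x - \<phi> y)\<^sup>2 / norm (x - y) powr (real DIM('a) + 2 * s)))"


section \<open>The nonlinearity and the exponents\<close>

definition C2_on :: "real set \<Rightarrow> (real \<Rightarrow> real) \<Rightarrow> bool" where
  "C2_on S f \<longleftrightarrow> f differentiable_on S \<and> deriv f differentiable_on S \<and>
     continuous_on S (deriv (deriv f))"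

definition q_fun :: "(real \<Rightarrow> real) \<Rightarrow> real \<Rightarrow> ereal" where
  "q_fun f t = (if f t * deriv (deriv f) t \<noteq> 0
     then ereal ((deriv f t)\<^sup>2 / (f t * deriv (deriv f) t)) else \<infinity>)"

text \<open>
  The solution \<open>p\<close> of \<open>1/p + 1/q = 1\<close>. In \<^typ>\<open>ereal\<close> we have \<open>1/0 = \<infinity>\<close> and \<open>1/\<infinity> = 0\<close>, which
  gives the conventions for \<open>q = 1\<close> and \<open>q = \<infinity>\<close>.
\<close>

definition conjugate_exponent :: "ereal \<Rightarrow> ereal" where
  "conjugate_exponent q = 1 / (1 - 1 / q)"

lemma conjugate_exponent_1: "conjugate_exponent 1 = \<infinity>"
  by (simp add: conjugate_exponent_def divide_ereal_def)

lemma conjugate_exponent_infinity: "conjugate_exponent \<infinity> = 1"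
  by (simp add: conjugate_exponent_def)

lemma conjugate_exponent_real:
  assumes "q \<noteq> 0" "q \<noteq> 1"
  shows "conjugate_exponent (ereal q) = ereal (q / (q - 1))"
  using assms by (auto simp: conjugate_exponent_def one_ereal_def field_simps)

lemma conjugate_exponent_eq:
  assumes "1 \<le> q"
  shows "1 / conjugate_exponent q + 1 / q = 1"
proof (cases q)
  case (real r)
  show ?thesis
  proof (cases "r = 1")
    case True
    then show ?thesis
      using real by (simp add: conjugate_exponent_1 flip: one_ereal_def)
  next
    case False
    with assms real have "r > 1" by (simp add: one_ereal_def)
    then show ?thesis
      using real by (simp add: conjugate_exponent_real one_ereal_def field_simps)
  qed
qed (use assms in \<open>simp_all add: conjugate_exponent_infinity\<close>)

definition p_c :: "nat \<Rightarrow> real \<Rightarrow> real" where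
  "p_c N s = ((real N - 2 * s)\<^sup>2 - 4 * s * real N + 8 * s * sqrt (s * (real N - s))) /
     ((real N - 10 * s) * (real N - 2 * s))"

end

theory Submission
  imports Defs
begin

text \<open>
  Let \<open>(\<phi> a - \<phi> b)\<^sup>2 \<le> (a - b) (K a - K b)\<close>, which follows from \<open>\<phi>'\<^sup>2 \<le> K'\<close> by Cauchy--Schwarz. Stability
  tested with \<open>\<phi>(u) \<psi>\<close> and the equation tested with \<open>K(u) \<psi>\<^sup>2\<close> give, as soon as
  \<open>f K \<le> (1 - \<delta>) f' \<phi>\<^sup>2\<close> and \<open>K(t)/t\<close> is nondecreasing, the bound
  \<open>\<integral> f'(u) \<phi>(u)\<^sup>2 \<psi>\<^sup>2 \<le> C \<integral> u K(u) \<Gamma>\<psi>\<close> with \<open>\<Gamma>\<psi>(x) = \<integral> (\<psi>(x) - \<psi>(y))\<^sup>2 |x - y|\<^bsup>-N-2s\<^esup> dy\<close>. No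
  extension to the half space is needed. With \<open>\<psi>(x) = (1 + |x|/R)\<^bsup>-(N+2s)/2\<^esup>\<close> one has
  \<open>\<Gamma>\<psi> \<le> C R\<^bsup>-2s\<^esup> \<psi>\<^sup>2\<close>; if \<open>t K(t) \<le> C (f' \<phi>\<^sup>2)\<^bsup>\<theta>\<^esup>\<close>, Young's inequality bounds the left-hand side by
  \<open>C R\<^bsup>N - 2s/(1-\<theta>)\<^esup>\<close>, and \<open>R \<rightarrow> \<infinity>\<close> gives a contradiction when \<open>N (1 - \<theta>) < 2s\<close>.

  Near zero \<open>\<phi> = f\<^bsup>\<alpha>\<^esup>\<close> and \<open>K = k f\<^bsup>2\<alpha>-1\<^esup> f'\<close> with \<open>k < 1\<close> are admissible if \<open>(\<alpha> - 1)\<^sup>2 < 1/q\<^sub>0\<close>, and letting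
  \<open>\<alpha> \<rightarrow> 1 + 1/\<surd>q\<^sub>0\<close> the condition becomes \<open>N < 2s (2 q\<^sub>0 + 2 \<surd>q\<^sub>0 + 1)\<close>, which is equivalent to the
  conditions on \<open>p\<^sub>0\<close>. If \<open>q\<^sub>0 = \<infinity>\<close> or \<open>f(0) > 0\<close>, then \<open>f(t) \<ge> c t\<^bsup>1+\<epsilon>\<^esup>\<close> for small \<open>\<epsilon>\<close>, and testing the equation
  with \<open>\<psi>\<^sup>2/\<surd>u\<close> suffices, without stability. If \<open>f(0) = 0\<close>, then \<open>q\<^sub>0 \<ge> 1\<close>.
\<close>

text \<open>Origin of the dimension condition for finite \<open>q0\<close>: put
  \<open>\<rho> = 1/q0\<close>. Up to small losses in the exponents, near zero \<open>f'\<close>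
  behaves like \<open>f^\<rho>\<close> and \<open>t\<close> like \<open>f^(1-\<rho>)\<close>, so
  \<open>t K(t)\<close> behaves like \<open>f^(2\<alpha>)\<close> and \<open>f' \<phi>^2\<close>
  like \<open>f^(2\<alpha>+\<rho>)\<close>. Hence
  \<open>\<theta> = 2\<alpha>/(2\<alpha>+\<rho>)\<close>, and the condition on
  \<open>\<theta>\<close> reads \<open>N \<rho> < 2s (2\<alpha>+\<rho>)\<close>; insert the limiting
  \<open>\<alpha>\<close> and divide by \<open>\<rho>\<close>. Three obstacles shape the details.
  The limit \<open>q0\<close> says nothing about \<open>f\<close> away from zero, while
  \<open>u\<close> may take any value up to its bound, so \<open>\<phi>\<close> and \<open>K\<close>
  have to be continued with a strict gain. The principal value need not converge absolutely, so
  every symmetrization is done with a truncated kernel; the truncation is removed by monotone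
  convergence on one side and dominated convergence on the other.\<close>

section \<open>Integrals of the kernel\<close>

text \<open>The shells \<open>\<rho> n \<le> norm h < 2 * \<rho> n\<close> cover \<open>S\<close> up
  to the origin. On a shell \<open>norm h powr p\<close> is comparable to
  \<open>\<rho> n powr p\<close>, for either sign of \<open>p\<close> at the price of the factor
  \<open>2 powr \<bar>p\<bar>\<close>, and the enclosing ball has volume proportional to
  \<open>\<rho> n ^ N\<close>; summation replaces polar coordinates. The origin costs nothing
  because \<open>0 powr p = 0\<close>.\<close>

lemma nn_integral_norm_powr_dyadic:
  fixes S :: "'a::euclidean_space set" and \<rho> :: "nat \<Rightarrow> real" and p :: real
  assumes S: "\<And>h. h \<in> S \<Longrightarrow> h \<noteq> 0 \<Longrightarrow> \<exists>n. \<rho> n \<le> norm h \<and> norm h < 2 * \<rho> n"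
    and pos: "\<And>n. \<rho> n > 0"
    and sm: "summable (\<lambda>n. \<rho> n powr (p + DIM('a)))"
  shows "(\<integral>\<^sup>+h. ennreal (indicator S h * norm h powr p) \<partial>lborel) < \<infinity>"
proof -
  define N where "N = DIM('a)"
  define A where "A = (\<lambda>n. ball (0::'a) (2 * \<rho> n))"
  define V where "V = unit_ball_vol (real N) * 2 ^ N"
  have V: "V \<ge> 0" by (simp add: V_def)
  have A: "A n \<in> sets lborel" for n by (simp add: A_def)
  have pw: "norm h powr p \<le> 2 powr \<bar>p\<bar> * \<rho> n powr p" if "\<rho> n \<le> norm h" "norm h < 2 * \<rho> n" for h :: 'a and n
  proof (cases "p \<ge> 0")
    case True
    have "norm h powr p \<le> (2 * \<rho> n) powr p" using that True by (intro powr_mono2) auto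
    also have "\<dots> = 2 powr \<bar>p\<bar> * \<rho> n powr p" using True pos[of n] by (simp add: powr_mult)
    finally show ?thesis .
  next
    case False
    have "norm h powr p \<le> \<rho> n powr p" using that False pos[of n] by (intro powr_mono2') auto
    also have "\<dots> \<le> 2 powr \<bar>p\<bar> * \<rho> n powr p"
      using ge_one_powr_ge_zero[of 2 "\<bar>p\<bar>"] mult_right_mono[of 1 "2 powr \<bar>p\<bar>" "\<rho> n powr p"] by simp
    finally show ?thesis .
  qed
  have "(\<integral>\<^sup>+h. ennreal (indicator S h * norm h powr p) \<partial>lborel)
      \<le> (\<integral>\<^sup>+h. (\<Sum>n. ennreal (2 powr \<bar>p\<bar> * \<rho> n powr p) * indicator (A n) h) \<partial>lborel)"
  proof (intro nn_integral_mono)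
    fix h :: 'a
    show "ennreal (indicator S h * norm h powr p) \<le> (\<Sum>n. ennreal (2 powr \<bar>p\<bar> * \<rho> n powr p) * indicator (A n) h)"
    proof (cases "h \<in> S \<and> h \<noteq> 0")
      case True
      then obtain n where n: "\<rho> n \<le> norm h" "norm h < 2 * \<rho> n" using S by blast
      have "ennreal (indicator S h * norm h powr p) \<le> ennreal (2 powr \<bar>p\<bar> * \<rho> n powr p) * indicator (A n) h"
        using True n pw[OF n] by (auto simp: A_def intro!: ennreal_leI)
      also have "\<dots> \<le> (\<Sum>n. ennreal (2 powr \<bar>p\<bar> * \<rho> n powr p) * indicator (A n) h)"
        using sum_le_suminf[of "\<lambda>k. ennreal (2 powr \<bar>p\<bar> * \<rho> k powr p) * indicator (A k) h" "{n}"]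
        by (simp del: sum_mult_indicator)
      finally show ?thesis .
    qed auto
  qed
  also have "\<dots> = (\<Sum>n. ennreal (2 powr \<bar>p\<bar> * \<rho> n powr p) * emeasure lborel (A n))"
    using A by (subst nn_integral_suminf) (simp_all add: nn_integral_cmult_indicator)
  also have "\<dots> = (\<Sum>n. ennreal (2 powr \<bar>p\<bar> * V * \<rho> n powr (p + DIM('a))))"
  proof (intro suminf_cong)
    fix n
    have "emeasure lborel (A n) = ennreal (unit_ball_vol (real N) * (2 * \<rho> n) ^ N)"
      using pos[of n] by (simp add: A_def emeasure_ball N_def)
    then show "ennreal (2 powr \<bar>p\<bar> * \<rho> n powr p) * emeasure lborel (A n)
        = ennreal (2 powr \<bar>p\<bar> * V * \<rho> n powr (p + DIM('a)))"
      using pos[of n] by (simp add: V_def power_mult_distrib powr_add powr_realpow N_def mult_ac flip: ennreal_mult)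
  qed
  also have "\<dots> = ennreal (\<Sum>n. 2 powr \<bar>p\<bar> * V * \<rho> n powr (p + DIM('a)))"
    using V sm by (intro suminf_ennreal2) (auto intro: summable_mult)
  also have "\<dots> < \<infinity>" by simp
  finally show ?thesis .
qed

lemma powr_less_one': "x powr a < 1" if "0 < x" "x < 1" "0 < a" for x a :: real
  using that powr_less_mono2[of a x 1] by simp

lemma power_powr_swap: "(x ^ n) powr a = (x powr a) ^ n" if "x > 0" for x a :: real
  using that by (simp add: powr_power powr_powr mult.commute flip: powr_realpow)

lemma nn_integral_norm_powr_near:
  fixes a :: real
  assumes "a > 0"
  shows "(\<integral>\<^sup>+h. ennreal (indicator (ball 0 1) h * norm h powr (a - DIM('a))) \<partial>(lborel::'a::euclidean_space measure)) < \<infinity>"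
proof (rule nn_integral_norm_powr_dyadic[where \<rho> = "\<lambda>n. (1/2) ^ Suc n"])
  fix h :: 'a assume h: "h \<in> ball 0 1" "h \<noteq> 0"
  define P where "P = (\<lambda>n. (1/2::real) ^ n \<le> norm h)"
  have "\<exists>n. (1/2::real) ^ n < norm h" using h by (intro real_arch_pow_inv) auto
  then have ex: "\<exists>n. P n" unfolding P_def by (meson less_imp_le)
  define m where "m = (LEAST n. P n)"
  have Pm: "P m" using ex unfolding m_def by (rule LeastI_ex)
  have "m \<noteq> 0" using Pm h by (intro notI) (auto simp: P_def)
  then obtain n where n: "m = Suc n" by (cases m) auto
  have "\<not> P n" using not_less_Least[of n P] n by (simp add: m_def)
  then show "\<exists>n. (1/2) ^ Suc n \<le> norm h \<and> norm h < 2 * (1/2) ^ Suc n"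
    using Pm n by (intro exI[of _ n]) (auto simp: P_def)
next
  have "(\<lambda>n. ((1/2) ^ Suc n) powr (a - real DIM('a) + real DIM('a))) = (\<lambda>n. ((1/2) powr a) ^ Suc n)"
    by (simp add: power_powr_swap del: power_Suc)
  moreover have "summable (\<lambda>n. ((1/2::real) powr a) ^ Suc n)"
    using assms by (subst summable_Suc_iff) (auto intro!: summable_geometric powr_less_one')
  ultimately show "summable (\<lambda>n. ((1/2) ^ Suc n) powr (a - real DIM('a) + real DIM('a)))" by simp
qed auto

lemma nn_integral_norm_powr_far:
  fixes a r :: real
  assumes "a > 0" "r > 0"
  shows "(\<integral>\<^sup>+h. ennreal (indicator (- ball 0 r) h * norm h powr (- a - DIM('a))) \<partial>(lborel::'a::euclidean_space measure)) < \<infinity>"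
proof (rule nn_integral_norm_powr_dyadic[where \<rho> = "\<lambda>n. r * 2 ^ n"])
  fix h :: 'a assume h: "h \<in> - ball 0 r" "h \<noteq> 0"
  define P where "P = (\<lambda>n. norm h < r * 2 ^ n)"
  obtain n0 where "norm h / r < (2::real) ^ n0" using real_arch_pow[of 2] by auto
  then have ex: "\<exists>n. P n" using assms by (auto simp: P_def field_simps)
  define m where "m = (LEAST n. P n)"
  have Pm: "P m" using ex unfolding m_def by (rule LeastI_ex)
  have "m \<noteq> 0" using Pm h by (cases "m = 0") (auto simp: P_def)
  then obtain n where n: "m = Suc n" by (cases m) auto
  have "\<not> P n" using not_less_Least[of n P] n by (simp add: m_def)
  then show "\<exists>n. r * 2 ^ n \<le> norm h \<and> norm h < 2 * (r * 2 ^ n)"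
    using Pm n by (intro exI[of _ n]) (auto simp: P_def)
next
  have "(\<lambda>n. (r * 2 ^ n) powr (- a - real DIM('a) + real DIM('a))) = (\<lambda>n. r powr (-a) * (2 powr (-a)) ^ n)"
    using assms by (simp add: powr_mult power_powr_swap)
  moreover have "summable (\<lambda>n. r powr (-a) * (2 powr (-a)) ^ n)"
    using assms by (intro summable_mult summable_geometric) (simp add: powr_less_one)
  ultimately show "summable (\<lambda>n. (r * 2 ^ n) powr (- a - real DIM('a) + real DIM('a)))" by simp
qed (use assms in auto)

text \<open>The kernel without \<open>frac_const\<close>. Division by zero makes it 0 on the
  diagonal, which is harmless because the differences it multiplies vanish there.\<close>

definition kern :: "real \<Rightarrow> 'a::euclidean_space \<Rightarrow> real" where
  "kern s h = 1 / norm h powr (real DIM('a) + 2 * s)"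

lemma kern_nonneg [simp]: "kern s h \<ge> 0"
  and kern_minus [simp]: "kern s (- h) = kern s h"
  by (simp_all add: kern_def)

lemma borel_measurable_kern [measurable (raw)]:
  "g \<in> borel_measurable M \<Longrightarrow> (\<lambda>x. kern s (g x)) \<in> borel_measurable M"
  unfolding kern_def by measurable

lemma kern_powr: "kern s (h::'a::euclidean_space) = norm h powr (- (2 * s) - DIM('a))"
proof -
  have "- (2 * s) - DIM('a) = - (DIM('a) + 2 * s)" by simp
  then show ?thesis unfolding kern_def by (simp only: powr_minus_divide)
qed

lemma nn_integral_kern_far:
  assumes "0 < s" "0 < r"
  shows "(\<integral>\<^sup>+h. ennreal (indicator (- ball 0 r) h * kern s h) \<partial>(lborel::'a::euclidean_space measure)) < \<infinity>"
  using nn_integral_norm_powr_far[where a="2 * s" and r=r and ?'a='a] assms by (simp add: kern_powr)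

lemma nn_integral_kern_near:
  assumes "2 * s < b"
  shows "(\<integral>\<^sup>+h. ennreal (indicator (ball 0 1) h * (norm h powr b * kern s h)) \<partial>(lborel::'a::euclidean_space measure)) < \<infinity>"
  using nn_integral_norm_powr_near[where a="b - 2 * s" and ?'a='a] assms
  by (simp add: kern_powr algebra_simps flip: powr_add)

text \<open>The shape of both majorants used below: a gain of order \<open>b > 2 * s\<close> at the
  origin makes the singularity integrable, and a constant suffices at infinity.\<close>

lemma nn_integral_kern_min:
  assumes "0 < s" "2 * s < b" "C \<ge> 0" "D \<ge> 0"
  shows "(\<integral>\<^sup>+h. ennreal ((if norm h < 1 then C * norm h powr b else D) * kern s h)
      \<partial>(lborel::'a::euclidean_space measure)) < \<infinity>"
proof -
  define g1 where "g1 = (\<lambda>h::'a. ennreal (indicator (ball 0 1) h * (norm h powr b * kern s h)))"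
  define g2 where "g2 = (\<lambda>h::'a. ennreal (indicator (- ball 0 1) h * kern s h))"
  have [measurable]: "ball (0::'a) 1 \<in> sets borel" by simp
  have [measurable]: "g1 \<in> borel_measurable borel" unfolding g1_def by measurable
  have [measurable]: "g2 \<in> borel_measurable borel" unfolding g2_def by measurable
  have "(\<integral>\<^sup>+h. ennreal ((if norm h < 1 then C * norm h powr b else D) * kern s h)
      \<partial>(lborel::'a::euclidean_space measure))
    = (\<integral>\<^sup>+h. ennreal C * g1 h + ennreal D * g2 h \<partial>lborel)"
    using assms by (intro nn_integral_cong) (auto simp: g1_def g2_def ennreal_mult mult.assoc split: split_indicator)
  also have "\<dots> = ennreal C * (\<integral>\<^sup>+h. g1 h \<partial>lborel) + ennreal D * (\<integral>\<^sup>+h. g2 h \<partial>lborel)"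
    by (simp add: nn_integral_add nn_integral_cmult)
  also have "\<dots> < \<infinity>"
    using nn_integral_kern_near[OF assms(2), where ?'a='a] nn_integral_kern_far[OF assms(1), where r=1 and ?'a='a]
    unfolding g1_def[symmetric] g2_def[symmetric] by (simp add: ennreal_mult_less_top)
  finally show ?thesis .
qed

section \<open>Regularity and the truncated operator\<close>

lemma C_k_imp_continuous: "C_k k u \<Longrightarrow> continuous_on UNIV u"
  by (cases k) (auto intro: differentiable_imp_continuous_on)

lemma frechet_derivative_partial:
  fixes u :: "'a::euclidean_space \<Rightarrow> real"
  assumes "u differentiable (at x)"
  shows "frechet_derivative u (at x) v = (\<Sum>i\<in>Basis. (v \<bullet> i) * partial i u x)"
proof -
  have lin: "linear (frechet_derivative u (at x))"
    using assms by (rule linear_frechet_derivative)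
  have "frechet_derivative u (at x) v = frechet_derivative u (at x) (\<Sum>i\<in>Basis. (v \<bullet> i) *\<^sub>R i)"
    by (simp add: euclidean_representation)
  also have "\<dots> = (\<Sum>i\<in>Basis. (v \<bullet> i) * partial i u x)"
    by (simp add: linear_sum[OF lin] linear_cmul[OF lin] partial_def)
  finally show ?thesis .
qed

lemma abs_sum_inner_le:
  fixes v :: "'a::euclidean_space"
  shows "\<bar>\<Sum>i\<in>Basis. (v \<bullet> i) * a i\<bar> \<le> norm v * (\<Sum>i\<in>Basis. \<bar>a i\<bar>)"
proof -
  have "\<bar>\<Sum>i\<in>Basis. (v \<bullet> i) * a i\<bar> \<le> (\<Sum>i\<in>Basis. \<bar>v \<bullet> i\<bar> * \<bar>a i\<bar>)"
    by (rule order_trans[OF sum_abs]) (simp add: abs_mult)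
  also have "\<dots> \<le> (\<Sum>i\<in>Basis. norm v * \<bar>a i\<bar>)"
    by (intro sum_mono mult_right_mono Basis_le_norm) auto
  finally show ?thesis by (simp add: sum_distrib_left)
qed

lemma C1_lipschitz_on_cball:
  fixes g :: "'a::euclidean_space \<Rightarrow> real"
  assumes diff: "g differentiable_on UNIV"
    and cont: "\<And>i. i \<in> Basis \<Longrightarrow> continuous_on UNIV (partial i g)"
  shows "\<exists>C\<ge>0. \<forall>x\<in>cball 0 R. \<forall>y\<in>cball 0 R. \<bar>g x - g y\<bar> \<le> C * dist x y"
proof -
  have c: "continuous_on (cball (0::'a) R) (\<lambda>x. \<Sum>i\<in>Basis. \<bar>partial i g x\<bar>)"
    by (intro continuous_intros continuous_on_subset[OF cont]) auto
  have "bounded ((\<lambda>x. \<Sum>i\<in>Basis. \<bar>partial i g x\<bar>) ` cball (0::'a) R)"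
    by (intro compact_imp_bounded compact_continuous_image c) auto
  then obtain B where B: "\<And>x. x \<in> cball (0::'a) R \<Longrightarrow> (\<Sum>i\<in>Basis. \<bar>partial i g x\<bar>) \<le> B" and B0: "B > 0"
    unfolding bounded_pos by fastforce
  have "\<bar>g x - g y\<bar> \<le> B * dist x y" if "x \<in> cball 0 R" "y \<in> cball 0 R" for x y
  proof -
    have "norm (g x - g y) \<le> B * norm (x - y)"
    proof (rule differentiable_bound[of "cball 0 R" g "\<lambda>x. frechet_derivative g (at x)"])
      fix z :: 'a assume z: "z \<in> cball 0 R"
      have d: "g differentiable (at z)" using diff by (simp add: differentiable_on_def)
      then show "(g has_derivative frechet_derivative g (at z)) (at z within cball 0 R)"
        using frechet_derivative_works has_derivative_at_withinI by blast
      show "onorm (frechet_derivative g (at z)) \<le> B"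
      proof (rule onorm_le)
        fix v
        have "norm (frechet_derivative g (at z) v) \<le> norm v * (\<Sum>i\<in>Basis. \<bar>partial i g z\<bar>)"
          using abs_sum_inner_le by (simp add: frechet_derivative_partial[OF d])
        also have "\<dots> \<le> norm v * B" using B[OF z] by (rule mult_left_mono) simp
        also have "\<dots> = B * norm v" by simp
        finally show "norm (frechet_derivative g (at z) v) \<le> B * norm v" .
      qed
    qed (use that in auto)
    then show ?thesis by (simp add: dist_norm)
  qed
  then show ?thesis using B0 by (intro exI[of _ B]) auto
qed

text \<open>Apply the mean value theorem to \<open>u (x + t h) + u (x - t h)\<close> for
  \<open>t\<close> in [0,1]: the second difference becomes a difference of first derivatives at two
  points at distance at most \<open>2 * norm h\<close>, so Hoelder continuity of the gradient adds
  \<open>a\<close> to the power 1 coming from \<open>h\<close> itself.\<close>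

lemma second_difference_of_gradient:
  fixes u :: "'a::euclidean_space \<Rightarrow> real"
  assumes diff: "u differentiable_on UNIV"
    and H: "\<And>R i. i \<in> Basis \<Longrightarrow> \<exists>C. \<forall>x\<in>cball 0 R. \<forall>y\<in>cball 0 R.
              \<bar>partial i u x - partial i u y\<bar> \<le> C * dist x y powr a"
    and a: "a \<ge> 0"
  shows "\<exists>C\<ge>0. \<forall>x h. norm x \<le> R \<longrightarrow> norm h \<le> 1 \<longrightarrow>
           \<bar>2 * u x - u (x + h) - u (x - h)\<bar> \<le> C * norm h powr (1 + a)"
proof -
  from H[of _ "R + 1"] obtain C where C: "\<And>i x y. i \<in> Basis \<Longrightarrow> x \<in> cball 0 (R + 1) \<Longrightarrow> y \<in> cball 0 (R + 1) \<Longrightarrow>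
     \<bar>partial i u x - partial i u y\<bar> \<le> C i * dist x y powr a" by metis
  define K where "K = (\<Sum>i\<in>(Basis::'a set). \<bar>C i\<bar>) * 2 powr a"
  have K: "K \<ge> 0" by (auto simp: K_def intro!: mult_nonneg_nonneg sum_nonneg)
  have "\<bar>2 * u x - u (x + h) - u (x - h)\<bar> \<le> K * norm h powr (1 + a)"
    if x: "norm x \<le> R" and h: "norm h \<le> 1" for x h
  proof -
    define g where "g = (\<lambda>t::real. u (x + t *\<^sub>R h) + u (x - t *\<^sub>R h))"
    define D where "D = (\<lambda>z. frechet_derivative u (at z))"
    have dz: "u differentiable (at z)" for z using diff by (simp add: differentiable_on_def)
    have uD: "(u has_derivative D z) (at z)" for z
      using dz unfolding D_def by (simp add: frechet_derivative_works[symmetric])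
    have linD: "linear (D z)" for z using uD by (rule has_derivative_linear)
    have "(g has_real_derivative (D (x + t *\<^sub>R h) h - D (x - t *\<^sub>R h) h)) (at t)" for t
    proof -
      have 1: "((\<lambda>t. x + t *\<^sub>R h) has_derivative (\<lambda>t. t *\<^sub>R h)) (at t)"
        by (auto intro!: derivative_eq_intros)
      have 2: "((\<lambda>t. x - t *\<^sub>R h) has_derivative (\<lambda>t. - (t *\<^sub>R h))) (at t)"
        by (auto intro!: derivative_eq_intros)
      have "(g has_derivative (\<lambda>t'. D (x + t *\<^sub>R h) (t' *\<^sub>R h) + D (x - t *\<^sub>R h) (- (t' *\<^sub>R h)))) (at t)"
        unfolding g_def by (intro has_derivative_add has_derivative_compose[OF 1 uD] has_derivative_compose[OF 2 uD])
      also have "(\<lambda>t'. D (x + t *\<^sub>R h) (t' *\<^sub>R h) + D (x - t *\<^sub>R h) (- (t' *\<^sub>R h)))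
         = (*) (D (x + t *\<^sub>R h) h - D (x - t *\<^sub>R h) h)"
        by (auto simp: linear_cmul[OF linD] linear_neg[OF linD] algebra_simps)
      finally show ?thesis by (simp add: has_field_derivative_def)
    qed
    then obtain \<theta> where \<theta>: "0 < \<theta>" "\<theta> < 1"
      "g 1 - g 0 = (1 - 0) * (D (x + \<theta> *\<^sub>R h) h - D (x - \<theta> *\<^sub>R h) h)"
      using MVT2[of 0 1 g "\<lambda>t. D (x + t *\<^sub>R h) h - D (x - t *\<^sub>R h) h"] by auto
    define y z where "y = x + \<theta> *\<^sub>R h" and "z = x - \<theta> *\<^sub>R h"
    have nh: "norm (\<theta> *\<^sub>R h) \<le> norm h" using \<theta> by (simp add: mult_left_le_one_le)
    have yz: "y \<in> cball 0 (R + 1)" "z \<in> cball 0 (R + 1)"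
      using norm_triangle_ineq[of x "\<theta> *\<^sub>R h"] norm_triangle_ineq4[of x "\<theta> *\<^sub>R h"] nh x h
      by (auto simp: y_def z_def)
    have "dist y z = 2 * norm (\<theta> *\<^sub>R h)"
    proof -
      have "y - z = 2 *\<^sub>R (\<theta> *\<^sub>R h)" by (simp add: y_def z_def scaleR_2 flip: scaleR_add_left)
      then show ?thesis by (simp add: dist_norm abs_mult)
    qed
    then have dyz: "dist y z powr a \<le> 2 powr a * norm h powr a"
      using nh a by (simp add: powr_mult[symmetric]) (intro powr_mono2, auto)
    have "\<bar>2 * u x - u (x + h) - u (x - h)\<bar> = \<bar>D y h - D z h\<bar>"
      using \<theta>(3) by (simp add: g_def y_def z_def)
    also have "D y h - D z h = (\<Sum>i\<in>Basis. (h \<bullet> i) * (partial i u y - partial i u z))"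
      by (simp add: D_def frechet_derivative_partial[OF dz] sum_subtractf right_diff_distrib)
    also have "\<bar>\<dots>\<bar> \<le> norm h * (\<Sum>i\<in>Basis. \<bar>partial i u y - partial i u z\<bar>)"
      by (rule abs_sum_inner_le)
    also have "\<dots> \<le> norm h * (\<Sum>i\<in>Basis. \<bar>C i\<bar> * (2 powr a * norm h powr a))"
    proof (intro mult_left_mono sum_mono)
      fix i :: 'a assume i: "i \<in> Basis"
      have "\<bar>partial i u y - partial i u z\<bar> \<le> C i * dist y z powr a" using C[OF i yz] .
      also have "\<dots> \<le> \<bar>C i\<bar> * dist y z powr a" by (intro mult_right_mono) auto
      also have "\<dots> \<le> \<bar>C i\<bar> * (2 powr a * norm h powr a)" by (intro mult_left_mono dyz) auto
      finally show "\<bar>partial i u y - partial i u z\<bar> \<le> \<bar>C i\<bar> * (2 powr a * norm h powr a)" .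
    qed auto
    also have "\<dots> = K * (norm h * norm h powr a)"
      by (simp add: K_def sum_distrib_right sum_distrib_left mult_ac)
    also have "norm h * norm h powr a = norm h powr (1 + a)"
      by (simp add: powr_add)
    finally show ?thesis .
  qed
  then show ?thesis using K by blast
qed

lemma locally_Hoelder_cball:
  "locally_Hoelder a v \<Longrightarrow> \<exists>C. \<forall>x\<in>cball 0 R. \<forall>y\<in>cball 0 R. \<bar>v x - v y\<bar> \<le> C * dist x y powr a"
  by (auto simp: locally_Hoelder_def simp del: mem_cball)

text \<open>The case split is on how many classical derivatives \<open>2 * \<sigma>\<close>
  provides. With none or one, \<open>b = 2 * \<sigma> > 2 * s\<close>; with two or more the gradient
  is locally Lipschitz and \<open>b = 2\<close>, which exceeds \<open>2 * s\<close> because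
  \<open>s < 1\<close>.\<close>

lemma C_real_second_difference:
  fixes u :: "'a::euclidean_space \<Rightarrow> real"
  assumes u: "u \<in> C_real (2 * \<sigma>)" and s: "0 < s" "s < 1" "s < \<sigma>"
  obtains b where "b > 2 * s"
    "\<And>R. \<exists>C\<ge>0. \<forall>x h. norm x \<le> R \<longrightarrow> norm h \<le> 1 \<longrightarrow>
           \<bar>2 * u x - u (x + h) - u (x - h)\<bar> \<le> C * norm h powr b"
proof -
  define n where "n = nat \<lfloor>2 * \<sigma>\<rfloor>"
  have Ck: "C_k n u" and Ho: "\<And>is. set is \<subseteq> Basis \<Longrightarrow> length is = n \<Longrightarrow>
        locally_Hoelder (2 * \<sigma> - real_of_int \<lfloor>2 * \<sigma>\<rfloor>) (foldr partial is u)"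
    using u by (auto simp: C_real_def n_def)
  have fl: "real_of_int \<lfloor>2 * \<sigma>\<rfloor> = real n" using s by (simp add: n_def)
  consider "n = 0" | "n = 1" | m where "n = Suc (Suc m)" by (metis One_nat_def not0_implies_Suc)
  then show ?thesis
  proof cases
    case 1
    have "locally_Hoelder (2 * \<sigma> - real n) (foldr partial [] u)"
      unfolding fl[symmetric] by (rule Ho) (use 1 in auto)
    then have H: "locally_Hoelder (2 * \<sigma>) u" by (simp add: 1)
    have "\<exists>C\<ge>0. \<forall>x h. norm x \<le> R \<longrightarrow> norm h \<le> 1 \<longrightarrow>
           \<bar>2 * u x - u (x + h) - u (x - h)\<bar> \<le> C * norm h powr (2 * \<sigma>)" for R
    proof -
      from H obtain C where C: "\<And>x y. x \<in> cball 0 (R + 1) \<Longrightarrow> y \<in> cball 0 (R + 1) \<Longrightarrow> \<bar>u x - u y\<bar> \<le> C * dist x y powr (2 * \<sigma>)"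
        using locally_Hoelder_cball by metis
      have "\<bar>2 * u x - u (x + h) - u (x - h)\<bar> \<le> (2 * \<bar>C\<bar>) * norm h powr (2 * \<sigma>)"
        if x: "norm x \<le> R" and h: "norm h \<le> 1" for x h
      proof -
        have mem: "x \<in> cball 0 (R + 1)" "x + h \<in> cball 0 (R + 1)" "x - h \<in> cball 0 (R + 1)"
          using norm_triangle_ineq[of x h] norm_triangle_ineq4[of x h] x h by auto
        have "\<bar>u x - u (x + h)\<bar> \<le> C * norm h powr (2 * \<sigma>)" 
          using C[OF mem(1,2)] by (simp add: dist_norm)
        moreover have "\<bar>u x - u (x - h)\<bar> \<le> C * norm h powr (2 * \<sigma>)" 
          using C[OF mem(1,3)] by (simp add: dist_norm)
        moreover have "C * norm h powr (2 * \<sigma>) \<le> \<bar>C\<bar> * norm h powr (2 * \<sigma>)"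
          by (intro mult_right_mono) auto
        ultimately show ?thesis by linarith
      qed
      then show ?thesis by (intro exI[of _ "2 * \<bar>C\<bar>"]) auto
    qed
    then show ?thesis using s by (intro that[of "2 * \<sigma>"]) auto
  next
    case 2
    have diff: "u differentiable_on UNIV" using Ck 2 by simp
    have H: "locally_Hoelder (2 * \<sigma> - 1) (partial i u)" if "i \<in> Basis" for i
    proof -
      have "locally_Hoelder (2 * \<sigma> - real n) (foldr partial [i] u)"
        unfolding fl[symmetric] by (rule Ho) (use 2 that in auto)
      then show ?thesis by (simp add: 2)
    qed
    have a: "2 * \<sigma> - 1 \<ge> 0" using of_int_floor_le[of "2 * \<sigma>"] 2 unfolding fl by simp
    have "\<exists>C\<ge>0. \<forall>x h. norm x \<le> R \<longrightarrow> norm h \<le> 1 \<longrightarrow>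
           \<bar>2 * u x - u (x + h) - u (x - h)\<bar> \<le> C * norm h powr (1 + (2 * \<sigma> - 1))" for R
    proof (rule second_difference_of_gradient[OF diff _ a])
      fix R and i :: 'a assume "i \<in> Basis"
      then show "\<exists>C. \<forall>x\<in>cball 0 R. \<forall>y\<in>cball 0 R. \<bar>partial i u x - partial i u y\<bar> \<le> C * dist x y powr (2 * \<sigma> - 1)"
        by (intro locally_Hoelder_cball H)
    qed
    then show ?thesis using s by (intro that[of "2 * \<sigma>"]) auto
  next
    case (3 m)
    have diff: "u differentiable_on UNIV" using Ck 3 by simp
    have pd: "partial i u differentiable_on UNIV" "\<And>j. j \<in> Basis \<Longrightarrow> C_k m (partial j (partial i u))" if "i \<in> Basis" for i
      using Ck 3 that by auto
    have "\<exists>C\<ge>0. \<forall>x h. norm x \<le> R \<longrightarrow> norm h \<le> 1 \<longrightarrow>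
           \<bar>2 * u x - u (x + h) - u (x - h)\<bar> \<le> C * norm h powr (1 + 1)" for R
    proof (rule second_difference_of_gradient[OF diff])
      fix R and i :: 'a assume i: "i \<in> Basis"
      show "\<exists>C. \<forall>x\<in>cball 0 R. \<forall>y\<in>cball 0 R. \<bar>partial i u x - partial i u y\<bar> \<le> C * dist x y powr 1"
        using C1_lipschitz_on_cball[OF pd(1)[OF i] C_k_imp_continuous[OF pd(2)[OF i]], of R] by auto
    qed auto
    then show ?thesis using s by (intro that[of 2]) auto
  qed
qed

section \<open>The singular integral with a hole around its centre\<close>

definition trunc_kern :: "real \<Rightarrow> real \<Rightarrow> 'a::euclidean_space \<Rightarrow> real" where
  "trunc_kern s \<epsilon> h = indicator (- ball 0 \<epsilon>) h * kern s h"

lemma trunc_kern_nonneg [simp]: "trunc_kern s \<epsilon> h \<ge> 0"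
  and trunc_kern_minus [simp]: "trunc_kern s \<epsilon> (- h) = trunc_kern s \<epsilon> h"
  and trunc_kern_le: "trunc_kern s \<epsilon> h \<le> kern s h"
  by (auto simp: trunc_kern_def split: split_indicator)

lemma trunc_kern_commute: "trunc_kern s \<epsilon> (x - y) = trunc_kern s \<epsilon> (y - x)"
  using trunc_kern_minus[of s \<epsilon> "x - y"] by simp

lemma borel_measurable_trunc_kern [measurable (raw)]:
  fixes g :: "'b \<Rightarrow> 'a::euclidean_space"
  assumes [measurable]: "g \<in> borel_measurable M"
  shows "(\<lambda>x. trunc_kern s \<epsilon> (g x)) \<in> borel_measurable M"
proof -
  have [measurable]: "ball (0::'a) \<epsilon> \<in> sets borel" by simp
  show ?thesis unfolding trunc_kern_def by measurable
qed

lemma integrable_trunc_kern: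
  assumes "0 < s" "0 < \<epsilon>"
  shows "integrable lborel (trunc_kern s \<epsilon> :: 'a::euclidean_space \<Rightarrow> real)"
proof (rule integrableI_nonneg)
  show "(\<integral>\<^sup>+x. ennreal (trunc_kern s \<epsilon> x) \<partial>(lborel::'a measure)) < \<infinity>"
    using nn_integral_kern_far[OF assms, where ?'a='a] by (simp add: trunc_kern_def)
  have "(\<lambda>x. trunc_kern s \<epsilon> (x::'a)) \<in> borel_measurable lborel" by measurable
  then show "trunc_kern s \<epsilon> \<in> borel_measurable (lborel::'a measure)" by simp
qed auto

text \<open>The quantity whose limit for \<open>\<epsilon>\<close> tending to 0 is the principal
  value, up to \<open>frac_const\<close>. Removing a ball makes the kernel integrable and keeps it
  even, so Fubini and reflection are available before the limit.\<close>

definition trunc_lap :: "real \<Rightarrow> ('a::euclidean_space \<Rightarrow> real) \<Rightarrow> real \<Rightarrow> 'a \<Rightarrow> real" where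
  "trunc_lap s u \<epsilon> x = (LINT y|lborel. trunc_kern s \<epsilon> (y - x) * (u x - u y))"

section \<open>Translations and dilations of integrals\<close>

lemma nn_integral_lborel_affine:
  fixes f :: "'a::euclidean_space \<Rightarrow> ennreal"
  assumes [measurable]: "f \<in> borel_measurable borel" and c: "c \<noteq> 0"
  shows "(\<integral>\<^sup>+x. f x \<partial>lborel) = ennreal (\<bar>c\<bar> ^ DIM('a)) * (\<integral>\<^sup>+x. f (t + c *\<^sub>R x) \<partial>lborel)"
proof -
  have "(\<integral>\<^sup>+x. f x \<partial>lborel) = (\<integral>\<^sup>+x. f x \<partial>density (distr lborel borel (\<lambda>x. t + c *\<^sub>R x)) (\<lambda>_. \<bar>c\<bar> ^ DIM('a)))"
    by (subst lborel_affine[OF c, of t]) simp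
  also have "\<dots> = ennreal (\<bar>c\<bar> ^ DIM('a)) * (\<integral>\<^sup>+x. f (t + c *\<^sub>R x) \<partial>lborel)"
    by (simp add: nn_integral_density nn_integral_distr nn_integral_cmult)
  finally show ?thesis .
qed

lemma nn_integral_lborel_translate:
  fixes f :: "'a::euclidean_space \<Rightarrow> ennreal"
  assumes [measurable]: "f \<in> borel_measurable borel"
  shows "(\<integral>\<^sup>+y. f (x + y) \<partial>lborel) = (\<integral>\<^sup>+y. f y \<partial>lborel)"
    and "(\<integral>\<^sup>+y. f (x - y) \<partial>lborel) = (\<integral>\<^sup>+y. f y \<partial>lborel)"
    and "(\<integral>\<^sup>+y. f (y - x) \<partial>lborel) = (\<integral>\<^sup>+y. f y \<partial>lborel)"
  using nn_integral_lborel_affine[OF assms, of 1 x] nn_integral_lborel_affine[OF assms, of "-1" x]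
    nn_integral_lborel_affine[OF assms, of 1 "-x"]
  by simp_all

lemma integral_lborel_translate:
  fixes f :: "'a::euclidean_space \<Rightarrow> real"
  assumes [measurable]: "f \<in> borel_measurable borel"
  shows "(LINT y|lborel. f (x + y)) = (LINT y|lborel. f y)"
    and "(LINT y|lborel. f (x - y)) = (LINT y|lborel. f y)"
proof -
  have *: "distr lborel borel (\<lambda>y. x + c *\<^sub>R y) = lborel" if "\<bar>c\<bar> = 1" for c :: real
    using lborel_affine[of c x] that by (auto simp: density_1)
  have "(LINT y|lborel. f y) = (LINT y|distr lborel borel (\<lambda>y. x + 1 *\<^sub>R y). f y)"
    by (simp only: *[of 1] abs_one)
  also have "\<dots> = (LINT y|lborel. f (x + y))" by (subst integral_distr) auto
  finally show "(LINT y|lborel. f (x + y)) = (LINT y|lborel. f y)" by simp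
  have "(LINT y|lborel. f y) = (LINT y|distr lborel borel (\<lambda>y. x + (-1) *\<^sub>R y). f y)"
    by (subst *) auto
  also have "\<dots> = (LINT y|lborel. f (x - y))" by (subst integral_distr) auto
  finally show "(LINT y|lborel. f (x - y)) = (LINT y|lborel. f y)" by simp
qed

lemma integrable_lborel_translate:
  fixes f :: "'a::euclidean_space \<Rightarrow> real"
  assumes "integrable lborel f"
  shows "integrable lborel (\<lambda>y. f (x + y))" "integrable lborel (\<lambda>y. f (x - y))" "integrable lborel (\<lambda>y. f (y - x))"
proof -
  have [measurable]: "f \<in> borel_measurable borel" using assms by auto
  show "integrable lborel (\<lambda>y. f (x + y))" "integrable lborel (\<lambda>y. f (x - y))" "integrable lborel (\<lambda>y. f (y - x))"
    using assms nn_integral_lborel_translate[of "\<lambda>y. ennreal (norm (f y))"]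
    unfolding integrable_iff_bounded by auto
qed

lemma trunc_lap_eq:
  fixes u :: "'a::euclidean_space \<Rightarrow> real"
  assumes u: "continuous_on UNIV u"
  shows "trunc_lap s u \<epsilon> x =
    (LINT y:- ball x \<epsilon>|lebesgue. (u x - u y) / norm (x - y) powr (real DIM('a) + 2 * s))"
proof -
  have [measurable]: "u \<in> borel_measurable borel" using u by (rule borel_measurable_continuous_onI)
  have "(LINT y:- ball x \<epsilon>|lebesgue. (u x - u y) / norm (x - y) powr (real DIM('a) + 2 * s))
     = (LINT y|lebesgue. trunc_kern s \<epsilon> (y - x) * (u x - u y))"
    unfolding set_lebesgue_integral_def
    by (intro Bochner_Integration.integral_cong)
       (auto simp: trunc_kern_def kern_def dist_norm norm_minus_commute split: split_indicator)
  also have "\<dots> = trunc_lap s u \<epsilon> x"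
    unfolding trunc_lap_def by (rule integral_completion) measurable
  finally show ?thesis ..
qed

lemma has_frac_laplacian_trunc_lap:
  fixes u :: "'a::euclidean_space \<Rightarrow> real"
  assumes "has_frac_laplacian s u x v" "continuous_on UNIV u"
  shows "(\<lambda>n. frac_const DIM('a) s * trunc_lap s u (1 / real (Suc n)) x) \<longlonglongrightarrow> v"
proof -
  have "filterlim (\<lambda>n. 1 / real (Suc n)) (at_right 0) sequentially"
    by (rule tendsto_imp_filterlim_at_right[OF LIMSEQ_Suc[OF lim_1_over_n]]) auto
  then show ?thesis
    using assms(1) filterlim_compose unfolding has_frac_laplacian_def trunc_lap_eq[OF assms(2)] by blast
qed

text \<open>Averaging over \<open>h\<close> and \<open>-h\<close> replaces the first difference by
  the second one, whose order \<open>b > 2 * s\<close> beats the singularity. The resulting majorant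
  \<open>G\<close> does not see \<open>\<epsilon>\<close>; this uniformity is what dominated
  convergence will need.\<close>

lemma trunc_lap_bounded:
  fixes u :: "'a::euclidean_space \<Rightarrow> real"
  assumes u: "continuous_on UNIV u" and M: "\<And>x. \<bar>u x\<bar> \<le> M" and s: "0 < s" and b: "2 * s < b"
    and C: "\<And>x h. norm x \<le> R \<Longrightarrow> norm h \<le> 1 \<Longrightarrow> \<bar>2 * u x - u (x + h) - u (x - h)\<bar> \<le> C * norm h powr b"
    and C0: "C \<ge> 0"
  shows "\<exists>B. \<forall>x \<epsilon>. norm x \<le> R \<longrightarrow> 0 < \<epsilon> \<longrightarrow> \<bar>trunc_lap s u \<epsilon> x\<bar> \<le> B"
proof -
  have [measurable]: "u \<in> borel_measurable borel" using u by (rule borel_measurable_continuous_onI)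
  have M0: "M \<ge> 0" using M[of 0] by simp
  define G where "G = (\<lambda>h::'a. (if norm h < 1 then C * norm h powr b else 4 * M) * kern s h)"
  have [measurable]: "G \<in> borel_measurable borel" unfolding G_def by measurable
  have intG: "integrable lborel G"
    using nn_integral_kern_min[OF s b C0, of "4 * M", where ?'a='a] M0 C0
    by (intro integrableI_nonneg) (auto simp: G_def)
  have "\<bar>trunc_lap s u \<epsilon> x\<bar> \<le> (LINT h|lborel. G h)" if x: "norm x \<le> R" and e: "\<epsilon> > 0" for x \<epsilon>
  proof -
    define f where "f = (\<lambda>h. trunc_kern s \<epsilon> h * (u x - u (x + h)))"
    define g where "g = (\<lambda>h. trunc_kern s \<epsilon> h * (u x - u (x - h)))"
    have [measurable]: "f \<in> borel_measurable borel" "g \<in> borel_measurable borel" 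
      unfolding f_def g_def by (measurable, measurable)
    have dif: "\<bar>u y - u z\<bar> \<le> 2 * M" for y z using M[of y] M[of z] by linarith
    have "integrable lborel (\<lambda>h::'a. trunc_kern s \<epsilon> h * (2 * M))"
      using integrable_trunc_kern[OF s e, where ?'a='a] by (rule integrable_mult_left)
    note i = this
    have "norm (f h) \<le> norm (trunc_kern s \<epsilon> h * (2 * M))" "norm (g h) \<le> norm (trunc_kern s \<epsilon> h * (2 * M))" for h
      using dif M0 by (simp_all add: f_def g_def abs_mult mult_left_mono)
    then have int: "integrable lborel f" "integrable lborel g"
      by (auto intro!: Bochner_Integration.integrable_bound[OF i])
    have 1: "trunc_lap s u \<epsilon> x = (LINT h|lborel. f h)"
      unfolding trunc_lap_def f_def
      using integral_lborel_translate(1)[of "\<lambda>y. trunc_kern s \<epsilon> (y - x) * (u x - u y)" x] by simp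
    have 2: "(LINT h|lborel. f h) = (LINT h|lborel. g h)"
      using integral_lborel_translate(2)[of f 0] by (simp add: f_def g_def)
    have "2 * trunc_lap s u \<epsilon> x = (LINT h|lborel. f h + g h)"
      using 1 2 int by simp
    also have "\<bar>\<dots>\<bar> \<le> (LINT h|lborel. G h)"
    proof (rule integral_abs_bound_integral)
      fix h :: 'a
      have "f h + g h = trunc_kern s \<epsilon> h * (2 * u x - u (x + h) - u (x - h))"
        by (simp add: f_def g_def algebra_simps)
      then have "\<bar>f h + g h\<bar> = trunc_kern s \<epsilon> h * \<bar>2 * u x - u (x + h) - u (x - h)\<bar>"
        by (simp add: abs_mult)
      also have "\<dots> \<le> kern s h * \<bar>2 * u x - u (x + h) - u (x - h)\<bar>"
        by (intro mult_right_mono trunc_kern_le) auto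
      also have "\<dots> \<le> kern s h * (if norm h < 1 then C * norm h powr b else 4 * M)"
        using C[OF x, of h] M[of x] M[of "x + h"] M[of "x - h"]
        by (intro mult_left_mono) (auto split: if_splits)
      finally show "\<bar>f h + g h\<bar> \<le> G h" by (simp add: G_def mult.commute)
    qed (use int intG in auto)
    finally have "2 * \<bar>trunc_lap s u \<epsilon> x\<bar> \<le> (LINT h|lborel. G h)" by (simp add: abs_mult)
    then show ?thesis by linarith
  qed
  then show ?thesis by blast
qed

lemma trunc_lap_measurable:
  fixes u :: "'a::euclidean_space \<Rightarrow> real"
  assumes [measurable]: "u \<in> borel_measurable borel"
  shows "trunc_lap s u \<epsilon> \<in> borel_measurable borel"
proof -
  have "(\<lambda>x. LINT y|lborel. trunc_kern s \<epsilon> (y - x) * (u x - u y)) \<in> borel_measurable borel"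
    by (rule lborel.borel_measurable_lebesgue_integral) measurable
  then show ?thesis by (simp add: trunc_lap_def[abs_def])
qed

lemma trunc_lap_test_tendsto:
  fixes u :: "'a::euclidean_space \<Rightarrow> real"
  assumes u: "continuous_on UNIV u"
    and B: "\<And>x \<epsilon>. norm x \<le> R \<Longrightarrow> 0 < \<epsilon> \<Longrightarrow> \<bar>trunc_lap s u \<epsilon> x\<bar> \<le> B"
    and W [measurable]: "W \<in> borel_measurable borel" and WD: "\<And>x. \<bar>W x\<bar> \<le> D * indicator (cball 0 R) x"
    and lim: "\<And>x. (\<lambda>n. trunc_lap s u (1 / real (Suc n)) x) \<longlonglongrightarrow> g x"
  shows "(\<lambda>n. LINT x|lborel. W x * trunc_lap s u (1 / real (Suc n)) x) \<longlonglongrightarrow> (LINT x|lborel. W x * g x)"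
proof (rule integral_dominated_convergence)
  have [measurable]: "u \<in> borel_measurable borel" using u by (rule borel_measurable_continuous_onI)
  have [measurable]: "trunc_lap s u \<epsilon> \<in> borel_measurable borel" for \<epsilon> by (rule trunc_lap_measurable) measurable
  have "g \<in> borel_measurable borel" by (rule borel_measurable_LIMSEQ_real[OF lim]) auto
  then show "(\<lambda>x. W x * g x) \<in> borel_measurable lborel" by simp
  show "(\<lambda>x. W x * trunc_lap s u (1 / real (Suc n)) x) \<in> borel_measurable lborel" for n by simp
  have "integrable lborel (\<lambda>x::'a. indicator (cball 0 R) x *\<^sub>R (D * B))"
    by (rule integrable_indicator) (auto simp: emeasure_bounded_finite[unfolded infinity_ennreal_def])
  then show "integrable lborel (\<lambda>x::'a. D * B * indicator (cball 0 R) x)" by (simp add: mult.commute)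
  show "AE x in lborel. (\<lambda>n. W x * trunc_lap s u (1 / real (Suc n)) x) \<longlonglongrightarrow> W x * g x"
    by (intro AE_I2 tendsto_mult tendsto_const lim)
  show "AE x in lborel. norm (W x * trunc_lap s u (1 / real (Suc n)) x) \<le> D * B * indicator (cball 0 R) x" for n
  proof (rule AE_I2)
    fix x :: 'a
    show "norm (W x * trunc_lap s u (1 / real (Suc n)) x) \<le> D * B * indicator (cball 0 R) x"
    proof (cases "norm x \<le> R")
      case True
      have "D \<ge> 0" using WD[of x] True abs_ge_zero[of "W x"] by (auto simp del: abs_ge_zero)
      then show ?thesis using WD[of x] True B[OF True, of "1 / real (Suc n)"]
        by (auto simp: abs_mult intro!: mult_mono)
    qed (use WD[of x] in auto)
  qed
qed

section \<open>The symmetrized energy inequality\<close>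

text \<open>The carre du champ of the operator up to a constant factor, written
  \<open>\<Gamma>\<psi>\<close> in the overview; values in \<open>ennreal\<close> postpone all
  questions of finiteness.\<close>

definition sqdiff_integral :: "real \<Rightarrow> ('a::euclidean_space \<Rightarrow> real) \<Rightarrow> 'a \<Rightarrow> ennreal" where
  "sqdiff_integral s \<psi> x = (\<integral>\<^sup>+y. ennreal ((\<psi> x - \<psi> y)\<^sup>2 * kern s (x - y)) \<partial>lborel)"

definition energy :: "real \<Rightarrow> ('a::euclidean_space \<Rightarrow> real) \<Rightarrow> ennreal" where
  "energy s w = (\<integral>\<^sup>+x. sqdiff_integral s w x \<partial>lborel)"

abbreviation LL :: "('a::euclidean_space \<times> 'a) measure" where
  "LL \<equiv> lborel \<Otimes>\<^sub>M lborel"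

lemma measurable_fst_lborel [measurable]: "fst \<in> borel_measurable LL"
  and measurable_snd_lborel [measurable]: "snd \<in> borel_measurable LL"
  using measurable_fst[of lborel lborel] measurable_snd[of lborel lborel] by simp_all

lemma sqdiff_integral_measurable [measurable (raw)]:
  fixes \<psi> :: "'a::euclidean_space \<Rightarrow> real"
  assumes [measurable]: "\<psi> \<in> borel_measurable borel"
  shows "sqdiff_integral s \<psi> \<in> borel_measurable borel"
proof -
  have "(\<lambda>x. \<integral>\<^sup>+y. ennreal ((\<psi> x - \<psi> y)\<^sup>2 * kern s (x - y)) \<partial>lborel) \<in> borel_measurable borel"
    by (rule lborel.borel_measurable_nn_integral) measurable
  then show ?thesis by (simp add: sqdiff_integral_def[abs_def])
qed

text \<open>For fixed \<open>x\<close> the truncated kernel has the same finite integral over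
  \<open>y\<close>, so it suffices that one variable stays in a ball of finite measure.
  \<open>J\<close> serves the case where this is \<open>x\<close>; its reflection serves
  \<open>y\<close>.\<close>

lemma integrable_pair_trunc_kern:
  fixes H :: "'a::euclidean_space \<times> 'a \<Rightarrow> real"
  assumes s: "0 < s" "0 < \<epsilon>" and [measurable]: "H \<in> borel_measurable LL"
    and H: "\<And>x y. \<bar>H (x, y)\<bar> \<le> D * (indicator (cball 0 R) x + indicator (cball 0 R) y) * trunc_kern s \<epsilon> (x - y)"
  shows "integrable LL H"
proof -
  have [measurable]: "cball (0::'a) R \<in> sets borel" by simp
  define J where "J = (\<lambda>p::'a \<times> 'a. indicator (cball 0 R) (fst p) * trunc_kern s \<epsilon> (fst p - snd p) :: real)"
  have [measurable]: "J \<in> borel_measurable LL" unfolding J_def by measurable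
  have K: "(\<integral>\<^sup>+y. ennreal (trunc_kern s \<epsilon> (x - y)) \<partial>lborel) = ennreal (LINT h|lborel. trunc_kern s \<epsilon> (h::'a))" for x :: 'a
  proof -
    have "(\<lambda>h::'a. ennreal (trunc_kern s \<epsilon> h)) \<in> borel_measurable borel" by measurable
    from nn_integral_lborel_translate(2)[OF this, of x]
    have "(\<integral>\<^sup>+y. ennreal (trunc_kern s \<epsilon> (x - y)) \<partial>lborel) = (\<integral>\<^sup>+y. ennreal (trunc_kern s \<epsilon> (y::'a)) \<partial>lborel)" .
    also have "\<dots> = ennreal (LINT h|lborel. trunc_kern s \<epsilon> (h::'a))"
      by (rule nn_integral_eq_integral[OF integrable_trunc_kern[OF s]]) simp
    finally show ?thesis .
  qed
  have fin: "emeasure lborel (cball (0::'a) R) < \<infinity>" by (rule emeasure_lborel_cball_finite)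
  have J: "integrable LL J"
  proof (rule integrableI_nonneg)
    have "(\<integral>\<^sup>+p. ennreal (J p) \<partial>LL) = (\<integral>\<^sup>+x. \<integral>\<^sup>+y. ennreal (J (x, y)) \<partial>lborel \<partial>lborel)"
      by (rule lborel.nn_integral_fst[symmetric]) measurable
    also have "\<dots> = (\<integral>\<^sup>+x. ennreal (LINT h|lborel. trunc_kern s \<epsilon> (h::'a)) * indicator (cball (0::'a) R) x \<partial>lborel)"
    proof (rule nn_integral_cong)
      fix x :: 'a
      show "(\<integral>\<^sup>+y. ennreal (J (x, y)) \<partial>lborel) = ennreal (LINT h|lborel. trunc_kern s \<epsilon> (h::'a)) * indicator (cball 0 R) x"
        using K[of x] by (cases "x \<in> cball 0 R") (simp_all add: J_def del: mem_cball)
    qed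
    also have "\<dots> = ennreal (LINT h|lborel. trunc_kern s \<epsilon> (h::'a)) * emeasure lborel (cball (0::'a) R)"
      by (rule nn_integral_cmult_indicator) simp
    also have "\<dots> < \<infinity>" using fin by (simp add: ennreal_mult_less_top)
    finally show "(\<integral>\<^sup>+p. ennreal (J p) \<partial>LL) < \<infinity>" .
  qed (auto simp: J_def)
  have J': "integrable LL (\<lambda>(x, y). J (y, x))"
    by (rule lborel_pair.integrable_product_swap[OF J])
  have "integrable LL (\<lambda>p. D * (J p + (case p of (x, y) \<Rightarrow> J (y, x))))"
    using J J' by (intro integrable_mult_right Bochner_Integration.integrable_add)
  then show ?thesis
  proof (rule Bochner_Integration.integrable_bound)
    show "AE p in LL. norm (H p) \<le> norm (D * (J p + (case p of (x, y) \<Rightarrow> J (y, x))))"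
    proof (rule AE_I2, clarify)
      fix x y :: 'a
      have "\<bar>H (x, y)\<bar> \<le> D * (J (x, y) + J (y, x))"
        using H[of x y] by (simp add: J_def trunc_kern_commute[of s \<epsilon> y x] algebra_simps)
      then show "norm (H (x, y)) \<le> norm (D * (J (x, y) + J (y, x)))" by simp
    qed
  qed fact
qed

text \<open>Multiply \<open>pw\<close> by the truncated kernel and integrate over pairs. Splitting
  \<open>(u x - u y) * (W x - W y)\<close> into its \<open>W x\<close> part and the mirror image
  gives twice the tested operator, and the same symmetry gives the factor 2 before \<open>E\<close>.
  As the hole closes, the left side increases to the energy and the right side converges. With
  \<open>w = 0\<close> the first conclusion is a one-sided test of the equation.\<close>

lemma energy_ineq:
  fixes u w W F \<psi> :: "'a::euclidean_space \<Rightarrow> real"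
  assumes u: "continuous_on UNIV u" and M: "\<And>x. \<bar>u x\<bar> \<le> M" and s: "0 < s"
    and B: "\<And>x \<epsilon>. norm x \<le> R \<Longrightarrow> 0 < \<epsilon> \<Longrightarrow> \<bar>trunc_lap s u \<epsilon> x\<bar> \<le> B"
    and lim: "\<And>x. (\<lambda>n. trunc_lap s u (1 / real (Suc n)) x) \<longlonglongrightarrow> g x"
    and meas [measurable]: "w \<in> borel_measurable borel" "W \<in> borel_measurable borel"
      "F \<in> borel_measurable borel" "\<psi> \<in> borel_measurable borel"
    and D: "\<And>x. \<bar>w x\<bar> \<le> D * indicator (cball 0 R) x" "\<And>x. \<bar>W x\<bar> \<le> D * indicator (cball 0 R) x"
      "\<And>x. \<bar>\<psi> x\<bar> \<le> D * indicator (cball 0 R) x" "\<And>x. F x \<le> D"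
    and F: "\<And>x. 0 \<le> F x"
    and pw: "\<And>x y. (w x - w y)\<^sup>2 \<le> c1 * ((u x - u y) * (W x - W y)) + c2 * ((F x + F y) * (\<psi> x - \<psi> y)\<^sup>2)"
    and c: "0 \<le> c1" "0 \<le> c2"
    and E: "(\<integral>\<^sup>+x. ennreal (F x) * sqdiff_integral s \<psi> x \<partial>lborel) \<le> ennreal E" "0 \<le> E"
  shows "0 \<le> 2 * c1 * (LINT x|lborel. W x * g x) + 2 * c2 * E"
    and "energy s w \<le> ennreal (2 * c1 * (LINT x|lborel. W x * g x) + 2 * c2 * E)"
proof -
  have [measurable]: "u \<in> borel_measurable borel" using u by (rule borel_measurable_continuous_onI)
  have M0: "M \<ge> 0" using M[of 0] by simp
  have D0: "D \<ge> 0" using D(4)[of 0] F[of 0] by simp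
  define V where "V = (\<lambda>n. 2 * c1 * (LINT x|lborel. W x * trunc_lap s u (1 / real (Suc n)) x) + 2 * c2 * E)"
  define P where "P = (\<lambda>n p. (w (fst p) - w (snd p))\<^sup>2 * trunc_kern s (1 / real (Suc n)) (fst p - snd p))"
  have [measurable]: "P n \<in> borel_measurable LL" for n unfolding P_def by measurable
  have Vlim: "V \<longlonglongrightarrow> 2 * c1 * (LINT x|lborel. W x * g x) + 2 * c2 * E"
    unfolding V_def by (intro tendsto_intros trunc_lap_test_tendsto[OF u B meas(2) D(2) lim])
  let ?ind = "\<lambda>x. indicator (cball (0::'a) R) x :: real"
  have sq: "(a x - a y)\<^sup>2 \<le> (2 * D\<^sup>2) * (?ind x + ?ind y)"
    if "\<And>x. \<bar>a x\<bar> \<le> D * ?ind x" for a :: "'a \<Rightarrow> real" and x y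
  proof -
    have "(a x - a y)\<^sup>2 \<le> 2 * (a x)\<^sup>2 + 2 * (a y)\<^sup>2"
      using zero_le_power2[of "a x + a y"] by (simp add: power2_eq_square algebra_simps)
    moreover have az: "(a z)\<^sup>2 \<le> D\<^sup>2 * ?ind z" for z
    proof -
      have "\<bar>a z\<bar>\<^sup>2 \<le> (D * ?ind z)\<^sup>2" by (intro power_mono that) auto
      then show ?thesis by (auto simp: power_mult_distrib split: split_indicator)
    qed
    moreover have "(2 * D\<^sup>2) * (?ind x + ?ind y) = 2 * (D\<^sup>2 * ?ind x) + 2 * (D\<^sup>2 * ?ind y)"
      by (simp add: algebra_simps)
    ultimately show ?thesis using az[of x] az[of y] by linarith
  qed
  have step: "integrable LL (P n) \<and> integral\<^sup>L LL (P n) \<le> V n" for n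
  proof -
    define \<epsilon> where "\<epsilon> = 1 / real (Suc n)"
    have e: "\<epsilon> > 0" by (simp add: \<epsilon>_def)
    define G where "G = (\<lambda>p. W (fst p) * (u (fst p) - u (snd p)) * trunc_kern s \<epsilon> (fst p - snd p))"
    define H where "H = (\<lambda>p. F (fst p) * (\<psi> (fst p) - \<psi> (snd p))\<^sup>2 * trunc_kern s \<epsilon> (fst p - snd p))"
    have [measurable]: "G \<in> borel_measurable LL" "H \<in> borel_measurable LL"
      unfolding G_def H_def by (measurable, measurable)
    have iP: "integrable LL (P n)"
      by (rule integrable_pair_trunc_kern[OF s e, where D="2 * D\<^sup>2" and R=R])
         (auto simp: P_def \<epsilon>_def abs_mult simp del: of_nat_Suc intro!: mult_right_mono sq D)
    have iH: "integrable LL H"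
    proof (rule integrable_pair_trunc_kern[OF s e, where D="D * (2 * D\<^sup>2)" and R=R])
      fix x y
      have "F x * (\<psi> x - \<psi> y)\<^sup>2 \<le> D * ((2 * D\<^sup>2) * (?ind x + ?ind y))"
        by (intro mult_mono sq D) (use D0 in auto)
      from mult_right_mono[OF this trunc_kern_nonneg[of s \<epsilon> "x - y"]]
      show "\<bar>H (x, y)\<bar> \<le> D * (2 * D\<^sup>2) * (?ind x + ?ind y) * trunc_kern s \<epsilon> (x - y)"
        using F[of x] by (simp add: H_def abs_mult mult.assoc)
    qed measurable
    have iG: "integrable LL G"
    proof (rule integrable_pair_trunc_kern[OF s e, where D="D * (2 * M)" and R=R])
      fix x y
      have "\<bar>W x\<bar> * \<bar>u x - u y\<bar> \<le> (D * ?ind x) * (2 * M)"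
        using M[of x] M[of y] M0 D0 by (intro mult_mono D) auto
      also have "\<dots> \<le> D * (2 * M) * (?ind x + ?ind y)"
        using D0 M0 by (auto split: split_indicator)
      finally show "\<bar>G (x, y)\<bar> \<le> D * (2 * M) * (?ind x + ?ind y) * trunc_kern s \<epsilon> (x - y)"
        by (auto simp: G_def abs_mult intro!: mult_right_mono)
    qed measurable
    have iG': "integrable LL (\<lambda>(x, y). G (y, x))"
      and iH': "integrable LL (\<lambda>(x, y). H (y, x))"
      by (rule lborel_pair.integrable_product_swap[OF iG] lborel_pair.integrable_product_swap[OF iH])+
    have G: "integral\<^sup>L LL G = (LINT x|lborel. W x * trunc_lap s u \<epsilon> x)"
    proof -
      have "integral\<^sup>L LL G = (LINT x|lborel. LINT y|lborel. G (x, y))"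
        by (rule lborel_pair.integral_fst'[OF iG, symmetric])
      also have "\<dots> = (LINT x|lborel. W x * trunc_lap s u \<epsilon> x)"
      proof (rule Bochner_Integration.integral_cong)
        fix x
        have "(LINT y|lborel. G (x, y)) = (LINT y|lborel. W x * (trunc_kern s \<epsilon> (y - x) * (u x - u y)))"
          by (intro Bochner_Integration.integral_cong) (auto simp: G_def trunc_kern_commute[of s \<epsilon> x] mult_ac)
        then show "(LINT y|lborel. G (x, y)) = W x * trunc_lap s u \<epsilon> x" by (simp add: trunc_lap_def)
      qed simp
      finally show ?thesis .
    qed
    have G': "integral\<^sup>L LL (\<lambda>(x, y). G (y, x)) = integral\<^sup>L LL G"
      by (rule lborel_pair.integral_product_swap) measurable
    have H': "integral\<^sup>L LL (\<lambda>(x, y). H (y, x)) = integral\<^sup>L LL H"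
      by (rule lborel_pair.integral_product_swap) measurable
    have H: "integral\<^sup>L LL H \<le> E"
    proof -
      have "ennreal (integral\<^sup>L LL H) = (\<integral>\<^sup>+p. ennreal (H p) \<partial>LL)"
        by (rule nn_integral_eq_integral[OF iH, symmetric]) (auto simp: H_def F)
      also have "\<dots> = (\<integral>\<^sup>+x. \<integral>\<^sup>+y. ennreal (H (x, y)) \<partial>lborel \<partial>lborel)"
        by (rule lborel.nn_integral_fst[symmetric]) measurable
      also have "\<dots> \<le> (\<integral>\<^sup>+x. ennreal (F x) * sqdiff_integral s \<psi> x \<partial>lborel)"
      proof (rule nn_integral_mono)
        fix x
        have "(\<integral>\<^sup>+y. ennreal (H (x, y)) \<partial>lborel) \<le> (\<integral>\<^sup>+y. ennreal (F x) * ennreal ((\<psi> x - \<psi> y)\<^sup>2 * kern s (x - y)) \<partial>lborel)"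
          using F[of x] by (intro nn_integral_mono)
            (auto simp: H_def mult.assoc trunc_kern_le simp flip: ennreal_mult intro!: ennreal_leI mult_left_mono)
        also have "\<dots> = ennreal (F x) * sqdiff_integral s \<psi> x"
          unfolding sqdiff_integral_def by (rule nn_integral_cmult) measurable
        finally show "(\<integral>\<^sup>+y. ennreal (H (x, y)) \<partial>lborel) \<le> ennreal (F x) * sqdiff_integral s \<psi> x" .
      qed
      also have "\<dots> \<le> ennreal E" by (rule E)
      finally show ?thesis using E(2) by (simp add: ennreal_le_iff)
    qed
    have "integral\<^sup>L LL (P n) \<le>
       integral\<^sup>L LL (\<lambda>p. c1 * (G p + (case p of (x, y) \<Rightarrow> G (y, x))) + c2 * (H p + (case p of (x, y) \<Rightarrow> H (y, x))))"
    proof (rule integral_mono)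
      fix p :: "'a \<times> 'a"
      obtain x y where p: "p = (x, y)" by (cases p)
      have "P n p \<le> (c1 * ((u x - u y) * (W x - W y)) + c2 * ((F x + F y) * (\<psi> x - \<psi> y)\<^sup>2)) * trunc_kern s \<epsilon> (x - y)"
        unfolding P_def p \<epsilon>_def fst_conv snd_conv by (intro mult_right_mono pw) auto
      also have "\<dots> = c1 * (G (x, y) + G (y, x)) + c2 * (H (x, y) + H (y, x))"
        by (simp add: G_def H_def trunc_kern_commute[of s \<epsilon> y x] power2_eq_square algebra_simps)
      finally show "P n p \<le> c1 * (G p + (case p of (x, y) \<Rightarrow> G (y, x))) + c2 * (H p + (case p of (x, y) \<Rightarrow> H (y, x)))"
        by (simp add: p)
    qed (use iP iG iG' iH iH' in \<open>auto intro!: Bochner_Integration.integrable_add integrable_mult_right\<close>)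
    also have "\<dots> = c1 * (2 * integral\<^sup>L LL G) + c2 * (2 * integral\<^sup>L LL H)"
      using iG iG' iH iH' G' H' by simp
    also have "\<dots> \<le> V n"
      using mult_left_mono[OF H c(2)] by (simp add: V_def G \<epsilon>_def mult.commute)
    finally show ?thesis using iP by simp
  qed
  have "0 \<le> V n" for n
  proof -
    have "0 \<le> integral\<^sup>L LL (P n)" by (rule integral_nonneg_AE) (auto simp: P_def)
    then show ?thesis using step[of n] by simp
  qed
  then show "0 \<le> 2 * c1 * (LINT x|lborel. W x * g x) + 2 * c2 * E"
    by (intro LIMSEQ_le_const[OF Vlim]) auto
  \<comment> \<open>A smaller hole gives a larger kernel, so monotone convergence yields the full
    energy without knowing beforehand that it is finite.\<close>
  have inc: "incseq (\<lambda>n p. ennreal (P n p))"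
  proof (intro incseq_SucI le_funI ennreal_leI)
    fix n and p :: "'a \<times> 'a"
    have "1 / real (Suc (Suc n)) \<le> 1 / real (Suc n)" by (simp add: field_simps)
    then have "ball 0 (1 / real (Suc (Suc n))) \<subseteq> ball (0::'a) (1 / real (Suc n))" by (rule subset_ball)
    then show "P n p \<le> P (Suc n) p"
      unfolding P_def trunc_kern_def by (intro mult_left_mono mult_right_mono) (auto split: split_indicator simp del: of_nat_Suc)
  qed
  have "energy s w = (\<integral>\<^sup>+p. ennreal ((w (fst p) - w (snd p))\<^sup>2 * kern s (fst p - snd p)) \<partial>LL)"
  proof -
    have "(\<lambda>p::'a \<times> 'a. ennreal ((w (fst p) - w (snd p))\<^sup>2 * kern s (fst p - snd p)))
        \<in> borel_measurable LL"
      by measurable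
    from lborel.nn_integral_fst[OF this] show ?thesis
      by (simp add: energy_def sqdiff_integral_def)
  qed
  also have "\<dots> = (\<integral>\<^sup>+p. (SUP n. ennreal (P n p)) \<partial>LL)"
  proof (rule nn_integral_cong)
    fix p :: "'a \<times> 'a"
    have "\<forall>\<^sub>F n in sequentially. ennreal (P n p) = ennreal ((w (fst p) - w (snd p))\<^sup>2 * kern s (fst p - snd p))"
    proof (cases "fst p = snd p")
      case False
      then have "norm (fst p - snd p) > 0" by simp
      then have "\<forall>\<^sub>F n in sequentially. 1 / real (Suc n) < norm (fst p - snd p)"
        using order_tendstoD(2)[OF LIMSEQ_Suc[OF lim_1_over_n]] by blast
      then show ?thesis by eventually_elim (simp add: P_def trunc_kern_def)
    qed (simp add: P_def)
    then have "(\<lambda>n. ennreal (P n p)) \<longlonglongrightarrow> ennreal ((w (fst p) - w (snd p))\<^sup>2 * kern s (fst p - snd p))"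
      by (rule tendsto_eventually)
    moreover have "(\<lambda>n. ennreal (P n p)) \<longlonglongrightarrow> (SUP n. ennreal (P n p))"
      using inc[THEN incseqD] by (intro LIMSEQ_SUP) (auto simp: incseq_def intro: le_funD)
    ultimately show "ennreal ((w (fst p) - w (snd p))\<^sup>2 * kern s (fst p - snd p)) = (SUP n. ennreal (P n p))"
      by (rule LIMSEQ_unique)
  qed
  also have "\<dots> = (SUP n. \<integral>\<^sup>+p. ennreal (P n p) \<partial>LL)"
    by (rule nn_integral_monotone_convergence_SUP[OF inc]) measurable
  also have "\<dots> \<le> ennreal (2 * c1 * (LINT x|lborel. W x * g x) + 2 * c2 * E)"
  proof (rule SUP_least)
    fix n
    have Q: "(\<integral>\<^sup>+p. ennreal (P m p) \<partial>LL) \<le> ennreal (V m)" for m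
    proof -
      have "(\<integral>\<^sup>+p. ennreal (P m p) \<partial>LL) = ennreal (integral\<^sup>L LL (P m))"
        using step[of m] by (intro nn_integral_eq_integral) (auto simp: P_def)
      also have "\<dots> \<le> ennreal (V m)" using step[of m] by (intro ennreal_leI) auto
      finally show ?thesis .
    qed
    \<comment> \<open>Only the limit of \<open>V\<close> is controlled, so the integral of
      \<open>P n\<close> is compared with all later \<open>V m\<close>, using that these integrals
      increase.\<close>
    show "(\<integral>\<^sup>+p. ennreal (P n p) \<partial>LL) \<le> ennreal (2 * c1 * (LINT x|lborel. W x * g x) + 2 * c2 * E)"
    proof (rule LIMSEQ_le_const[OF tendsto_ennrealI[OF Vlim]], intro exI[of _ n] allI impI)
      fix m assume "n \<le> m"
      then have "(\<integral>\<^sup>+p. ennreal (P n p) \<partial>LL) \<le> (\<integral>\<^sup>+p. ennreal (P m p) \<partial>LL)"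
        using inc[THEN incseqD] by (intro nn_integral_mono) (auto intro: le_funD)
      then show "(\<integral>\<^sup>+p. ennreal (P n p) \<partial>LL) \<le> ennreal (V m)" using Q order_trans by blast
    qed
  qed
  finally show "energy s w \<le> ennreal (2 * c1 * (LINT x|lborel. W x * g x) + 2 * c2 * E)" .
qed

section \<open>Mollification\<close>

definition flat :: "nat \<Rightarrow> real \<Rightarrow> real" where
  "flat n t = (if t > 0 then exp (- (1 / t)) / t ^ n else 0)"

lemma flat_nonneg: "flat n t \<ge> 0" by (simp add: flat_def)

lemma power_div_fact_le_exp: "x ^ n / fact n \<le> exp x" if "x \<ge> 0" for x :: real
  using sum_le_suminf[OF summable_exp_generic[of x], of "{n}"] that
  by (simp add: exp_def divide_inverse mult.commute)

text \<open>The estimate \<open>x ^ m / fact m \<le> exp x\<close> at \<open>x = 1 / t\<close> and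
  \<open>m = n + 2\<close>. The two extra powers make every \<open>flat n\<close> vanish
  quadratically at 0, hence differentiable there with derivative 0.\<close>

lemma flat_bound: "\<bar>flat n t\<bar> \<le> fact (n + 2) * t\<^sup>2"
proof (cases "t > 0")
  case True
  define c :: real where "c = fact (n + 2)"
  have c: "c > 0" by (simp add: c_def)
  have "(1 / t) ^ (n + 2) / c \<le> exp (1 / t)"
    using True unfolding c_def by (intro power_div_fact_le_exp) auto
  then have "1 \<le> exp (1 / t) * (c * t ^ (n + 2))"
    using True c by (simp add: divide_le_eq power_divide mult.commute mult.left_commute)
  then have "exp (- (1 / t)) \<le> c * t ^ (n + 2)"
    by (simp add: exp_minus inverse_eq_divide divide_le_eq mult.commute)
  also have "\<dots> = (c * t\<^sup>2) * t ^ n"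
    by (simp add: power_add power2_eq_square)
  finally have "exp (- (1 / t)) / t ^ n \<le> c * t\<^sup>2"
    using True by (simp add: divide_le_eq)
  then show ?thesis using True by (simp add: flat_def c_def)
qed (simp add: flat_def)

text \<open>The family reproduces itself under differentiation, so smoothness of all orders can be
  proved without a formula for higher derivatives.\<close>

lemma flat_deriv: "(flat n has_real_derivative (flat (n + 2) t - real n * flat (n + 1) t)) (at t)"
proof -
  consider "t < 0" | "t > 0" | "t = 0" by linarith
  then show ?thesis
  proof cases
    case 1
    have "((\<lambda>_. 0) has_real_derivative 0) (at t)" by simp
    then have "(flat n has_real_derivative 0) (at t)"
      by (rule has_field_derivative_transform_within_open[where S="{..<0}"]) (use 1 in \<open>auto simp: flat_def\<close>)
    then show ?thesis using 1 by (simp add: flat_def)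
  next
    case 2
    have "((\<lambda>t. exp (- (1 / t)) / t ^ n) has_real_derivative
        (exp (- (1 / t)) * (1 / t\<^sup>2) * t ^ n - exp (- (1 / t)) * (real n * t ^ (n - 1))) / (t ^ n * t ^ n)) (at t)"
      using 2 by (auto intro!: derivative_eq_intros simp: power2_eq_square)
    also have "(exp (- (1 / t)) * (1 / t\<^sup>2) * t ^ n - exp (- (1 / t)) * (real n * t ^ (n - 1))) / (t ^ n * t ^ n)
        = flat (n + 2) t - real n * flat (n + 1) t"
      using 2 by (cases n) (auto simp: flat_def field_simps power2_eq_square)
    finally have "((\<lambda>t. exp (- (1 / t)) / t ^ n) has_real_derivative (flat (n + 2) t - real n * flat (n + 1) t)) (at t)" .
    then show ?thesis
      by (rule has_field_derivative_transform_within_open[where S="{0<..}"]) (use 2 in \<open>auto simp: flat_def\<close>)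
  next
    case 3
    have "((\<lambda>h. (flat n (0 + h) - flat n 0) / h) \<longlongrightarrow> 0) (at 0)"
    proof (rule Lim_null_comparison)
      show "((\<lambda>h::real. fact (n + 2) * \<bar>h\<bar>) \<longlongrightarrow> 0) (at 0)"
        by (intro tendsto_mult_right_zero tendsto_rabs_zero tendsto_ident_at)
      show "\<forall>\<^sub>F h in at 0. norm ((flat n (0 + h) - flat n 0) / h) \<le> fact (n + 2) * \<bar>h\<bar>"
      proof (rule eventually_at_filter[THEN iffD2], rule always_eventually, intro allI impI)
        fix h :: real assume h: "h \<noteq> 0"
        have "\<bar>flat n h\<bar> / \<bar>h\<bar> \<le> fact (n + 2) * h\<^sup>2 / \<bar>h\<bar>"
          by (intro divide_right_mono flat_bound) auto
        also have "\<dots> = fact (n + 2) * \<bar>h\<bar>"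
          using h power2_abs[of h] by (simp add: power2_eq_square abs_if)
        finally show "norm ((flat n (0 + h) - flat n 0) / h) \<le> fact (n + 2) * \<bar>h\<bar>"
          by (simp add: flat_def[of n 0])
      qed
    qed
    then show ?thesis using 3 by (simp add: DERIV_def flat_def[of _ 0])
  qed
qed

text \<open>An algebra that contains the bump and is closed under partial derivatives; membership
  therefore gives \<open>C_k\<close> for all \<open>k\<close> by induction. The coordinate functions
  are included because the chain rule for \<open>r - x \<bullet> x\<close> produces them.\<close>

inductive bump_algebra :: "real \<Rightarrow> ('a::euclidean_space \<Rightarrow> real) \<Rightarrow> bool" for r where
  flat: "bump_algebra r (\<lambda>x. flat n (r - x \<bullet> x))"
| coord: "bump_algebra r (\<lambda>x. x \<bullet> i)"
| const: "bump_algebra r (\<lambda>x. c)"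
| add: "bump_algebra r f \<Longrightarrow> bump_algebra r g \<Longrightarrow> bump_algebra r (\<lambda>x. f x + g x)"
| mult: "bump_algebra r f \<Longrightarrow> bump_algebra r g \<Longrightarrow> bump_algebra r (\<lambda>x. f x * g x)"

lemma bump_algebra_has_derivative:
  assumes "bump_algebra r (f :: 'a::euclidean_space \<Rightarrow> real)"
  shows "\<exists>f'. (\<forall>x. (f has_derivative f' x) (at x)) \<and> (\<forall>i. bump_algebra r (\<lambda>x. f' x i))"
  using assms
proof induction
  case (flat n)
  define f' where "f' = (\<lambda>x h::'a. (flat (n + 2) (r - x \<bullet> x) + (- real n) * flat (n + 1) (r - x \<bullet> x)) * ((-2) * (x \<bullet> h)))"
  have "((\<lambda>x. flat n (r - x \<bullet> x)) has_derivative f' x) (at x)" for x :: 'a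
  proof -
    have 1: "((\<lambda>x. r - x \<bullet> x) has_derivative (\<lambda>h. (-2) * (x \<bullet> h))) (at x)"
      by (auto intro!: derivative_eq_intros simp: inner_commute)
    have 2: "(flat n has_derivative (*) (flat (n + 2) (r - x \<bullet> x) - real n * flat (n + 1) (r - x \<bullet> x))) (at (r - x \<bullet> x))"
      using flat_deriv by (simp add: has_field_derivative_def)
    show ?thesis using has_derivative_compose[OF 1 2] by (simp add: f'_def)
  qed
  moreover have "bump_algebra r (\<lambda>x. f' x i)" for i
    unfolding f'_def by (intro bump_algebra.intros)
  ultimately show ?case by blast
next
  case (coord i)
  show ?case
    by (rule exI[of _ "\<lambda>x h. h \<bullet> i"]) (auto intro!: derivative_eq_intros bump_algebra.intros)
next
  case (const c)
  show ?case by (rule exI[of _ "\<lambda>x h. 0"]) (auto intro!: bump_algebra.intros)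
next
  case (add f g)
  then obtain f' g' where "\<forall>x. (f has_derivative f' x) (at x)" "\<forall>i. bump_algebra r (\<lambda>x. f' x i)"
    "\<forall>x. (g has_derivative g' x) (at x)" "\<forall>i. bump_algebra r (\<lambda>x. g' x i)" by blast
  then show ?case
    by (intro exI[of _ "\<lambda>x h. f' x h + g' x h"]) (auto intro!: has_derivative_add bump_algebra.add)
next
  case (mult f g)
  then obtain f' g' where *: "\<forall>x. (f has_derivative f' x) (at x)" "\<forall>i. bump_algebra r (\<lambda>x. f' x i)"
    "\<forall>x. (g has_derivative g' x) (at x)" "\<forall>i. bump_algebra r (\<lambda>x. g' x i)" by blast
  show ?case
    by (rule exI[of _ "\<lambda>x h. f x * g' x h + f' x h * g x"])
       (use * mult in \<open>auto intro!: has_derivative_mult bump_algebra.add bump_algebra.mult\<close>)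
qed

lemma bump_algebra_C_k: "bump_algebra r f \<Longrightarrow> C_k k f"
proof (induction k arbitrary: f)
  case (0 f)
  from bump_algebra_has_derivative[OF this] obtain f' where "\<And>x. (f has_derivative f' x) (at x)" by blast
  then have "continuous_on UNIV f" by (auto intro!: has_derivative_continuous_on)
  then show ?case by simp
next
  case (Suc k f)
  from bump_algebra_has_derivative[OF Suc.prems] obtain f'
    where f': "\<And>x. (f has_derivative f' x) (at x)" "\<And>i. bump_algebra r (\<lambda>x. f' x i)" by blast
  have "partial i f = (\<lambda>x. f' x i)" for i
    using frechet_derivative_at[OF f'(1)] by (auto simp: partial_def)
  then show ?case using Suc.IH f' by (auto simp: differentiable_on_def differentiable_def)
qed

lemma exists_bump:
  assumes "\<delta> > 0"
  obtains \<eta> :: "'a::euclidean_space \<Rightarrow> real" where "\<And>k. C_k k \<eta>" "\<And>x. 0 \<le> \<eta> x"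
    "\<And>x. norm x \<ge> \<delta> \<Longrightarrow> \<eta> x = 0" "integrable lborel \<eta>" "(LINT x|lborel. \<eta> x) = 1"
proof -
  define b where "b = (\<lambda>x::'a. flat 0 (\<delta>\<^sup>2 - x \<bullet> x))"
  have cb: "continuous_on UNIV b" using bump_algebra_C_k[OF bump_algebra.flat, of 0] unfolding b_def by simp
  have b0: "b x \<ge> 0" for x by (simp add: b_def flat_nonneg)
  have bs: "b x = 0" if "norm x \<ge> \<delta>" for x
    using that assms power_mono[OF that, of 2] by (simp add: b_def flat_def power2_norm_eq_inner)
  have "set_integrable lborel (cball 0 \<delta>) b"
    unfolding set_integrable_def
    by (rule borel_integrable_compact) (auto intro: continuous_on_subset[OF cb])
  moreover have "(\<lambda>x. indicator (cball 0 \<delta>) x *\<^sub>R b x) = b"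
    using bs by (force split: split_indicator)
  ultimately have ib: "integrable lborel b" by (simp add: set_integrable_def)
  define I where "I = (LINT x|lborel. b x)"
  have S: "{x. b x \<noteq> 0} \<in> sets borel"
    by (intro borel_open open_Collect_neq cb) auto
  have "I \<noteq> 0"
  proof
    assume "I = 0"
    then have "AE x in lborel. b x = 0"
      using integral_nonneg_eq_0_iff_AE[OF ib] b0 by (simp add: I_def)
    then have "emeasure lborel {x. b x \<noteq> 0} = 0"
      using AE_iff_measurable[where N="{x. b x \<noteq> 0}" and P="\<lambda>x. b x = 0" and M=lborel] S by simp
    moreover have "ball 0 \<delta> \<subseteq> {x. b x \<noteq> 0}"
    proof
      fix x :: 'a assume "x \<in> ball 0 \<delta>"
      then have "(norm x)\<^sup>2 < \<delta>\<^sup>2" by (intro power_strict_mono) auto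
      then show "x \<in> {x. b x \<noteq> 0}" by (simp add: b_def flat_def power2_norm_eq_inner)
    qed
    ultimately have "emeasure lborel (ball (0::'a) \<delta>) = 0"
      using emeasure_mono[of "ball 0 \<delta>" "{x. b x \<noteq> 0}" lborel] S by auto
    then show False using assms unit_ball_vol_pos[of "real DIM('a)"] by (simp add: emeasure_ball)
  qed
  moreover have "I \<ge> 0" unfolding I_def by (rule integral_nonneg_AE) (simp add: b0)
  ultimately have I: "I > 0" by simp
  show thesis
  proof (rule that[of "\<lambda>x. b x * (1 / I)"])
    show "C_k k (\<lambda>x. b x * (1 / I))" for k
      unfolding b_def
      by (rule bump_algebra_C_k[where r="\<delta>\<^sup>2"]) (intro bump_algebra.mult bump_algebra.flat bump_algebra.const)
    show "integrable lborel (\<lambda>x. b x * (1 / I))" using ib by simp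
    show "(LINT x|lborel. b x * (1 / I)) = 1" using I by (simp add: I_def)
  qed (use b0 bs I in auto)
qed

section \<open>Convolution and its derivatives\<close>

definition mollify :: "('a::euclidean_space \<Rightarrow> real) \<Rightarrow> ('a \<Rightarrow> real) \<Rightarrow> 'a \<Rightarrow> real" where
  "mollify w \<eta> x = (LINT y|lborel. w y * \<eta> (x - y))"

lemma mollify_eq_integral:
  fixes w \<eta> :: "'a::euclidean_space \<Rightarrow> real"
  assumes w: "continuous_on UNIV w" "\<And>x. x \<notin> cbox a b \<Longrightarrow> w x = 0" and \<eta>: "continuous_on UNIV \<eta>"
  shows "mollify w \<eta> x = integral (cbox a b) (\<lambda>y. w y * \<eta> (x - y))"
proof -
  have c: "continuous_on UNIV (\<lambda>y. w y * \<eta> (x - y))"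
    by (intro continuous_intros w continuous_on_compose2[OF \<eta>]) auto
  have "set_integrable lborel (cbox a b) (\<lambda>y. w y * \<eta> (x - y))"
    unfolding set_integrable_def
    by (rule borel_integrable_compact) (auto intro: continuous_on_subset[OF c])
  then have "(LINT y:cbox a b|lborel. w y * \<eta> (x - y)) = integral (cbox a b) (\<lambda>y. w y * \<eta> (x - y))"
    by (rule set_borel_integral_eq_integral)
  moreover have "(\<lambda>y. indicator (cbox a b) y *\<^sub>R (w y * \<eta> (x - y))) = (\<lambda>y. w y * \<eta> (x - y))"
    using w(2) by (force split: split_indicator)
  ultimately show ?thesis by (simp add: mollify_def set_lebesgue_integral_def)
qed

text \<open>Differentiation under the integral sign: the derivative falls on \<open>\<eta>\<close>,
  so continuity of \<open>w\<close> suffices, and the bounded support of \<open>w\<close> turns the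
  integral into one over a compact box, as the Leibniz rule requires.\<close>

lemma mollify_derivative:
  fixes w \<eta> :: "'a::euclidean_space \<Rightarrow> real"
  assumes w: "continuous_on UNIV w" "\<And>x. x \<notin> cbox a b \<Longrightarrow> w x = 0"
    and \<eta>: "\<eta> differentiable_on UNIV" "\<And>i. i \<in> Basis \<Longrightarrow> continuous_on UNIV (partial i \<eta>)"
  shows "mollify w \<eta> differentiable (at x)"
    and "i \<in> Basis \<Longrightarrow> partial i (mollify w \<eta>) x = mollify w (partial i \<eta>) x"
proof -
  define \<eta>' where "\<eta>' = (\<lambda>z. \<Sum>i\<in>Basis. partial i \<eta> z *\<^sub>R blinfun_inner_left (i::'a))"
  have c\<eta>: "continuous_on UNIV \<eta>" using \<eta>(1) by (rule differentiable_imp_continuous_on)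
  have \<eta>'_app: "blinfun_apply (\<eta>' z) v = frechet_derivative \<eta> (at z) v" for z v
    using \<eta>(1) by (subst frechet_derivative_partial)
      (auto simp: differentiable_on_def \<eta>'_def blinfun.sum_left blinfun.scaleR_left mult.commute)
  have d\<eta>: "(\<eta> has_derivative blinfun_apply (\<eta>' z)) (at z)" for z
  proof -
    have "(\<eta> has_derivative frechet_derivative \<eta> (at z)) (at z)"
      using \<eta>(1) by (simp add: differentiable_on_def frechet_derivative_works[symmetric])
    moreover have "blinfun_apply (\<eta>' z) = frechet_derivative \<eta> (at z)" using \<eta>'_app by auto
    ultimately show ?thesis by simp
  qed
  have c\<eta>': "continuous_on UNIV \<eta>'"
    unfolding \<eta>'_def by (intro continuous_intros \<eta>(2)) auto
  define F where "F = (\<lambda>x y. w y *\<^sub>R \<eta>' (x - y))"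
  have cF: "continuous_on S (\<lambda>y. F x y)" for S and x :: 'a
    unfolding F_def
    by (intro continuous_intros continuous_on_compose2[OF c\<eta>'] continuous_on_subset[OF w(1)]) auto
  have mol: "mollify w \<eta> = (\<lambda>x. integral (cbox a b) (\<lambda>y. w y * \<eta> (x - y)))"
    using mollify_eq_integral[OF w c\<eta>] by auto
  have D: "(mollify w \<eta> has_derivative blinfun_apply (integral (cbox a b) (F x))) (at x)"
    unfolding mol
  proof (rule leibniz_rule[where U=UNIV, unfolded])
    fix x t :: 'a
    have 1: "((\<lambda>x. x - t) has_derivative (\<lambda>h. h)) (at x)" by (auto intro!: derivative_eq_intros)
    have "((\<lambda>x. w t * \<eta> (x - t)) has_derivative (\<lambda>h. w t * blinfun_apply (\<eta>' (x - t)) h)) (at x)"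
      by (intro has_derivative_mult_right has_derivative_compose[OF 1 d\<eta>])
    then show "((\<lambda>x. w t * \<eta> (x - t)) has_derivative blinfun_apply (F x t)) (at x within UNIV)"
      by (simp add: F_def blinfun.scaleR_left[abs_def])
    show "(\<lambda>y. w y * \<eta> (x - y)) integrable_on cbox a b"
      by (intro integrable_continuous continuous_intros continuous_on_compose2[OF c\<eta>] continuous_on_subset[OF w(1)]) auto
    show "continuous_on (UNIV \<times> cbox a b) (\<lambda>(x, y). F x y)"
      unfolding F_def case_prod_beta
      by (intro continuous_intros continuous_on_compose2[OF c\<eta>'] continuous_on_compose2[OF w(1)]) auto
  qed auto
  then show "mollify w \<eta> differentiable (at x)" by (auto simp: differentiable_def)
  assume i: "i \<in> Basis"
  have "partial i (mollify w \<eta>) x = blinfun_apply (integral (cbox a b) (F x)) i"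
    using frechet_derivative_at[OF D] by (simp add: partial_def)
  also have "\<dots> = integral (cbox a b) (\<lambda>y. blinfun_apply (F x y) i)"
    by (intro blinfun_apply_integral integrable_continuous cF)
  also have "\<dots> = integral (cbox a b) (\<lambda>y. w y * partial i \<eta> (x - y))"
    by (simp add: F_def blinfun.scaleR_left \<eta>'_app partial_def)
  also have "\<dots> = mollify w (partial i \<eta>) x" using mollify_eq_integral[OF w \<eta>(2)[OF i]] by simp
  finally show "partial i (mollify w \<eta>) x = mollify w (partial i \<eta>) x" .
qed

text \<open>The induction runs over all \<open>\<eta>\<close> at once, because a partial derivative
  of the convolution is the convolution with that derivative of \<open>\<eta>\<close>.\<close>

lemma mollify_C_k:
  fixes w \<eta> :: "'a::euclidean_space \<Rightarrow> real"
  assumes w: "continuous_on UNIV w" "\<And>x. x \<notin> cbox a b \<Longrightarrow> w x = 0"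
    and \<eta>: "\<And>k. C_k k \<eta>"
  shows "C_k k (mollify w \<eta>)"
  using \<eta>
proof (induction k arbitrary: \<eta>)
  case (0 \<eta>)
  have \<eta>1: "\<eta> differentiable_on UNIV" "\<And>i. i \<in> Basis \<Longrightarrow> continuous_on UNIV (partial i \<eta>)"
    using "0.prems"[of "Suc 0"] by simp_all
  have "mollify w \<eta> differentiable_on UNIV"
    using mollify_derivative(1)[OF w \<eta>1] by (simp add: differentiable_on_def)
  then show ?case by (simp add: differentiable_imp_continuous_on)
next
  case (Suc k \<eta>)
  have \<eta>1: "\<eta> differentiable_on UNIV" "\<And>i. i \<in> Basis \<Longrightarrow> continuous_on UNIV (partial i \<eta>)"
    using Suc.prems[of "Suc 0"] by simp_all
  have "partial i (mollify w \<eta>) = mollify w (partial i \<eta>)" if "i \<in> Basis" for i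
    using mollify_derivative(2)[OF w \<eta>1 that] by auto
  moreover have "C_k k (mollify w (partial i \<eta>))" if "i \<in> Basis" for i
  proof (rule Suc.IH)
    show "C_k k (partial i \<eta>)" for k using Suc.prems[of "Suc k"] that by simp
  qed
  ultimately show ?case
    using mollify_derivative(1)[OF w \<eta>1] by (simp add: differentiable_on_def)
qed

section \<open>Density in the stability inequality\<close>

lemma mollify_eq:
  fixes w \<eta> :: "'a::euclidean_space \<Rightarrow> real"
  assumes [measurable]: "w \<in> borel_measurable borel" "\<eta> \<in> borel_measurable borel"
  shows "mollify w \<eta> x = (LINT z|lborel. w (x - z) * \<eta> z)"
proof -
  have "(\<lambda>z. w (x - z) * \<eta> z) \<in> borel_measurable borel" by measurable
  from integral_lborel_translate(2)[OF this, of x] show ?thesis by (simp add: mollify_def)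
qed

text \<open>The convolution is an average of translates of \<open>w\<close> against a probability
  density. Jensen's inequality moves the square inside the average, and each translate has the
  energy of \<open>w\<close> because the kernel depends only on \<open>x - y\<close>.\<close>

lemma energy_mollify:
  fixes w \<eta> :: "'a::euclidean_space \<Rightarrow> real"
  assumes w [measurable]: "w \<in> borel_measurable borel" and D: "\<And>x. \<bar>w x\<bar> \<le> D"
    and \<eta> [measurable]: "\<eta> \<in> borel_measurable borel" and \<eta>0: "\<And>x. 0 \<le> \<eta> x"
    and i\<eta>: "integrable lborel \<eta>" and \<eta>1: "(LINT x|lborel. \<eta> x) = 1"
  shows "energy s (mollify w \<eta>) \<le> energy s w"
proof -
  have intb: "integrable lborel (\<lambda>z. a z * \<eta> z)"
    if [measurable]: "a \<in> borel_measurable borel" and a: "\<And>z. \<bar>a z\<bar> \<le> C" for a :: "'a \<Rightarrow> real" and C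
  proof (rule Bochner_Integration.integrable_bound[of _ "\<lambda>z. C * \<eta> z"])
    show "AE z in lborel. norm (a z * \<eta> z) \<le> norm (C * \<eta> z)"
    proof (rule AE_I2)
      fix z show "norm (a z * \<eta> z) \<le> norm (C * \<eta> z)"
        using a[of z] \<eta>0[of z] by (simp add: abs_mult mult_right_mono)
    qed
  qed (use i\<eta> in auto)
  have jensen: "(mollify w \<eta> x - mollify w \<eta> y)\<^sup>2 \<le> (LINT z|lborel. (w (x - z) - w (y - z))\<^sup>2 * \<eta> z)"
    "integrable lborel (\<lambda>z. (w (x - z) - w (y - z))\<^sup>2 * \<eta> z)" for x y
  proof -
    define a where "a = (\<lambda>z. w (x - z) - w (y - z))"
    have [measurable]: "a \<in> borel_measurable borel" unfolding a_def by measurable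
    have a2: "\<bar>a z\<bar> \<le> 2 * D" for z using D[of "x - z"] D[of "y - z"] by (simp add: a_def)
    have ia: "integrable lborel (\<lambda>z. a z * \<eta> z)" by (rule intb[OF _ a2]) measurable
    have "\<bar>(a z)\<^sup>2\<bar> \<le> (2 * D)\<^sup>2" for z using power_mono[OF a2[of z], of 2] by simp
    then have ia2: "integrable lborel (\<lambda>z. (a z)\<^sup>2 * \<eta> z)" by (intro intb) auto
    define m where "m = (LINT z|lborel. a z * \<eta> z)"
    have m: "mollify w \<eta> x - mollify w \<eta> y = m"
    proof -
      have "integrable lborel (\<lambda>z. w (x - z) * \<eta> z)" "integrable lborel (\<lambda>z. w (y - z) * \<eta> z)"
        by (rule intb[of _ D]; use D in simp)+
      then show ?thesis
        by (simp add: m_def a_def left_diff_distrib mollify_eq)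
    qed
    \<comment> \<open>Jensen's inequality for the square, in the form that the variance of
      \<open>a\<close> under the density \<open>\<eta>\<close> is nonnegative; \<open>m\<close> is
      the mean.\<close>
    have "0 \<le> (LINT z|lborel. (a z - m)\<^sup>2 * \<eta> z)"
      by (rule integral_nonneg_AE) (simp add: \<eta>0)
    also have "\<dots> = (LINT z|lborel. (a z)\<^sup>2 * \<eta> z - 2 * m * (a z * \<eta> z) + m\<^sup>2 * \<eta> z)"
      by (intro Bochner_Integration.integral_cong) (auto simp: power2_eq_square algebra_simps)
    also have "\<dots> = (LINT z|lborel. (a z)\<^sup>2 * \<eta> z) - 2 * m * m + m\<^sup>2 * 1"
      using ia ia2 i\<eta> by (simp add: \<eta>1 m_def)
    finally have "m\<^sup>2 \<le> (LINT z|lborel. (a z)\<^sup>2 * \<eta> z)" by (simp add: power2_eq_square)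
    then show "(mollify w \<eta> x - mollify w \<eta> y)\<^sup>2 \<le> (LINT z|lborel. (w (x - z) - w (y - z))\<^sup>2 * \<eta> z)"
      unfolding m a_def .
    show "integrable lborel (\<lambda>z. (w (x - z) - w (y - z))\<^sup>2 * \<eta> z)" using ia2 by (simp add: a_def)
  qed
  have sq [measurable]: "sqdiff_integral s w \<in> borel_measurable borel" by measurable
  define f where "f = (\<lambda>x y z. ennreal ((w (x - z) - w (y - z))\<^sup>2 * kern s (x - y)) * ennreal (\<eta> z))"
  have "energy s (mollify w \<eta>) \<le> (\<integral>\<^sup>+x. \<integral>\<^sup>+y. \<integral>\<^sup>+z. f x y z \<partial>lborel \<partial>lborel \<partial>lborel)"
    unfolding energy_def sqdiff_integral_def
  proof (intro nn_integral_mono)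
    fix x y :: 'a
    have "ennreal ((mollify w \<eta> x - mollify w \<eta> y)\<^sup>2 * kern s (x - y))
       \<le> ennreal ((LINT z|lborel. (w (x - z) - w (y - z))\<^sup>2 * \<eta> z) * kern s (x - y))"
      by (intro ennreal_leI mult_right_mono jensen) auto
    also have "\<dots> = ennreal (LINT z|lborel. ((w (x - z) - w (y - z))\<^sup>2 * \<eta> z) * kern s (x - y))"
      using jensen(2) by simp
    also have "\<dots> = (\<integral>\<^sup>+z. ennreal (((w (x - z) - w (y - z))\<^sup>2 * \<eta> z) * kern s (x - y)) \<partial>lborel)"
      using jensen(2) by (intro nn_integral_eq_integral[symmetric]) (auto simp: \<eta>0)
    also have "\<dots> = (\<integral>\<^sup>+z. f x y z \<partial>lborel)"
      by (intro nn_integral_cong) (simp add: f_def \<eta>0 mult_ac flip: ennreal_mult)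
    finally show "ennreal ((mollify w \<eta> x - mollify w \<eta> y)\<^sup>2 * kern s (x - y)) \<le> (\<integral>\<^sup>+z. f x y z \<partial>lborel)" .
  qed
  also have "\<dots> = (\<integral>\<^sup>+x. \<integral>\<^sup>+z. sqdiff_integral s w (x - z) * ennreal (\<eta> z) \<partial>lborel \<partial>lborel)"
  proof (rule nn_integral_cong)
    fix x :: 'a
    have "(\<integral>\<^sup>+y. \<integral>\<^sup>+z. f x y z \<partial>lborel \<partial>lborel) = (\<integral>\<^sup>+z. \<integral>\<^sup>+y. f x y z \<partial>lborel \<partial>lborel)"
      unfolding f_def by (rule lborel_pair.Fubini'[symmetric]) (simp add: case_prod_beta)
    also have "\<dots> = (\<integral>\<^sup>+z. sqdiff_integral s w (x - z) * ennreal (\<eta> z) \<partial>lborel)"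
    proof (rule nn_integral_cong)
      fix z :: 'a
      have m: "(\<lambda>y. ennreal ((w (x - z) - w y)\<^sup>2 * kern s ((x - z) - y))) \<in> borel_measurable borel"
        by measurable
      have "(\<integral>\<^sup>+y. f x y z \<partial>lborel) = (\<integral>\<^sup>+y. ennreal ((w (x - z) - w (y - z))\<^sup>2 * kern s ((x - z) - (y - z))) \<partial>lborel) * ennreal (\<eta> z)"
        unfolding f_def by (subst nn_integral_multc) auto
      also have "\<dots> = sqdiff_integral s w (x - z) * ennreal (\<eta> z)"
        unfolding sqdiff_integral_def by (subst nn_integral_lborel_translate(3)[OF m]) (rule refl)
      finally show "(\<integral>\<^sup>+y. f x y z \<partial>lborel) = sqdiff_integral s w (x - z) * ennreal (\<eta> z)" .
    qed
    finally show "(\<integral>\<^sup>+y. \<integral>\<^sup>+z. f x y z \<partial>lborel \<partial>lborel) = (\<integral>\<^sup>+z. sqdiff_integral s w (x - z) * ennreal (\<eta> z) \<partial>lborel)" .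
  qed
  also have "\<dots> = (\<integral>\<^sup>+z. \<integral>\<^sup>+x. sqdiff_integral s w (x - z) * ennreal (\<eta> z) \<partial>lborel \<partial>lborel)"
    by (rule lborel_pair.Fubini'[symmetric]) (simp add: case_prod_beta)
  also have "\<dots> = (\<integral>\<^sup>+z. energy s w * ennreal (\<eta> z) \<partial>lborel)"
  proof (rule nn_integral_cong)
    fix z :: 'a
    have "(\<integral>\<^sup>+x. sqdiff_integral s w (x - z) * ennreal (\<eta> z) \<partial>lborel) = (\<integral>\<^sup>+x. sqdiff_integral s w (x - z) \<partial>lborel) * ennreal (\<eta> z)"
      by (rule nn_integral_multc) measurable
    also have "\<dots> = energy s w * ennreal (\<eta> z)"
      unfolding energy_def by (subst nn_integral_lborel_translate(3)) auto
    finally show "(\<integral>\<^sup>+x. sqdiff_integral s w (x - z) * ennreal (\<eta> z) \<partial>lborel) = energy s w * ennreal (\<eta> z)" .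
  qed
  also have "\<dots> = energy s w * (\<integral>\<^sup>+z. ennreal (\<eta> z) \<partial>lborel)"
    by (rule nn_integral_cmult) measurable
  also have "(\<integral>\<^sup>+z. ennreal (\<eta> z) \<partial>lborel) = 1"
    using nn_integral_eq_integral[OF i\<eta>] \<eta>0 \<eta>1 by simp
  finally show ?thesis by simp
qed

text \<open>
  Integrability of the inner integrals is not needed here: the Bochner integral of a nonintegrable function is
  \<open>0\<close>, which only helps.
\<close>

lemma LINT_energy_le:
  fixes \<phi> :: "'a::euclidean_space \<Rightarrow> real"
  assumes \<phi>: "continuous_on UNIV \<phi>" and B: "energy s \<phi> \<le> ennreal B" "0 \<le> B"
  shows "(LINT x|lebesgue. LINT y|lebesgue. (\<phi> x - \<phi> y)\<^sup>2 / norm (x - y) powr (real DIM('a) + 2 * s)) \<le> B"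
proof -
  have [measurable]: "\<phi> \<in> borel_measurable borel" using \<phi> by (rule borel_measurable_continuous_onI)
  have sq [measurable]: "sqdiff_integral s \<phi> \<in> borel_measurable borel" by measurable
  have inner: "(LINT y|lebesgue. (\<phi> x - \<phi> y)\<^sup>2 / norm (x - y) powr (real DIM('a) + 2 * s)) = enn2real (sqdiff_integral s \<phi> x)" for x
  proof -
    have "(LINT y|lebesgue. (\<phi> x - \<phi> y)\<^sup>2 / norm (x - y) powr (real DIM('a) + 2 * s))
        = (LINT y|lebesgue. (\<phi> x - \<phi> y)\<^sup>2 * kern s (x - y))"
      by (simp add: kern_def)
    also have "\<dots> = (LINT y|lborel. (\<phi> x - \<phi> y)\<^sup>2 * kern s (x - y))"
      by (rule integral_completion) measurable
    also have "\<dots> = enn2real (sqdiff_integral s \<phi> x)"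
      unfolding sqdiff_integral_def by (rule integral_eq_nn_integral) auto
    finally show ?thesis .
  qed
  have "(LINT x|lebesgue. enn2real (sqdiff_integral s \<phi> x)) = (LINT x|lborel. enn2real (sqdiff_integral s \<phi> x))"
    by (rule integral_completion) measurable
  also have "\<dots> = enn2real (\<integral>\<^sup>+x. ennreal (enn2real (sqdiff_integral s \<phi> x)) \<partial>lborel)"
    by (rule integral_eq_nn_integral) auto
  also have "\<dots> \<le> B"
  proof (rule enn2real_leI)
    have "(\<integral>\<^sup>+x. ennreal (enn2real (sqdiff_integral s \<phi> x)) \<partial>lborel) \<le> energy s \<phi>"
      unfolding energy_def by (intro nn_integral_mono) (simp add: ennreal_enn2real_if)
    also have "\<dots> \<le> ennreal B" by (rule B)
    finally show "(\<integral>\<^sup>+x. ennreal (enn2real (sqdiff_integral s \<phi> x)) \<partial>lborel) \<le> ennreal B" .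
  qed (rule B)
  finally show ?thesis unfolding inner .
qed

text \<open>One estimate with three uses: \<open>c = 0\<close>, \<open>e = 0\<close> controls the
  support of the mollified function, \<open>c = 0\<close> with \<open>e\<close> a bound of
  \<open>w\<close> controls its size, and \<open>c = w x\<close> gives pointwise
  convergence.\<close>

lemma mollify_dist_le:
  fixes w \<eta> :: "'a::euclidean_space \<Rightarrow> real"
  assumes w [measurable]: "w \<in> borel_measurable borel" and D: "\<And>x. \<bar>w x\<bar> \<le> D"
    and \<eta> [measurable]: "\<eta> \<in> borel_measurable borel" and \<eta>0: "\<And>x. 0 \<le> \<eta> x"
    and i\<eta>: "integrable lborel \<eta>" and \<eta>1: "(LINT x|lborel. \<eta> x) = 1"
    and \<eta>s: "\<And>z. norm z \<ge> \<delta> \<Longrightarrow> \<eta> z = 0"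
    and e: "\<And>z. norm z < \<delta> \<Longrightarrow> \<bar>w (x - z) - c\<bar> \<le> e"
  shows "\<bar>mollify w \<eta> x - c\<bar> \<le> e"
proof -
  have i: "integrable lborel (\<lambda>z. w (x - z) * \<eta> z)"
  proof (rule Bochner_Integration.integrable_bound[of _ "\<lambda>z. D * \<eta> z"])
    show "AE z in lborel. norm (w (x - z) * \<eta> z) \<le> norm (D * \<eta> z)"
    proof (rule AE_I2)
      fix z show "norm (w (x - z) * \<eta> z) \<le> norm (D * \<eta> z)"
        using D[of "x - z"] \<eta>0[of z] by (simp add: abs_mult mult_right_mono)
    qed
  qed (use i\<eta> in auto)
  have "mollify w \<eta> x - c = (LINT z|lborel. w (x - z) * \<eta> z - c * \<eta> z)"
    using i i\<eta> by (simp add: mollify_eq \<eta>1)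
  also have "\<bar>\<dots>\<bar> \<le> (LINT z|lborel. e * \<eta> z)"
  proof (rule integral_abs_bound_integral)
    fix z :: 'a
    have "w (x - z) * \<eta> z - c * \<eta> z = (w (x - z) - c) * \<eta> z" by (simp add: left_diff_distrib)
    then show "\<bar>w (x - z) * \<eta> z - c * \<eta> z\<bar> \<le> e * \<eta> z"
      using e[of z] \<eta>s[of z] \<eta>0[of z] by (cases "norm z < \<delta>") (simp_all add: abs_mult mult_right_mono)
  qed (use i i\<eta> in auto)
  also have "\<dots> = e" by (simp add: \<eta>1)
  finally show ?thesis .
qed

lemma bounded_on_cball:
  fixes h :: "'a::euclidean_space \<Rightarrow> real"
  assumes "continuous_on UNIV h"
  shows "\<exists>D\<ge>0. \<forall>x. norm x \<le> R \<longrightarrow> \<bar>h x\<bar> \<le> D"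
proof -
  have "bounded (h ` cball 0 R)"
    by (intro compact_imp_bounded compact_continuous_image continuous_on_subset[OF assms]) auto
  then obtain D where D: "\<And>x. norm x \<le> R \<Longrightarrow> \<bar>h x\<bar> \<le> D" unfolding bounded_iff by force
  then have "\<forall>x. norm x \<le> R \<longrightarrow> \<bar>h x\<bar> \<le> \<bar>D\<bar>" by fastforce
  then show ?thesis by (intro exI[of _ "\<bar>D\<bar>"]) auto
qed

text \<open>Mollification does not increase the energy, so the right-hand side keeps the bound
  \<open>B\<close> all along and only the left-hand side is passed to the limit; convergence of
  energies is never asked for.\<close>

lemma stability_density:
  fixes V w :: "'a::euclidean_space \<Rightarrow> real"
  assumes stab: "\<And>\<phi>. \<phi> \<in> test_functions \<Longrightarrow> (LINT x|lebesgue. V x * (\<phi> x)\<^sup>2) \<le>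
       c * (LINT x|lebesgue. LINT y|lebesgue. (\<phi> x - \<phi> y)\<^sup>2 / norm (x - y) powr (real DIM('a) + 2 * s))"
    and c: "0 \<le> c" and V: "continuous_on UNIV V"
    and w: "continuous_on UNIV w" "\<And>x. norm x > R \<Longrightarrow> w x = 0"
    and B: "energy s w \<le> ennreal B" "0 \<le> B"
  shows "(LINT x|lborel. V x * (w x)\<^sup>2) \<le> c * B"
proof -
  have [measurable]: "V \<in> borel_measurable borel" "w \<in> borel_measurable borel"
    using V w by (auto intro: borel_measurable_continuous_onI)
  obtain D where D0: "D \<ge> 0" "\<And>x. norm x \<le> R \<Longrightarrow> \<bar>w x\<bar> \<le> D" using bounded_on_cball[OF w(1)] by blast
  have D: "\<bar>w x\<bar> \<le> D" for x using D0(1) D0(2)[of x] w(2)[of x] by (cases "norm x \<le> R") auto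
  obtain b where "cball 0 R \<subseteq> cbox (- b) (b::'a)"
    using bounded_subset_cbox_symmetric[OF bounded_cball] by blast
  then have wbox: "w x = 0" if "x \<notin> cbox (- b) b" for x
    using that w(2)[of x] by (cases "norm x \<le> R") auto
  define \<delta> where "\<delta> = (\<lambda>n. 1 / real (Suc n))"
  have \<delta>: "\<delta> n > 0" "\<delta> n \<le> 1" for n by (auto simp: \<delta>_def)
  have "\<exists>\<eta>::'a \<Rightarrow> real. (\<forall>k. C_k k \<eta>) \<and> (\<forall>x. 0 \<le> \<eta> x) \<and> (\<forall>x. norm x \<ge> \<delta> n \<longrightarrow> \<eta> x = 0)
      \<and> integrable lborel \<eta> \<and> (LINT x|lborel. \<eta> x) = 1" for n
    by (rule exists_bump[OF \<delta>(1)[of n], where ?'a='a]) blast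
  then obtain \<eta> :: "nat \<Rightarrow> 'a \<Rightarrow> real" where \<eta>: "\<And>n k. C_k k (\<eta> n)" "\<And>n x. 0 \<le> \<eta> n x"
    "\<And>n x. norm x \<ge> \<delta> n \<Longrightarrow> \<eta> n x = 0" "\<And>n. integrable lborel (\<eta> n)" "\<And>n. (LINT x|lborel. \<eta> n x) = 1"
    by metis
  have \<eta>m [measurable]: "\<eta> n \<in> borel_measurable borel" for n
    using \<eta>(4)[of n] by auto
  define \<phi> where "\<phi> = (\<lambda>n. mollify w (\<eta> n))"
  note dist = mollify_dist_le[OF _ D \<eta>m \<eta>(2) \<eta>(4) \<eta>(5) \<eta>(3)]
  have Ck: "C_k k (\<phi> n)" for n k
    unfolding \<phi>_def by (rule mollify_C_k[OF w(1) wbox \<eta>(1)])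
  have \<phi>0: "\<phi> n x = 0" if "norm x > R + 1" for n x
  proof -
    have "\<bar>\<phi> n x - 0\<bar> \<le> 0" unfolding \<phi>_def
    proof (rule dist)
      fix z :: 'a assume "norm z < \<delta> n"
      then have "norm (x - z) > R" using norm_triangle_ineq2[of x z] that \<delta>(2)[of n] by linarith
      then show "\<bar>w (x - z) - 0\<bar> \<le> 0" using w(2) by simp
    qed simp
    then show ?thesis by simp
  qed
  have \<phi>D: "\<bar>\<phi> n x\<bar> \<le> D" for n x
  proof -
    have "\<bar>\<phi> n x - 0\<bar> \<le> D" unfolding \<phi>_def by (rule dist) (use D in auto)
    then show ?thesis by simp
  qed
  have c\<phi>: "continuous_on UNIV (\<phi> n)" for n using Ck[of 0] by simp
  have [measurable]: "\<phi> n \<in> borel_measurable borel" for n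
    using c\<phi> by (rule borel_measurable_continuous_onI)
  have test: "\<phi> n \<in> test_functions" for n
  proof -
    have "{x. \<phi> n x \<noteq> 0} \<subseteq> cball 0 (R + 1)" using \<phi>0[of _ n] by force
    then have "bounded {x. \<phi> n x \<noteq> 0}" using bounded_cball bounded_subset by blast
    then show ?thesis using Ck by (simp add: test_functions_def)
  qed
  have le: "(LINT x|lborel. V x * (\<phi> n x)\<^sup>2) \<le> c * B" for n
  proof -
    have "(LINT x|lborel. V x * (\<phi> n x)\<^sup>2) = (LINT x|lebesgue. V x * (\<phi> n x)\<^sup>2)"
      by (rule integral_completion[symmetric]) measurable
    also have "\<dots> \<le> c * (LINT x|lebesgue. LINT y|lebesgue. (\<phi> n x - \<phi> n y)\<^sup>2 / norm (x - y) powr (real DIM('a) + 2 * s))"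
      by (rule stab[OF test])
    also have "\<dots> \<le> c * B"
    proof (intro mult_left_mono c LINT_energy_le c\<phi> B)
      have "energy s (\<phi> n) \<le> energy s w"
        unfolding \<phi>_def by (rule energy_mollify[OF _ D \<eta>m \<eta>(2) \<eta>(4) \<eta>(5)]) measurable
      then show "energy s (\<phi> n) \<le> ennreal B" using B(1) by (rule order_trans)
    qed
    finally show ?thesis .
  qed
  obtain K where K: "K \<ge> 0" "\<And>x. norm x \<le> R + 1 \<Longrightarrow> \<bar>V x\<bar> \<le> K" using bounded_on_cball[OF V] by blast
  have "(\<lambda>n. LINT x|lborel. V x * (\<phi> n x)\<^sup>2) \<longlonglongrightarrow> (LINT x|lborel. V x * (w x)\<^sup>2)"
  proof (rule integral_dominated_convergence)
    have "integrable lborel (\<lambda>x::'a. indicator (cball 0 (R + 1)) x *\<^sub>R (K * D\<^sup>2))"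
      by (rule integrable_indicator) (auto simp: emeasure_bounded_finite[unfolded infinity_ennreal_def])
    then show "integrable lborel (\<lambda>x::'a. K * D\<^sup>2 * indicator (cball 0 (R + 1)) x)" by (simp add: mult.commute)
    show "AE x in lborel. norm (V x * (\<phi> n x)\<^sup>2) \<le> K * D\<^sup>2 * indicator (cball 0 (R + 1)) x" for n
    proof (rule AE_I2)
      fix x :: 'a
      show "norm (V x * (\<phi> n x)\<^sup>2) \<le> K * D\<^sup>2 * indicator (cball 0 (R + 1)) x"
      proof (cases "norm x \<le> R + 1")
        case True
        have "\<bar>\<phi> n x\<bar>\<^sup>2 \<le> D\<^sup>2" by (intro power_mono \<phi>D) auto
        then have "\<bar>V x\<bar> * (\<phi> n x)\<^sup>2 \<le> K * D\<^sup>2" using K(1) K(2)[of x] True by (intro mult_mono) auto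
        then show ?thesis using True by (simp add: abs_mult)
      qed (use \<phi>0[of x n] in auto)
    qed
    show "AE x in lborel. (\<lambda>n. V x * (\<phi> n x)\<^sup>2) \<longlonglongrightarrow> V x * (w x)\<^sup>2"
    proof (intro AE_I2 tendsto_mult tendsto_const tendsto_power)
      fix x :: 'a
      show "(\<lambda>n. \<phi> n x) \<longlonglongrightarrow> w x"
      proof (rule LIMSEQ_I)
        fix e :: real assume e: "e > 0"
        have "isCont w x" using w(1) by (simp add: continuous_on_eq_continuous_at)
        then obtain d where d: "d > 0" "\<And>y. dist y x < d \<Longrightarrow> dist (w y) (w x) < e / 2"
          using e unfolding continuous_at_eps_delta by (metis half_gt_zero)
        have "\<forall>\<^sub>F n in sequentially. \<delta> n < d"
          using order_tendstoD(2)[OF LIMSEQ_Suc[OF lim_1_over_n] d(1)] by (simp add: \<delta>_def)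
        then obtain n0 where n0: "\<And>n. n \<ge> n0 \<Longrightarrow> \<delta> n < d" by (auto simp: eventually_sequentially)
        have "norm (\<phi> n x - w x) < e" if "n \<ge> n0" for n
        proof -
          have "\<bar>\<phi> n x - w x\<bar> \<le> e / 2" unfolding \<phi>_def
          proof (rule dist)
            fix z :: 'a assume "norm z < \<delta> n"
            then have "dist (x - z) x < d" using n0[OF that] by (simp add: dist_norm)
            then show "\<bar>w (x - z) - w x\<bar> \<le> e / 2" using d(2)[of "x - z"] by (simp add: dist_real_def)
          qed simp
          then show ?thesis using e by simp
        qed
        then show "\<exists>n0. \<forall>n\<ge>n0. norm (\<phi> n x - w x) < e" by blast
      qed
    qed
  qed auto
  then show ?thesis by (rule LIMSEQ_le_const2) (use le in auto)
qed

section \<open>Polynomial weights\<close>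

text \<open>The square decays like \<open>norm x powr (- (N + 2 * s))\<close>, as the kernel does.
  This is the fastest decay for which the carre du champ can be bounded by a multiple of the square,
  since the mass near the origin alone contributes a tail of that order; and it is
  integrable.\<close>

definition weight :: "real \<Rightarrow> real \<Rightarrow> 'a::euclidean_space \<Rightarrow> real" where
  "weight s R x = (1 + norm x / R) powr (- ((real DIM('a) + 2 * s) / 2))"

lemma weight_pos: "R > 0 \<Longrightarrow> weight s R x > 0"
  unfolding weight_def by (smt (verit) divide_nonneg_pos norm_ge_zero powr_gt_zero)

lemma weight_le_one:
  assumes "R > 0" "s > 0"
  shows "weight s R (x::'a::euclidean_space) \<le> 1"
proof -
  have "(1 + norm x / R) powr (- ((real DIM('a) + 2 * s) / 2)) \<le> 1 powr (- ((real DIM('a) + 2 * s) / 2))"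
    using assms by (intro powr_mono2') auto
  then show ?thesis by (simp add: weight_def)
qed

lemma weight_continuous: "R > 0 \<Longrightarrow> continuous_on UNIV (weight s R)"
  unfolding weight_def[abs_def]
  by (intro continuous_intros) (auto simp: add_nonneg_eq_0_iff)

lemma weight_mono:
  assumes "0 < r" "r \<le> R" "s > 0"
  shows "weight s r (x::'a::euclidean_space) \<le> weight s R x"
proof -
  have "norm x / R \<le> norm x / r" using assms by (intro divide_left_mono) auto
  then show ?thesis using assms unfolding weight_def by (intro powr_mono2') (auto intro!: add_pos_nonneg)
qed

lemma weight_scale: "weight s R x = weight s 1 ((1 / R) *\<^sub>R x)" if "R > 0"
  using that by (simp add: weight_def)

lemma weight_sq: "(weight s R (x::'a::euclidean_space))\<^sup>2 = (1 + norm x / R) powr (- (real DIM('a) + 2 * s))"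
proof -
  have "- (c / 2) + - (c / 2) = - c" for c :: real by simp
  then show ?thesis unfolding weight_def power2_eq_square powr_add[symmetric] by simp
qed

lemma kern_eq_powr: "kern s (h::'a::euclidean_space) = norm h powr (- (real DIM('a) + 2 * s))"
  unfolding kern_def by (rule powr_minus_divide[symmetric])

lemma weight_small_outside_ball:
  assumes "R > 0" "s > 0" "e > 0"
  shows "\<exists>S. \<forall>x::'a::euclidean_space. norm x > S \<longrightarrow> weight s R x < e"
proof -
  have "((\<lambda>t::real. t powr (- ((real DIM('a) + 2 * s) / 2))) \<longlongrightarrow> 0) at_top"
    using assms by (intro tendsto_neg_powr filterlim_ident) auto
  then have "\<forall>\<^sub>F t::real in at_top. t powr (- ((real DIM('a) + 2 * s) / 2)) < e"
    using assms by (intro order_tendstoD) auto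
  then obtain T where T: "\<And>t. t \<ge> T \<Longrightarrow> t powr (- ((real DIM('a) + 2 * s) / 2)) < e"
    by (auto simp: eventually_at_top_linorder)
  have "weight s R x < e" if "norm x > R * \<bar>T\<bar>" for x :: 'a
  proof -
    have "\<bar>T\<bar> \<le> norm x / R" using that assms by (simp add: field_simps)
    then show ?thesis unfolding weight_def by (intro T) auto
  qed
  then show ?thesis by blast
qed

lemma abs_diff_powr_neg_le:
  fixes p m a b :: real
  assumes "p > 0" "m > 0" "m \<le> a" "m \<le> b"
  shows "\<bar>a powr (- p) - b powr (- p)\<bar> \<le> p * m powr (- p - 1) * \<bar>a - b\<bar>"
proof -
  have "norm (a powr (- p) - b powr (- p)) \<le> p * m powr (- p - 1) * norm (a - b)"
  proof (rule field_differentiable_bound[of "{m..}" _ "\<lambda>t. - p * t powr (- p - 1)"])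
    fix z assume z: "z \<in> {m..}"
    then have "z > 0" using assms by auto
    then show "((\<lambda>t. t powr (- p)) has_field_derivative - p * z powr (- p - 1)) (at z within {m..})"
      by (intro has_real_derivative_powr[THEN DERIV_subset]) auto
    have "z powr (- p - 1) \<le> m powr (- p - 1)" using z assms by (intro powr_mono2') auto
    then show "norm (- p * z powr (- p - 1)) \<le> p * m powr (- p - 1)" using assms by (simp add: abs_mult)
  qed (use assms in auto)
  then show ?thesis by simp
qed

text \<open>For \<open>R = 1\<close> the square is at most 1 inside the unit ball and at most the
  kernel outside it; a dilation then produces the factor \<open>R ^ N\<close>.\<close>

lemma nn_integral_weight_sq:
  assumes s: "s > 0"
  shows "\<exists>C>0. \<forall>R>0. (\<integral>\<^sup>+x. ennreal ((weight s R (x::'a::euclidean_space))\<^sup>2) \<partial>lborel) \<le> ennreal (C * R ^ DIM('a))"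
proof -
  have wm [measurable]: "weight s R \<in> borel_measurable (borel :: 'a measure)" if "R > 0" for R
    using weight_continuous[OF that] by (rule borel_measurable_continuous_onI)
  define I where "I = (\<integral>\<^sup>+x. ennreal ((weight s 1 (x::'a))\<^sup>2) \<partial>lborel)"
  have "I \<le> (\<integral>\<^sup>+x. indicator (ball (0::'a) 1) x + ennreal (indicator (- ball 0 1) x * kern s x) \<partial>lborel)"
    unfolding I_def
  proof (rule nn_integral_mono)
    fix x :: 'a
    show "ennreal ((weight s 1 x)\<^sup>2) \<le> indicator (ball 0 1) x + ennreal (indicator (- ball 0 1) x * kern s x)"
    proof (cases "norm x < 1")
      case True
      have "(weight s 1 x)\<^sup>2 \<le> 1"
        using weight_le_one[of 1 s x] weight_pos[of 1 s x] s by (simp add: power_le_one)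
      then show ?thesis using True by (simp add: ennreal_le_1)
    next
      case False
      have "(weight s 1 x)\<^sup>2 \<le> norm x powr (- (real DIM('a) + 2 * s))"
        using False s by (subst weight_sq) (auto intro!: powr_mono2')
      also have "\<dots> = kern s x" by (simp add: kern_eq_powr)
      finally show ?thesis using False by (auto intro: ennreal_leI)
    qed
  qed
  also have "\<dots> = emeasure lborel (ball (0::'a) 1) + (\<integral>\<^sup>+x. ennreal (indicator (- ball 0 1) (x::'a) * kern s x) \<partial>lborel)"
  proof -
    have [measurable]: "ball (0::'a) 1 \<in> sets borel" by simp
    have "(\<lambda>x::'a. ennreal (indicator (- ball 0 1) x * kern s x)) \<in> borel_measurable lborel" by measurable
    then show ?thesis by (subst nn_integral_add) auto
  qed
  also have "\<dots> < \<infinity>"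
    using nn_integral_kern_far[OF s, of 1, where ?'a='a] emeasure_lborel_ball_finite[of "0::'a" 1] by simp
  finally have I: "I < \<infinity>" .
  define C where "C = enn2real I + 1"
  have C: "C > 0" "I \<le> ennreal C"
  proof -
    show "C > 0" by (simp add: C_def add_nonneg_pos)
    have "I = ennreal (enn2real I)" using I by simp
    also have "\<dots> \<le> ennreal C" by (intro ennreal_leI) (simp add: C_def)
    finally show "I \<le> ennreal C" .
  qed
  have "(\<integral>\<^sup>+x. ennreal ((weight s R (x::'a))\<^sup>2) \<partial>lborel) \<le> ennreal (C * R ^ DIM('a))" if R: "R > 0" for R
  proof -
    have "(\<integral>\<^sup>+x. ennreal ((weight s R (x::'a))\<^sup>2) \<partial>lborel)
       = ennreal (R ^ DIM('a)) * (\<integral>\<^sup>+x. ennreal ((weight s R (0 + R *\<^sub>R x :: 'a))\<^sup>2) \<partial>lborel)"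
      using nn_integral_lborel_affine[of "\<lambda>x::'a. ennreal ((weight s R x)\<^sup>2)" R 0] R wm[OF R] by simp
    also have "(\<lambda>x. weight s R (0 + R *\<^sub>R x :: 'a)) = weight s 1"
      using R by (auto simp: weight_scale[OF R])
    also have "ennreal (R ^ DIM('a)) * (\<integral>\<^sup>+x. ennreal ((weight s 1 (x::'a))\<^sup>2) \<partial>lborel) \<le> ennreal (R ^ DIM('a)) * ennreal C"
      using C(2) unfolding I_def by (intro mult_left_mono) auto
    also have "\<dots> = ennreal (C * R ^ DIM('a))" using R C by (simp add: mult.commute flip: ennreal_mult)
    finally show ?thesis .
  qed
  then show ?thesis using C by blast
qed

lemma kern_scale: "kern s (R *\<^sub>R h :: 'a::euclidean_space) = R powr (- (real DIM('a) + 2 * s)) * kern s h" if "R > 0"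
  using that by (simp add: kern_def powr_mult powr_minus_divide del: minus_add_distrib)

text \<open>While \<open>norm (x - y) < 1\<close>, both \<open>1 + norm x\<close> and
  \<open>1 + norm y\<close> are at least half of \<open>1 + norm x\<close>, so the derivative of the
  radial profile between them is bounded by a multiple of the weight at \<open>x\<close>
  itself.\<close>

lemma weight_near:
  fixes x y :: "'a::euclidean_space"
  assumes s: "s > 0" and xy: "norm (x - y) < 1"
  defines "p \<equiv> (real DIM('a) + 2 * s) / 2"
  shows "\<bar>weight s 1 x - weight s 1 y\<bar> \<le> p * 2 powr (p + 1) * weight s 1 x * norm (x - y)"
proof -
  have p: "p > 0" using s by (simp add: p_def add_nonneg_pos)
  have w: "weight s 1 z = (1 + norm z) powr (- p)" for z :: 'a by (simp add: weight_def p_def)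
  define m where "m = (1 + norm x) / 2"
  have m: "m > 0" unfolding m_def by (auto intro!: add_pos_nonneg)
  have nxy: "\<bar>norm x - norm y\<bar> \<le> norm (x - y)" by (rule norm_triangle_ineq3)
  have "m \<le> 1 + norm y" using norm_triangle_sub[of x y] xy norm_ge_zero[of y] unfolding m_def by argo
  then have "\<bar>(1 + norm x) powr (- p) - (1 + norm y) powr (- p)\<bar> \<le> p * m powr (- p - 1) * \<bar>(1 + norm x) - (1 + norm y)\<bar>"
    using p m by (intro abs_diff_powr_neg_le) (auto simp: m_def)
  also have "\<dots> \<le> p * (2 powr (p + 1) * (1 + norm x) powr (- p)) * norm (x - y)"
  proof (intro mult_mono mult_left_mono)
    have "m powr (- p - 1) = (1 + norm x) powr (- p - 1) / 2 powr (- p - 1)"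
      unfolding m_def by (rule powr_divide)
    also have "\<dots> = 2 powr (p + 1) * (1 + norm x) powr (- p - 1)"
      using powr_minus_divide[of 2 "p + 1"] by simp
    also have "\<dots> \<le> 2 powr (p + 1) * (1 + norm x) powr (- p)"
      by (intro mult_left_mono powr_mono) auto
    finally show "m powr (- p - 1) \<le> 2 powr (p + 1) * (1 + norm x) powr (- p)" .
  qed (use p nxy in auto)
  finally show ?thesis by (simp add: w mult.assoc)
qed

text \<open>By the triangle inequality \<open>x - y\<close> and \<open>y\<close> cannot both be
  short compared with \<open>x\<close>. Hence one factor on the left is at most a constant times
  \<open>(weight s 1 x)^2\<close>, and the other survives on the right as a function that is
  integrable in \<open>y\<close>.\<close>

lemma weight_far:
  fixes x y :: "'a::euclidean_space"
  assumes s: "s > 0" and xy: "norm (x - y) \<ge> 1"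
  shows "(weight s 1 y)\<^sup>2 * kern s (x - y) \<le> 3 powr (real DIM('a) + 2 * s) * (weight s 1 x)\<^sup>2 * ((weight s 1 y)\<^sup>2 + kern s (x - y))"
proof -
  define q where "q = real DIM('a) + 2 * s"
  have q: "q > 0" using s by (simp add: q_def add_nonneg_pos)
  have w: "(weight s 1 z)\<^sup>2 = (1 + norm z) powr (- q)" for z :: 'a by (simp add: weight_sq q_def)
  have k: "kern s h = norm h powr (- q)" for h :: 'a by (simp add: kern_eq_powr q_def)
  \<comment> \<open>If \<open>r \<ge> 1\<close> and \<open>2 * r \<ge> norm x\<close>, then
    \<open>3 * r \<ge> 1 + norm x\<close>; this is the origin of the constant 3.\<close>
  have three: "r powr (- q) \<le> 3 powr q * (1 + norm x) powr (- q)" if "r \<ge> (1 + norm x) / 3" for r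
  proof -
    have "r powr (- q) \<le> ((1 + norm x) / 3) powr (- q)"
      using that q by (intro powr_mono2') (auto intro!: add_pos_nonneg)
    also have "\<dots> = (1 + norm x) powr (- q) / 3 powr (- q)" by (rule powr_divide)
    also have "\<dots> = 3 powr q * (1 + norm x) powr (- q)" using powr_minus_divide[of 3 q] by simp
    finally show ?thesis .
  qed
  have tri: "norm x \<le> norm (x - y) + norm y" using norm_triangle_ineq[of "x - y" y] by simp
  show ?thesis
  proof (cases "norm (x - y) \<ge> norm x / 2")
    case True
    then have "kern s (x - y) \<le> 3 powr q * (1 + norm x) powr (- q)"
      unfolding k using xy by (intro three) auto
    then have "(weight s 1 y)\<^sup>2 * kern s (x - y) \<le> (weight s 1 y)\<^sup>2 * (3 powr q * (1 + norm x) powr (- q))"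
      by (intro mult_left_mono) auto
    also have "\<dots> \<le> 3 powr q * (1 + norm x) powr (- q) * ((weight s 1 y)\<^sup>2 + kern s (x - y))"
      by (simp add: algebra_simps)
    finally show ?thesis by (simp add: w[of x] q_def)
  next
    case False
    then have "(weight s 1 y)\<^sup>2 \<le> 3 powr q * (1 + norm x) powr (- q)"
      unfolding w using tri xy norm_ge_zero[of x] by (intro three) argo
    then have "(weight s 1 y)\<^sup>2 * kern s (x - y) \<le> (3 powr q * (1 + norm x) powr (- q)) * kern s (x - y)"
      by (intro mult_right_mono) auto
    also have "\<dots> \<le> 3 powr q * (1 + norm x) powr (- q) * ((weight s 1 y)\<^sup>2 + kern s (x - y))"
      by (simp add: algebra_simps)
    finally show ?thesis by (simp add: w[of x] q_def)
  qed
qed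

text \<open>At \<open>R = 1\<close> the pairs with \<open>norm (x - y) < 1\<close> are handled by
  \<open>weight_near\<close> and the others by \<open>weight_far\<close>; both leave
  \<open>(weight s 1 x)^2\<close> times an integral that is finite and independent of
  \<open>x\<close>. The dilation contributes \<open>R ^ N\<close> from the measure and
  \<open>R powr (- N - 2 * s)\<close> from the kernel, whence
  \<open>R powr (- 2 * s)\<close>.\<close>

lemma sqdiff_integral_weight:
  assumes s: "0 < s" "s < 1"
  shows "\<exists>C>0. \<forall>R>0. \<forall>x::'a::euclidean_space.
     sqdiff_integral s (weight s R) x \<le> ennreal (C * R powr (- 2 * s) * (weight s R x)\<^sup>2)"
proof -
  define p where "p = (real DIM('a) + 2 * s) / 2"
  define c1 where "c1 = (p * 2 powr (p + 1))\<^sup>2"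
  \<comment> \<open>The summand 1 accounts for the term \<open>X^2 * k\<close>, the power of 3 for
    \<open>Y^2 * k\<close> through \<open>weight_far\<close>.\<close>
  define c2 where "c2 = 1 + 3 powr (real DIM('a) + 2 * s)"
  have c: "c1 \<ge> 0" "c2 \<ge> 0" by (auto simp: c1_def c2_def)
  define G1 where "G1 = (\<lambda>h::'a. ennreal ((if norm h < 1 then c1 * norm h powr 2 else c2) * kern s h))"
  define G2 where "G2 = (\<lambda>y::'a. ennreal (c2 * (weight s 1 y)\<^sup>2))"
  have [measurable]: "weight s 1 \<in> borel_measurable (borel :: 'a measure)"
    by (rule borel_measurable_continuous_onI[OF weight_continuous]) simp
  have [measurable]: "G1 \<in> borel_measurable borel" unfolding G1_def by measurable
  have [measurable]: "G2 \<in> borel_measurable borel" unfolding G2_def by measurable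
  have I1: "(\<integral>\<^sup>+h. G1 h \<partial>lborel) < \<infinity>"
    unfolding G1_def by (rule nn_integral_kern_min) (use s c in auto)
  obtain C0 where C0: "C0 > 0" "\<And>R. R > 0 \<Longrightarrow> (\<integral>\<^sup>+x. ennreal ((weight s R (x::'a))\<^sup>2) \<partial>lborel) \<le> ennreal (C0 * R ^ DIM('a))"
    using nn_integral_weight_sq[OF s(1), where ?'a='a] by blast
  have "(\<integral>\<^sup>+y. G2 y \<partial>lborel) = ennreal c2 * (\<integral>\<^sup>+x. ennreal ((weight s 1 (x::'a))\<^sup>2) \<partial>lborel)"
    unfolding G2_def using c by (subst nn_integral_cmult[symmetric]) (auto simp: ennreal_mult)
  also have "\<dots> \<le> ennreal c2 * ennreal C0"
    using C0(2)[of 1] by (intro mult_left_mono) auto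
  also have "\<dots> < \<infinity>" by (simp add: ennreal_mult_less_top)
  finally have I2: "(\<integral>\<^sup>+y. G2 y \<partial>lborel) < \<infinity>" .
  define C where "C = enn2real ((\<integral>\<^sup>+h. G1 h \<partial>lborel) + (\<integral>\<^sup>+y. G2 y \<partial>lborel)) + 1"
  have C: "C > 0" by (simp add: C_def add_nonneg_pos)
  have CI: "(\<integral>\<^sup>+h. G1 h \<partial>lborel) + (\<integral>\<^sup>+y. G2 y \<partial>lborel) \<le> ennreal C"
  proof -
    have "(\<integral>\<^sup>+h. G1 h \<partial>lborel) + (\<integral>\<^sup>+y. G2 y \<partial>lborel) = ennreal (enn2real ((\<integral>\<^sup>+h. G1 h \<partial>lborel) + (\<integral>\<^sup>+y. G2 y \<partial>lborel)))"
      using I1 I2 by simp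
    also have "\<dots> \<le> ennreal C" by (intro ennreal_leI) (simp add: C_def)
    finally show ?thesis .
  qed
  have one: "sqdiff_integral s (weight s 1) x \<le> ennreal (C * (weight s 1 x)\<^sup>2)" for x :: 'a
  proof -
    have "sqdiff_integral s (weight s 1) x \<le> (\<integral>\<^sup>+y. ennreal ((weight s 1 x)\<^sup>2) * (G1 (x - y) + G2 y) \<partial>lborel)"
      unfolding sqdiff_integral_def
    proof (rule nn_integral_mono)
      fix y :: 'a
      define k where "k = kern s (x - y)"
      define X Y where "X = weight s 1 x" and "Y = weight s 1 y"
      have pos: "k \<ge> 0" "X > 0" "Y > 0" by (simp_all add: k_def X_def Y_def weight_pos)
      have "(X - Y)\<^sup>2 * k \<le> X\<^sup>2 * ((if norm (x - y) < 1 then c1 * norm (x - y) powr 2 else c2) * k + c2 * Y\<^sup>2)"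
      proof (cases "norm (x - y) < 1")
        case True
        have "\<bar>X - Y\<bar> \<le> p * 2 powr (p + 1) * X * norm (x - y)"
          using weight_near[OF s(1) True] by (simp add: p_def X_def Y_def)
        then have "\<bar>X - Y\<bar>\<^sup>2 \<le> (p * 2 powr (p + 1) * X * norm (x - y))\<^sup>2"
          by (rule power_mono) simp
        then have "(X - Y)\<^sup>2 \<le> X\<^sup>2 * (c1 * (norm (x - y))\<^sup>2)"
          by (simp add: c1_def power_mult_distrib mult_ac)
        then have "(X - Y)\<^sup>2 * k \<le> X\<^sup>2 * (c1 * (norm (x - y))\<^sup>2) * k"
          using pos by (intro mult_right_mono)
        also have "\<dots> \<le> X\<^sup>2 * ((c1 * (norm (x - y))\<^sup>2) * k + c2 * Y\<^sup>2)"
          using c by (simp add: algebra_simps)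
        finally show ?thesis using True by simp
      next
        case False
        have "(X - Y)\<^sup>2 \<le> X\<^sup>2 + Y\<^sup>2" using pos by (simp add: power2_eq_square algebra_simps)
        then have "(X - Y)\<^sup>2 * k \<le> X\<^sup>2 * k + Y\<^sup>2 * k"
          using pos mult_right_mono[of "(X - Y)\<^sup>2" "X\<^sup>2 + Y\<^sup>2" k] by (simp add: algebra_simps)
        also have "Y\<^sup>2 * k \<le> (c2 - 1) * X\<^sup>2 * (Y\<^sup>2 + k)"
          using weight_far[OF s(1), of x y] False by (simp add: c2_def X_def Y_def k_def)
        also have "X\<^sup>2 * k + (c2 - 1) * X\<^sup>2 * (Y\<^sup>2 + k) = X\<^sup>2 * (c2 * k + c2 * Y\<^sup>2) - X\<^sup>2 * Y\<^sup>2"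
          by (simp add: algebra_simps)
        also have "\<dots> \<le> X\<^sup>2 * (c2 * k + c2 * Y\<^sup>2)" by simp
        finally show ?thesis using False by simp
      qed
      then have "ennreal ((X - Y)\<^sup>2 * k) \<le> ennreal (X\<^sup>2 * ((if norm (x - y) < 1 then c1 * norm (x - y) powr 2 else c2) * k + c2 * Y\<^sup>2))"
        by (rule ennreal_leI)
      also have "\<dots> = ennreal (X\<^sup>2) * (G1 (x - y) + G2 y)"
        using c pos by (simp add: G1_def G2_def X_def Y_def k_def ennreal_mult ennreal_plus)
      finally show "ennreal ((weight s 1 x - weight s 1 y)\<^sup>2 * kern s (x - y)) \<le> ennreal ((weight s 1 x)\<^sup>2) * (G1 (x - y) + G2 y)"
        by (simp add: X_def Y_def k_def)
    qed
    also have "\<dots> = ennreal ((weight s 1 x)\<^sup>2) * (\<integral>\<^sup>+y. G1 (x - y) + G2 y \<partial>lborel)"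
      by (rule nn_integral_cmult) measurable
    also have "(\<integral>\<^sup>+y. G1 (x - y) + G2 y \<partial>lborel) = (\<integral>\<^sup>+y. G1 (x - y) \<partial>lborel) + (\<integral>\<^sup>+y. G2 y \<partial>lborel)"
      by (rule nn_integral_add) auto
    also have "(\<integral>\<^sup>+y. G1 (x - y) \<partial>lborel) = (\<integral>\<^sup>+h. G1 h \<partial>lborel)"
      by (rule nn_integral_lborel_translate(2)) measurable
    also have "ennreal ((weight s 1 x)\<^sup>2) * ((\<integral>\<^sup>+h. G1 h \<partial>lborel) + (\<integral>\<^sup>+y. G2 y \<partial>lborel)) \<le> ennreal ((weight s 1 x)\<^sup>2) * ennreal C"
      by (intro mult_left_mono CI) auto
    also have "\<dots> = ennreal (C * (weight s 1 x)\<^sup>2)" using C by (simp add: mult.commute flip: ennreal_mult)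
    finally show ?thesis .
  qed
  have "sqdiff_integral s (weight s R) x \<le> ennreal (C * R powr (- 2 * s) * (weight s R x)\<^sup>2)" if R: "R > 0" for R and x :: 'a
  proof -
    define x' where "x' = (1 / R) *\<^sub>R x"
    have x: "x = R *\<^sub>R x'" using R by (simp add: x'_def)
    have wR: "weight s R (R *\<^sub>R z) = weight s 1 z" for z :: 'a using R by (simp add: weight_scale[OF R])
    have [measurable]: "weight s R \<in> borel_measurable (borel :: 'a measure)"
      by (rule borel_measurable_continuous_onI[OF weight_continuous[OF R]])
    define f where "f = (\<lambda>y. ennreal ((weight s R x - weight s R y)\<^sup>2 * kern s (x - y)))"
    have [measurable]: "f \<in> borel_measurable borel" unfolding f_def by measurable
    have "sqdiff_integral s (weight s R) x = ennreal (\<bar>R\<bar> ^ DIM('a)) * (\<integral>\<^sup>+z. f (0 + R *\<^sub>R z) \<partial>lborel)"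
      unfolding sqdiff_integral_def f_def[symmetric] by (rule nn_integral_lborel_affine) (use R in auto)
    also have "(\<integral>\<^sup>+z. f (0 + R *\<^sub>R z) \<partial>lborel) = (\<integral>\<^sup>+z. ennreal (R powr (- (real DIM('a) + 2 * s))) * ennreal ((weight s 1 x' - weight s 1 z)\<^sup>2 * kern s (x' - z)) \<partial>lborel)"
    proof (rule nn_integral_cong)
      fix z :: 'a
      have "kern s (x - R *\<^sub>R z) = R powr (- (real DIM('a) + 2 * s)) * kern s (x' - z)"
        using kern_scale[OF R, of s "x' - z"] by (simp add: x scaleR_diff_right)
      then show "f (0 + R *\<^sub>R z) = ennreal (R powr (- (real DIM('a) + 2 * s))) * ennreal ((weight s 1 x' - weight s 1 z)\<^sup>2 * kern s (x' - z))"
        by (simp add: f_def wR x mult_ac flip: ennreal_mult)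
    qed
    also have "\<dots> = ennreal (R powr (- (real DIM('a) + 2 * s))) * sqdiff_integral s (weight s 1) x'"
      unfolding sqdiff_integral_def by (rule nn_integral_cmult) measurable
    also have "ennreal (\<bar>R\<bar> ^ DIM('a)) * (ennreal (R powr (- (real DIM('a) + 2 * s))) * sqdiff_integral s (weight s 1) x')
       = ennreal (R powr (- 2 * s)) * sqdiff_integral s (weight s 1) x'"
    proof -
      have "\<bar>R\<bar> ^ DIM('a) * R powr (- (real DIM('a) + 2 * s)) = R powr (- 2 * s)"
        using R by (simp add: powr_add[symmetric] flip: powr_realpow)
      then show ?thesis using R by (simp add: mult.assoc[symmetric] flip: ennreal_mult)
    qed
    also have "\<dots> \<le> ennreal (R powr (- 2 * s)) * ennreal (C * (weight s 1 x')\<^sup>2)"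
      by (intro mult_left_mono one) auto
    also have "\<dots> = ennreal (C * R powr (- 2 * s) * (weight s R x)\<^sup>2)"
      using C by (simp add: x wR mult_ac flip: ennreal_mult)
    finally show ?thesis .
  qed
  then show ?thesis using C by blast
qed

section \<open>Testing the equation and the stability inequality\<close>

lemma sq_sum_weighted: "(u + v)\<^sup>2 \<le> (1 + \<eta>) * u\<^sup>2 + (1 + 1 / \<eta>) * v\<^sup>2" if "\<eta> > 0" for u v \<eta> :: real
proof -
  have "0 \<le> (\<eta> * u - v)\<^sup>2 / \<eta>" using that by simp
  also have "(\<eta> * u - v)\<^sup>2 / \<eta> = \<eta> * u\<^sup>2 - 2 * u * v + v\<^sup>2 / \<eta>"
    using that by (simp add: power2_eq_square field_simps)
  finally show ?thesis by (simp add: power2_eq_square algebra_simps)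
qed

text \<open>Take \<open>b \<le> a\<close>. Monotonicity of \<open>K(t)/t\<close> gives
  \<open>(a - b) * Ka \<le> a * (Ka - Kb)\<close>: the relative increment of \<open>K\<close> is at
  least that of \<open>t\<close>. It also gives \<open>Kb \<le> Ka\<close>, so the mean of the two
  values is at most \<open>Ka\<close>. The other order follows by symmetry.\<close>

lemma trapezoid_sq_le:
  fixes a b Ka Kb :: real
  assumes pos: "0 < a" "0 < b" "0 \<le> Ka" "0 \<le> Kb"
    and star: "b \<le> a \<Longrightarrow> Kb * a \<le> Ka * b" "a \<le> b \<Longrightarrow> Ka * b \<le> Kb * a"
  shows "((a - b) * (Ka + Kb) / 2)\<^sup>2 \<le> (a - b) * (Ka - Kb) * (a * Ka + b * Kb)"
proof -
  have main: "((a - b) * (Ka + Kb) / 2)\<^sup>2 \<le> (a - b) * (Ka - Kb) * (a * Ka + b * Kb)"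
    if "0 < a" "0 < b" "0 \<le> Ka" "0 \<le> Kb" "b \<le> a" "Kb * a \<le> Ka * b" for a b Ka Kb :: real
  proof -
    have "Ka * b \<le> Ka * a" using that(3,5) by (rule mult_left_mono[rotated])
    then have "Kb * a \<le> Ka * a" using that by linarith
    then have KK: "Kb \<le> Ka" using that by simp
    have "(a - b) * ((Ka + Kb) / 2) \<le> (a - b) * Ka"
      using that(5) KK by (intro mult_left_mono) auto
    then have "((a - b) * (Ka + Kb) / 2)\<^sup>2 \<le> ((a - b) * Ka)\<^sup>2"
      using that(3,4,5) by (intro power_mono) auto
    also have "\<dots> = ((a - b) * Ka) * ((a - b) * Ka)" by (simp add: power2_eq_square)
    also have "\<dots> \<le> ((a - b) * Ka) * (a * (Ka - Kb))"
    proof (rule mult_left_mono)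
      show "(a - b) * Ka \<le> a * (Ka - Kb)" using that(6) by (simp add: algebra_simps)
      show "0 \<le> (a - b) * Ka" using that(3,5) by simp
    qed
    also have "\<dots> = (a - b) * (Ka - Kb) * (a * Ka)" by simp
    also have "\<dots> \<le> (a - b) * (Ka - Kb) * (a * Ka + b * Kb)"
      using that KK by (intro mult_left_mono) auto
    finally show ?thesis .
  qed
  show ?thesis
  proof (cases "b \<le> a")
    case True
    then show ?thesis using main[of a b Ka Kb] pos star by simp
  next
    case False
    then have "((b - a) * (Kb + Ka) / 2)\<^sup>2 \<le> (b - a) * (Kb - Ka) * (b * Kb + a * Ka)"
      using main[of b a Kb Ka] pos star by simp
    moreover have "((b - a) * (Kb + Ka) / 2)\<^sup>2 = ((a - b) * (Ka + Kb) / 2)\<^sup>2"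
      by (simp add: power2_eq_square algebra_simps)
    moreover have "(b - a) * (Kb - Ka) * (b * Kb + a * Ka) = (a - b) * (Ka - Kb) * (a * Ka + b * Kb)"
      by (simp add: algebra_simps)
    ultimately show ?thesis by simp
  qed
qed

text \<open>In the variables \<open>p = \<alpha> - \<beta>\<close> and
  \<open>q = \<alpha> + \<beta>\<close> the left side is the square of
  \<open>(A - B) q / 2 + (A + B) p / 2\<close>, and \<open>P\<close> on the right is
  \<open>X + S p q\<close>. Terms with \<open>p^2\<close> go to the error, and the cross term is
  split by Young's inequality with \<open>\<eta>\<close>, which works because
  \<open>S^2 \<le> D G\<close>. The leading constant tends to 1 as \<open>\<eta>\<close> tends to 0,
  as absorption will require.\<close>

lemma stability_pointwise:
  fixes a b A B Ka Kb \<alpha> \<beta> \<eta> :: real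
  assumes pos: "0 < a" "0 < b" "0 \<le> Ka" "0 \<le> Kb" and \<eta>: "0 < \<eta>" "\<eta> < 1"
    and star: "b \<le> a \<Longrightarrow> Kb * a \<le> Ka * b" "a \<le> b \<Longrightarrow> Ka * b \<le> Kb * a"
    and AB: "(A - B)\<^sup>2 \<le> (a - b) * (Ka - Kb)" "A\<^sup>2 \<le> a * Ka" "B\<^sup>2 \<le> b * Kb"
  shows "(A * \<alpha> - B * \<beta>)\<^sup>2 \<le> (1 + \<eta>) / (1 - \<eta>) * ((a - b) * (Ka * \<alpha>\<^sup>2 - Kb * \<beta>\<^sup>2))
     + ((1 + \<eta>) / (1 - \<eta>) / \<eta> + (1 + 1 / \<eta>)) * ((a * Ka + b * Kb) * (\<alpha> - \<beta>)\<^sup>2)"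
proof -
  define D where "D = (a - b) * (Ka - Kb)"
  define G where "G = a * Ka + b * Kb"
  define p where "p = \<alpha> - \<beta>"
  define q where "q = \<alpha> + \<beta>"
  define X where "X = D * (\<alpha>\<^sup>2 + \<beta>\<^sup>2) / 2"
  define P where "P = (a - b) * (Ka * \<alpha>\<^sup>2 - Kb * \<beta>\<^sup>2)"
  define S where "S = (a - b) * (Ka + Kb) / 2"
  have D0: "D \<ge> 0" using AB(1) zero_le_power2[of "A - B"] unfolding D_def by linarith
  have G0: "G \<ge> 0" unfolding G_def using pos by simp
  have SDG: "S\<^sup>2 \<le> D * G"
    using trapezoid_sq_le[OF pos star] by (simp add: S_def D_def G_def)
  have q2: "q\<^sup>2 / 4 \<le> (\<alpha>\<^sup>2 + \<beta>\<^sup>2) / 2"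
    using zero_le_power2[of "\<alpha> - \<beta>"] by (simp add: q_def power2_eq_square algebra_simps)
  have DqX: "D * q\<^sup>2 / 4 \<le> X" using mult_left_mono[OF q2 D0] by (simp add: X_def)
  \<comment> \<open>Compare squares: \<open>S^2 \<le> D * G\<close> and the arithmetic-geometric
    mean inequality; the factors \<open>\<eta>\<close> and \<open>1 / \<eta>\<close> cancel in the
    product.\<close>
  have "\<bar>S * p * q\<bar> \<le> \<eta> * (D * q\<^sup>2 / 4) + G * p\<^sup>2 / \<eta>"
  proof (rule power2_le_imp_le)
    have "\<bar>S * p * q\<bar>\<^sup>2 = S\<^sup>2 * (p\<^sup>2 * q\<^sup>2)" by (simp add: power_mult_distrib)
    also have "\<dots> \<le> D * G * (p\<^sup>2 * q\<^sup>2)" by (intro mult_right_mono SDG) simp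
    also have "\<dots> = 4 * (\<eta> * (D * q\<^sup>2 / 4)) * (G * p\<^sup>2 / \<eta>)" using \<eta> by simp
    also have "\<dots> \<le> (\<eta> * (D * q\<^sup>2 / 4) + G * p\<^sup>2 / \<eta>)\<^sup>2"
      using zero_le_power2[of "\<eta> * (D * q\<^sup>2 / 4) - G * p\<^sup>2 / \<eta>"] unfolding power2_sum power2_diff by linarith
    finally show "\<bar>S * p * q\<bar>\<^sup>2 \<le> (\<eta> * (D * q\<^sup>2 / 4) + G * p\<^sup>2 / \<eta>)\<^sup>2" .
    show "0 \<le> \<eta> * (D * q\<^sup>2 / 4) + G * p\<^sup>2 / \<eta>" using D0 G0 \<eta> by simp
  qed
  moreover have "\<eta> * (D * q\<^sup>2 / 4) \<le> \<eta> * X" using DqX \<eta> by (intro mult_left_mono) auto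
  moreover have "P = X + S * p * q"
    by (simp add: P_def X_def S_def p_def q_def D_def power2_eq_square field_simps)
  ultimately have XP: "(1 - \<eta>) * X \<le> P + G * p\<^sup>2 / \<eta>"
    by (simp add: left_diff_distrib)
  then have X: "X \<le> (P + G * p\<^sup>2 / \<eta>) / (1 - \<eta>)" using \<eta> by (simp add: field_simps)
  have "A * \<alpha> - B * \<beta> = (A - B) * q / 2 + (A + B) * p / 2"
    by (simp add: p_def q_def field_simps)
  then have "(A * \<alpha> - B * \<beta>)\<^sup>2 \<le> (1 + \<eta>) * ((A - B) * q / 2)\<^sup>2 + (1 + 1 / \<eta>) * ((A + B) * p / 2)\<^sup>2"
    using sq_sum_weighted[OF \<eta>(1)] by simp
  also have "\<dots> \<le> (1 + \<eta>) * X + (1 + 1 / \<eta>) * (G * p\<^sup>2)"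
  proof (intro add_mono mult_left_mono)
    have "((A - B) * q / 2)\<^sup>2 = (A - B)\<^sup>2 * q\<^sup>2 / 4" by (simp add: power_mult_distrib power_divide)
    also have "\<dots> \<le> D * q\<^sup>2 / 4" using AB(1) unfolding D_def by (intro divide_right_mono mult_right_mono) auto
    finally show "((A - B) * q / 2)\<^sup>2 \<le> X" using DqX by linarith
    have "(A + B)\<^sup>2 \<le> 2 * A\<^sup>2 + 2 * B\<^sup>2" using zero_le_power2[of "A - B"] by (simp add: power2_eq_square algebra_simps)
    also have "\<dots> \<le> 4 * G" using AB G0 by (simp add: G_def)
    finally have "(A + B)\<^sup>2 * p\<^sup>2 / 4 \<le> 4 * G * p\<^sup>2 / 4" by (intro divide_right_mono mult_right_mono) auto
    then show "((A + B) * p / 2)\<^sup>2 \<le> G * p\<^sup>2" by (simp add: power_mult_distrib power_divide)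
  qed (use \<eta> in auto)
  also have "(1 + \<eta>) * X \<le> (1 + \<eta>) * ((P + G * p\<^sup>2 / \<eta>) / (1 - \<eta>))"
    using X \<eta> by (intro mult_left_mono) auto
  finally have "(A * \<alpha> - B * \<beta>)\<^sup>2 \<le> (1 + \<eta>) * ((P + G * p\<^sup>2 / \<eta>) / (1 - \<eta>)) + (1 + 1 / \<eta>) * (G * p\<^sup>2)" by simp
  also have "\<dots> = (1 + \<eta>) / (1 - \<eta>) * P + ((1 + \<eta>) / (1 - \<eta>) / \<eta> + (1 + 1 / \<eta>)) * (G * p\<^sup>2)"
    by (simp add: add_divide_distrib algebra_simps)
  finally show ?thesis by (simp add: P_def G_def p_def)
qed

text \<open>A discrete Picone inequality in the variables \<open>p = sqrt a\<close>,
  \<open>q = sqrt b\<close>: the difference of the two sides, divided by \<open>p + q\<close>, is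
  the square \<open>(q \<alpha> - p \<beta>)^2 / (p q)\<close>.\<close>

lemma supersolution_pointwise:
  fixes a b \<alpha> \<beta> :: real
  assumes "0 < a" "0 < b"
  shows "(a - b) * (\<alpha>\<^sup>2 / sqrt a - \<beta>\<^sup>2 / sqrt b) \<le> (sqrt a + sqrt b) * (\<alpha> - \<beta>)\<^sup>2"
proof -
  define p where "p = sqrt a"
  define q where "q = sqrt b"
  have pq: "p > 0" "q > 0" using assms by (auto simp: p_def q_def)
  have ab: "a = p * p" "b = q * q" using assms by (auto simp: p_def q_def)
  have "(\<alpha> - \<beta>)\<^sup>2 - (p - q) * (\<alpha>\<^sup>2 / p - \<beta>\<^sup>2 / q) = (q * \<alpha> - p * \<beta>)\<^sup>2 / (p * q)"
    using pq by (simp add: power2_eq_square field_simps)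
  also have "\<dots> \<ge> 0" using pq by simp
  finally have "(p - q) * (\<alpha>\<^sup>2 / p - \<beta>\<^sup>2 / q) \<le> (\<alpha> - \<beta>)\<^sup>2" by simp
  then have "(p + q) * ((p - q) * (\<alpha>\<^sup>2 / p - \<beta>\<^sup>2 / q)) \<le> (p + q) * (\<alpha> - \<beta>)\<^sup>2"
    using pq by (intro mult_left_mono) auto
  moreover have "(p + q) * ((p - q) * (\<alpha>\<^sup>2 / p - \<beta>\<^sup>2 / q)) = (a - b) * (\<alpha>\<^sup>2 / p - \<beta>\<^sup>2 / q)"
    by (simp add: ab algebra_simps)
  ultimately show ?thesis unfolding p_def q_def by argo
qed

section \<open>The tests in integrated form\<close>

lemma integrable_times_sq:
  fixes h \<psi> :: "'a::euclidean_space \<Rightarrow> real"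
  assumes h: "continuous_on UNIV h" and \<psi>: "continuous_on UNIV \<psi>" "\<And>x. norm x > R \<Longrightarrow> \<psi> x = 0"
  shows "integrable lborel (\<lambda>x. h x * (\<psi> x)\<^sup>2)"
proof -
  have c: "continuous_on UNIV (\<lambda>x. h x * (\<psi> x)\<^sup>2)" by (intro continuous_intros h \<psi>)
  have "integrable lborel (\<lambda>x. indicator (cball 0 R) x *\<^sub>R (h x * (\<psi> x)\<^sup>2))"
    by (rule borel_integrable_compact) (auto intro: continuous_on_subset[OF c])
  also have "(\<lambda>x. indicator (cball 0 R) x *\<^sub>R (h x * (\<psi> x)\<^sup>2)) = (\<lambda>x. h x * (\<psi> x)\<^sup>2)"
    using \<psi>(2) by (force split: split_indicator)
  finally show ?thesis .
qed

lemma nn_integral_times_sq: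
  fixes h \<psi> :: "'a::euclidean_space \<Rightarrow> real"
  assumes h: "continuous_on UNIV h" "\<And>x. 0 \<le> h x" and \<psi>: "continuous_on UNIV \<psi>" "\<And>x. norm x > R \<Longrightarrow> \<psi> x = 0"
  shows "(\<integral>\<^sup>+x. ennreal (h x * (\<psi> x)\<^sup>2) \<partial>lborel) = ennreal (LINT x|lborel. h x * (\<psi> x)\<^sup>2)"
  by (rule nn_integral_eq_integral[OF integrable_times_sq[OF h(1) \<psi>]]) (use h in auto)

text \<open>\<open>g\<close> will be \<open>f(u)\<close> divided by \<open>frac_const\<close>.
  Besides positivity, continuity and boundedness, the locale records what testing uses of the
  equation: bounds for the truncated operator that are uniform on balls, and its pointwise limit
  along \<open>1 / Suc n\<close>.\<close>

locale positive_solution =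
  fixes s :: real and u g :: "'a::euclidean_space \<Rightarrow> real" and M :: real
  assumes s: "0 < s" "s < 1"
    and u_cont: "continuous_on UNIV u" and u_pos: "\<And>x. 0 < u x" and u_le: "\<And>x. u x \<le> M"
    and g_cont: "continuous_on UNIV g" and g_nonneg: "\<And>x. 0 \<le> g x"
    and trunc_bdd: "\<And>R. \<exists>B. \<forall>x \<epsilon>. norm x \<le> R \<longrightarrow> 0 < \<epsilon> \<longrightarrow> \<bar>trunc_lap s u \<epsilon> x\<bar> \<le> B"
    and trunc_lim: "\<And>x. (\<lambda>n. trunc_lap s u (1 / real (Suc n)) x) \<longlonglongrightarrow> g x"
begin

lemma M_pos: "0 < M"
  using u_pos[of 0] u_le[of 0] by linarith

lemma u_meas [measurable]: "u \<in> borel_measurable borel"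
  using u_cont by (rule borel_measurable_continuous_onI)

lemma abs_u_le: "\<bar>u x\<bar> \<le> M"
  using u_pos[of x] u_le[of x] by simp

lemma supersolution_test:
  assumes \<psi>: "continuous_on UNIV \<psi>" "\<And>x. norm x > R \<Longrightarrow> \<psi> x = 0"
    and E: "(\<integral>\<^sup>+x. ennreal (sqrt (u x)) * sqdiff_integral s \<psi> x \<partial>lborel) \<le> ennreal E" "0 \<le> E"
  shows "(\<integral>\<^sup>+x. ennreal (g x / sqrt (u x) * (\<psi> x)\<^sup>2) \<partial>lborel) \<le> ennreal E"
proof -
  have [measurable]: "\<psi> \<in> borel_measurable borel" using \<psi>(1) by (rule borel_measurable_continuous_onI)
  \<comment> \<open>The minus sign turns the first conclusion of \<open>energy_ineq\<close>, used
    with \<open>w = 0\<close>, into an upper bound for the tested right-hand side.\<close>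
  define W where "W = (\<lambda>x. - (\<psi> x)\<^sup>2 / sqrt (u x))"
  have cW: "continuous_on UNIV W"
    unfolding W_def using u_pos by (intro continuous_intros \<psi> u_cont) (auto simp: less_imp_neq[symmetric])
  obtain DW where DW: "DW \<ge> 0" "\<And>x. norm x \<le> R \<Longrightarrow> \<bar>W x\<bar> \<le> DW" using bounded_on_cball[OF cW] by blast
  obtain D\<psi> where D\<psi>: "D\<psi> \<ge> 0" "\<And>x. norm x \<le> R \<Longrightarrow> \<bar>\<psi> x\<bar> \<le> D\<psi>" using bounded_on_cball[OF \<psi>(1)] by blast
  obtain B where B: "\<And>x \<epsilon>. norm x \<le> R \<Longrightarrow> 0 < \<epsilon> \<Longrightarrow> \<bar>trunc_lap s u \<epsilon> x\<bar> \<le> B" using trunc_bdd by blast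
  define D where "D = DW + D\<psi> + sqrt M"
  have "0 \<le> 2 * 1 * (LINT x|lborel. W x * g x) + 2 * 1 * E"
  proof (rule energy_ineq(1)[where w="\<lambda>_. 0" and F="\<lambda>x. sqrt (u x)" and D=D and R=R and \<psi>=\<psi>, OF u_cont abs_u_le s(1) B trunc_lim])
    show "W \<in> borel_measurable borel" using cW by (rule borel_measurable_continuous_onI)
    have D0: "D \<ge> 0" using DW(1) D\<psi>(1) M_pos by (simp add: D_def)
    show "\<bar>0\<bar> \<le> D * indicator (cball 0 R) x" for x using D0 by simp
    show "\<bar>W x\<bar> \<le> D * indicator (cball 0 R) x" for x
      using DW(2)[of x] \<psi>(2)[of x] D\<psi>(1) M_pos by (cases "norm x \<le> R") (auto simp: D_def W_def intro: order_trans)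
    show "\<bar>\<psi> x\<bar> \<le> D * indicator (cball 0 R) x" for x
      using D\<psi>(2)[of x] \<psi>(2)[of x] DW(1) M_pos by (cases "norm x \<le> R") (auto simp: D_def intro: order_trans)
    show "sqrt (u x) \<le> D" for x using DW(1) D\<psi>(1) u_le[of x] by (simp add: D_def add_increasing)
    show "(0 - 0)\<^sup>2 \<le> 1 * ((u x - u y) * (W x - W y)) + 1 * ((sqrt (u x) + sqrt (u y)) * (\<psi> x - \<psi> y)\<^sup>2)" for x y
      using supersolution_pointwise[OF u_pos[of x] u_pos[of y], of "\<psi> x" "\<psi> y"]
      by (simp add: W_def algebra_simps)
  qed (use E u_pos in \<open>auto simp: less_imp_le\<close>)
  moreover have "(LINT x|lborel. W x * g x) = - (LINT x|lborel. g x / sqrt (u x) * (\<psi> x)\<^sup>2)"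
    by (subst integral_minus[symmetric]) (auto simp: W_def intro!: Bochner_Integration.integral_cong)
  ultimately have "(LINT x|lborel. g x / sqrt (u x) * (\<psi> x)\<^sup>2) \<le> E" by simp
  moreover have "continuous_on UNIV (\<lambda>x. g x / sqrt (u x))"
    using u_pos by (intro continuous_intros g_cont u_cont) (auto simp: less_imp_neq[symmetric])
  ultimately show ?thesis
    using g_nonneg u_pos by (subst nn_integral_times_sq[OF _ _ \<psi>]) (auto intro!: ennreal_leI divide_nonneg_pos)
qed

text \<open>Stability is applied to \<open>\<phi>(u) \<psi>\<close>, whose energy is bounded by
  \<open>energy_ineq\<close> with \<open>W = K(u) \<psi>^2\<close>. The tested equation returns
  \<open>c g K(u)\<close>, which by \<open>gain\<close> is at most \<open>1 - \<delta>\<close> times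
  the density on the left, so it can be absorbed. The constant \<open>C\<close> depends on neither
  \<open>\<psi>\<close> nor the radius of its support.\<close>

lemma stable_test:
  fixes V :: "'a \<Rightarrow> real" and \<phi> K :: "real \<Rightarrow> real"
  assumes stab: "\<And>\<xi>. \<xi> \<in> test_functions \<Longrightarrow> (LINT x|lebesgue. V x * (\<xi> x)\<^sup>2) \<le>
       c / 2 * (LINT x|lebesgue. LINT y|lebesgue. (\<xi> x - \<xi> y)\<^sup>2 / norm (x - y) powr (real DIM('a) + 2 * s))"
    and c: "0 < c" and V: "continuous_on UNIV V" "\<And>x. 0 \<le> V x"
    and cont: "continuous_on {0<..} \<phi>" "continuous_on {0<..} K"
    and sv: "\<And>a b. 0 < a \<Longrightarrow> a \<le> M \<Longrightarrow> 0 < b \<Longrightarrow> b \<le> M \<Longrightarrow> (\<phi> a - \<phi> b)\<^sup>2 \<le> (a - b) * (K a - K b)"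
    and star: "\<And>a b. 0 < b \<Longrightarrow> b \<le> a \<Longrightarrow> a \<le> M \<Longrightarrow> K b * a \<le> K a * b"
    and K0: "\<And>a. 0 < a \<Longrightarrow> a \<le> M \<Longrightarrow> 0 \<le> K a"
    and \<phi>K: "\<And>a. 0 < a \<Longrightarrow> a \<le> M \<Longrightarrow> (\<phi> a)\<^sup>2 \<le> a * K a"
    and gain: "\<And>x. c * g x * K (u x) \<le> (1 - \<delta>) * V x * (\<phi> (u x))\<^sup>2"
    and \<delta>: "0 < \<delta>" "\<delta> < 1"
  shows "\<exists>C\<ge>0. \<forall>\<psi> R E. continuous_on UNIV \<psi> \<longrightarrow> (\<forall>x. norm x > R \<longrightarrow> \<psi> x = 0) \<longrightarrow> 0 \<le> E \<longrightarrow>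
     (\<integral>\<^sup>+x. ennreal (u x * K (u x)) * sqdiff_integral s \<psi> x \<partial>lborel) \<le> ennreal E \<longrightarrow>
     (\<integral>\<^sup>+x. ennreal (V x * (\<phi> (u x))\<^sup>2 * (\<psi> x)\<^sup>2) \<partial>lborel) \<le> ennreal (C * E)"
proof -
  \<comment> \<open>Small enough that \<open>(1 + \<eta>) / (1 - \<eta>) * (1 - \<delta>) \<le> 1 -
    \<delta> / 2\<close>: the loss in the pointwise inequality consumes at most half of the
    gain.\<close>
  define \<eta> where "\<eta> = \<delta> / 4"
  have \<eta>: "0 < \<eta>" "\<eta> < 1" using \<delta> by (auto simp: \<eta>_def)
  define c1 where "c1 = (1 + \<eta>) / (1 - \<eta>)"
  define c2 where "c2 = (1 + \<eta>) / (1 - \<eta>) / \<eta> + (1 + 1 / \<eta>)"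
  have c12: "c1 \<ge> 0" "c2 \<ge> 0" using \<eta> by (auto simp: c1_def c2_def)
  have c1\<delta>: "c1 * (1 - \<delta>) \<le> 1 - \<delta> / 2"
  proof -
    have "(1 + \<eta>) * (1 - \<delta>) \<le> (1 - \<delta> / 2) * (1 - \<eta>)"
      using \<delta> by (simp add: \<eta>_def field_simps)
    then show ?thesis using \<eta> by (simp add: c1_def divide_le_eq)
  qed
  have uM: "u x \<in> {0<..}" for x using u_pos by simp
  have c\<phi>u: "continuous_on UNIV (\<lambda>x. \<phi> (u x))" and cKu: "continuous_on UNIV (\<lambda>x. K (u x))"
    using uM by (auto intro!: continuous_on_compose2[OF cont(1) u_cont] continuous_on_compose2[OF cont(2) u_cont])
  have "(\<integral>\<^sup>+x. ennreal (V x * (\<phi> (u x))\<^sup>2 * (\<psi> x)\<^sup>2) \<partial>lborel) \<le> ennreal (2 * c * c2 / \<delta> * E)"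
    if \<psi>: "continuous_on UNIV \<psi>" "\<And>x. norm x > R \<Longrightarrow> \<psi> x = 0" and E0: "0 \<le> E"
      and E: "(\<integral>\<^sup>+x. ennreal (u x * K (u x)) * sqdiff_integral s \<psi> x \<partial>lborel) \<le> ennreal E" for \<psi> R E
  proof -
    define w where "w = (\<lambda>x. \<phi> (u x) * \<psi> x)"
    define W where "W = (\<lambda>x. K (u x) * (\<psi> x)\<^sup>2)"
    have cw: "continuous_on UNIV w" and cW: "continuous_on UNIV W"
      unfolding w_def W_def by (intro continuous_intros c\<phi>u cKu \<psi>)+
    have [measurable]: "\<psi> \<in> borel_measurable borel" "w \<in> borel_measurable borel" "W \<in> borel_measurable borel"
      "(\<lambda>x. u x * K (u x)) \<in> borel_measurable borel"
      using \<psi>(1) cw cW by (auto intro!: borel_measurable_continuous_onI continuous_intros u_cont cKu)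
    obtain DW where DW: "DW \<ge> 0" "\<And>x. norm x \<le> R \<Longrightarrow> \<bar>W x\<bar> \<le> DW" using bounded_on_cball[OF cW] by blast
    obtain Dw where Dw: "Dw \<ge> 0" "\<And>x. norm x \<le> R \<Longrightarrow> \<bar>w x\<bar> \<le> Dw" using bounded_on_cball[OF cw] by blast
    obtain D\<psi> where D\<psi>: "D\<psi> \<ge> 0" "\<And>x. norm x \<le> R \<Longrightarrow> \<bar>\<psi> x\<bar> \<le> D\<psi>" using bounded_on_cball[OF \<psi>(1)] by blast
    obtain B where B: "\<And>x \<epsilon>. norm x \<le> R \<Longrightarrow> 0 < \<epsilon> \<Longrightarrow> \<bar>trunc_lap s u \<epsilon> x\<bar> \<le> B" using trunc_bdd by blast
    \<comment> \<open>\<open>K\<close> is largest at \<open>M\<close> because \<open>K(t)/t\<close>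
      is nondecreasing and \<open>K M \<ge> 0\<close>.\<close>
    have KM: "K (u x) \<le> K M" for x
    proof -
      have "K (u x) * M \<le> K M * u x" using star[OF u_pos u_le] by simp
      also have "\<dots> \<le> K M * M" using K0[OF M_pos] u_le by (intro mult_left_mono) auto
      finally show ?thesis using M_pos by simp
    qed
    have KM0: "K M \<ge> 0" using K0[OF M_pos] by simp
    define D where "D = DW + Dw + D\<psi> + M * K M"
    have D: "DW \<le> D" "Dw \<le> D" "D\<psi> \<le> D" "M * K M \<le> D"
      using DW(1) Dw(1) D\<psi>(1) KM0 M_pos by (auto simp: D_def)
    have b1: "\<bar>w x\<bar> \<le> D * indicator (cball 0 R) x" for x
      using Dw(2)[of x] \<psi>(2)[of x] D by (cases "norm x \<le> R") (auto simp: w_def intro: order_trans)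
    have b2: "\<bar>W x\<bar> \<le> D * indicator (cball 0 R) x" for x
      using DW(2)[of x] \<psi>(2)[of x] D by (cases "norm x \<le> R") (auto simp: W_def intro: order_trans)
    have b3: "\<bar>\<psi> x\<bar> \<le> D * indicator (cball 0 R) x" for x
      using D\<psi>(2)[of x] \<psi>(2)[of x] D by (cases "norm x \<le> R") (auto intro: order_trans)
    have b4: "u x * K (u x) \<le> D" for x
    proof -
      have "u x * K (u x) \<le> M * K M"
        using u_le[of x] u_pos[of x] KM[of x] K0[of "u x"] M_pos by (intro mult_mono) auto
      then show ?thesis using D(4) by linarith
    qed
    have F0: "0 \<le> u x * K (u x)" for x using u_pos[of x] u_le[of x] K0[of "u x"] by simp
    have pw: "(w x - w y)\<^sup>2 \<le> c1 * ((u x - u y) * (W x - W y)) + c2 * ((u x * K (u x) + u y * K (u y)) * (\<psi> x - \<psi> y)\<^sup>2)" for x y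
      unfolding w_def W_def c1_def c2_def
      using u_pos u_le by (intro stability_pointwise \<eta> K0 \<phi>K sv star) auto
    have wm: "w \<in> borel_measurable borel" "W \<in> borel_measurable borel"
      "(\<lambda>x. u x * K (u x)) \<in> borel_measurable borel" "\<psi> \<in> borel_measurable borel" by measurable
    note ei = energy_ineq[where F="\<lambda>x. u x * K (u x)", OF u_cont abs_u_le s(1) B trunc_lim wm b1 b2 b3 b4 F0 pw c12 E E0]
    have "energy s w \<le> ennreal (2 * c1 * (LINT x|lborel. W x * g x) + 2 * c2 * E)"
      and "0 \<le> 2 * c1 * (LINT x|lborel. W x * g x) + 2 * c2 * E"
      using ei by simp_all
    then have "(LINT x|lborel. V x * (w x)\<^sup>2) \<le> c / 2 * (2 * c1 * (LINT x|lborel. W x * g x) + 2 * c2 * E)"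
      using c \<psi>(2) by (intro stability_density[OF stab _ V(1) cw, where R=R]) (auto simp: w_def)
    \<comment> \<open>The factor 2 from symmetrization cancels the \<open>1 / 2\<close> of the
      stability inequality.\<close>
    also have "\<dots> = c1 * (LINT x|lborel. c * g x * K (u x) * (\<psi> x)\<^sup>2) + c * c2 * E"
    proof -
      have "(LINT x|lborel. c * g x * K (u x) * (\<psi> x)\<^sup>2) = (LINT x|lborel. c * (W x * g x))"
        by (intro Bochner_Integration.integral_cong) (auto simp: W_def)
      also have "\<dots> = c * (LINT x|lborel. W x * g x)" by simp
      finally have "(LINT x|lborel. c * g x * K (u x) * (\<psi> x)\<^sup>2) = c * (LINT x|lborel. W x * g x)" .
      then show ?thesis by (simp only:) (simp add: algebra_simps)
    qed
    also have "(LINT x|lborel. c * g x * K (u x) * (\<psi> x)\<^sup>2) \<le> (LINT x|lborel. (1 - \<delta>) * (V x * (w x)\<^sup>2))"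
    proof -
      have "(LINT x|lborel. c * g x * K (u x) * (\<psi> x)\<^sup>2) \<le> (LINT x|lborel. ((1 - \<delta>) * V x * (\<phi> (u x))\<^sup>2) * (\<psi> x)\<^sup>2)"
        by (intro integral_mono integrable_times_sq[OF _ \<psi>] continuous_intros g_cont cKu c\<phi>u V mult_right_mono gain) auto
      also have "(\<lambda>x. ((1 - \<delta>) * V x * (\<phi> (u x))\<^sup>2) * (\<psi> x)\<^sup>2) = (\<lambda>x. (1 - \<delta>) * (V x * (w x)\<^sup>2))"
        by (auto simp: w_def power_mult_distrib)
      finally show ?thesis .
    qed
    also have "(LINT x|lborel. (1 - \<delta>) * (V x * (w x)\<^sup>2)) = (1 - \<delta>) * (LINT x|lborel. V x * (w x)\<^sup>2)" by simp
    finally have "(LINT x|lborel. V x * (w x)\<^sup>2) \<le> c1 * (1 - \<delta>) * (LINT x|lborel. V x * (w x)\<^sup>2) + c * c2 * E"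
      using c12(1) by (simp add: mult_left_mono mult.assoc)
    moreover have I0: "0 \<le> (LINT x|lborel. V x * (w x)\<^sup>2)" by (rule integral_nonneg_AE) (simp add: V)
    moreover have "c1 * (1 - \<delta>) * (LINT x|lborel. V x * (w x)\<^sup>2) \<le> (1 - \<delta> / 2) * (LINT x|lborel. V x * (w x)\<^sup>2)"
      by (intro mult_right_mono c1\<delta> I0)
    ultimately have "\<delta> / 2 * (LINT x|lborel. V x * (w x)\<^sup>2) \<le> c * c2 * E" by (simp add: algebra_simps)
    then have "(LINT x|lborel. V x * (w x)\<^sup>2) \<le> 2 * c * c2 / \<delta> * E" using \<delta> by (simp add: field_simps)
    moreover have "(LINT x|lborel. V x * (w x)\<^sup>2) = (LINT x|lborel. V x * (\<phi> (u x))\<^sup>2 * (\<psi> x)\<^sup>2)"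
      by (intro Bochner_Integration.integral_cong) (auto simp: w_def power_mult_distrib)
    ultimately show ?thesis
      using V by (subst nn_integral_times_sq[OF _ _ \<psi>]) (auto intro!: ennreal_leI continuous_intros c\<phi>u)
  qed
  moreover have "0 \<le> 2 * c * c2 / \<delta>" using c c12 \<delta> by simp
  ultimately show ?thesis by blast
qed

end

section \<open>The Liouville argument\<close>

text \<open>If \<open>y / 2\<close> alone does not dominate, then
  \<open>y powr (1 - \<theta>) < 2 * l\<close>, which bounds \<open>y\<close> itself and hence the
  product by a power of \<open>l\<close>. With \<open>l\<close> of order
  \<open>R powr (- 2 * s)\<close>, the exponent \<open>1 / (1 - \<theta>)\<close> fixes the decay
  rate in the Liouville argument.\<close>

lemma young_powr:
  fixes l y \<theta> :: real
  assumes "0 \<le> l" "0 < y" "0 \<le> \<theta>" "\<theta> < 1"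
  shows "l * y powr \<theta> \<le> y / 2 + (2 * l) powr (1 / (1 - \<theta>))"
proof (cases "l * y powr \<theta> \<le> y / 2")
  case True
  then show ?thesis by (simp add: add_increasing2)
next
  case False
  then have l: "l > 0" using assms by (cases "l = 0") auto
  have "y powr (1 - \<theta>) = y / y powr \<theta>" using assms by (simp add: powr_diff)
  also have "\<dots> < 2 * l" using False assms by (simp add: field_simps)
  finally have "(y powr (1 - \<theta>)) powr (1 / (1 - \<theta>)) \<le> (2 * l) powr (1 / (1 - \<theta>))"
    using assms by (intro powr_mono2) auto
  then have "y \<le> (2 * l) powr (1 / (1 - \<theta>))" using assms by (simp add: powr_powr)
  then have "y powr \<theta> \<le> ((2 * l) powr (1 / (1 - \<theta>))) powr \<theta>" using assms by (intro powr_mono2) auto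
  then have "l * y powr \<theta> \<le> (2 * l) * ((2 * l) powr (1 / (1 - \<theta>))) powr \<theta>"
    using l by (intro mult_mono) auto
  also have "\<dots> = (2 * l) powr (1 + 1 / (1 - \<theta>) * \<theta>)" using l by (simp add: powr_add powr_powr)
  also have "1 + 1 / (1 - \<theta>) * \<theta> = 1 / (1 - \<theta>)" using assms by (simp add: field_simps)
  finally show ?thesis using assms by simp
qed

text \<open>The positive parts of \<open>weight s R x - 1 / Suc n\<close> have bounded support,
  increase to the weight, and have smaller differences than it, so their carre du champ inherits the
  bound \<open>gam\<close>. Monotone convergence then carries the test over to the weight.\<close>

lemma weighted_test:
  fixes Y F :: "'a::euclidean_space \<Rightarrow> real"
  assumes s: "0 < s" and R: "0 < R" and Cg: "0 \<le> Cg"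
    and Y [measurable]: "Y \<in> borel_measurable borel" and F [measurable]: "F \<in> borel_measurable borel"
    and Y0: "\<And>x. 0 \<le> Y x" and F0: "\<And>x. 0 \<le> F x"
    and fin: "(\<integral>\<^sup>+x. ennreal (F x * (weight s R x)\<^sup>2) \<partial>lborel) < \<infinity>"
    and gam: "\<And>x::'a. sqdiff_integral s (weight s R) x \<le> ennreal (Cg * (weight s R x)\<^sup>2)"
    and C0: "0 \<le> C0"
    and test: "\<And>\<psi> R E. continuous_on UNIV \<psi> \<Longrightarrow> (\<And>x. norm x > R \<Longrightarrow> \<psi> x = 0) \<Longrightarrow> 0 \<le> E \<Longrightarrow>
       (\<integral>\<^sup>+x. ennreal (F x) * sqdiff_integral s \<psi> x \<partial>lborel) \<le> ennreal E \<Longrightarrow>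
       (\<integral>\<^sup>+x. ennreal (Y x * (\<psi> x)\<^sup>2) \<partial>lborel) \<le> ennreal (C0 * E)"
  shows "(\<integral>\<^sup>+x. ennreal (Y x * (weight s R x)\<^sup>2) \<partial>lborel)
     \<le> ennreal (C0 * Cg) * (\<integral>\<^sup>+x. ennreal (F x * (weight s R x)\<^sup>2) \<partial>lborel)"
proof -
  define J where "J = (\<integral>\<^sup>+x. ennreal (F x * (weight s R x)\<^sup>2) \<partial>lborel)"
  have J: "J = ennreal (enn2real J)" using fin by (simp add: J_def)
  define E where "E = Cg * enn2real J"
  have cw: "continuous_on UNIV (weight s R :: 'a \<Rightarrow> real)" using R by (rule weight_continuous)
  then have [measurable]: "weight s R \<in> borel_measurable (borel :: 'a measure)" by (rule borel_measurable_continuous_onI)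
  define \<psi> where "\<psi> = (\<lambda>n x::'a. max (weight s R x - 1 / real (Suc n)) 0)"
  have c\<psi>: "continuous_on UNIV (\<psi> n)" for n unfolding \<psi>_def by (intro continuous_intros cw)
  then have [measurable]: "\<psi> n \<in> borel_measurable borel" for n by (rule borel_measurable_continuous_onI)
  have le: "(\<integral>\<^sup>+x. ennreal (Y x * (\<psi> n x)\<^sup>2) \<partial>lborel) \<le> ennreal (C0 * E)" for n
  proof -
    obtain S where S: "\<And>x::'a. norm x > S \<Longrightarrow> weight s R x < 1 / real (Suc n)"
      using weight_small_outside_ball[OF R s, of "1 / real (Suc n)", where ?'a='a] by auto
    show ?thesis
    proof (rule test[OF c\<psi>])
      show "\<psi> n x = 0" if "norm x > S" for x using S[OF that] by (simp add: \<psi>_def)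
      show "0 \<le> E" using Cg by (simp add: E_def)
      have "sqdiff_integral s (\<psi> n) x \<le> sqdiff_integral s (weight s R) x" for x
        unfolding sqdiff_integral_def
      proof (intro nn_integral_mono ennreal_leI mult_right_mono)
        fix y :: 'a
        have "\<bar>\<psi> n x - \<psi> n y\<bar> \<le> \<bar>weight s R x - weight s R y\<bar>" unfolding \<psi>_def by linarith
        then show "(\<psi> n x - \<psi> n y)\<^sup>2 \<le> (weight s R x - weight s R y)\<^sup>2" by (simp add: abs_le_square_iff)
      qed auto
      then have "(\<integral>\<^sup>+x. ennreal (F x) * sqdiff_integral s (\<psi> n) x \<partial>lborel)
         \<le> (\<integral>\<^sup>+x. ennreal (F x) * ennreal (Cg * (weight s R x)\<^sup>2) \<partial>lborel)"
        using gam by (intro nn_integral_mono mult_left_mono) (auto intro: order_trans)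
      also have "\<dots> = (\<integral>\<^sup>+x. ennreal Cg * ennreal (F x * (weight s R x)\<^sup>2) \<partial>lborel)"
        using F0 Cg by (intro nn_integral_cong) (simp add: mult_ac flip: ennreal_mult)
      also have "\<dots> = ennreal Cg * J" unfolding J_def by (rule nn_integral_cmult) measurable
      also have "\<dots> = ennreal E" using Cg by (subst J) (simp add: E_def flip: ennreal_mult)
      finally show "(\<integral>\<^sup>+x. ennreal (F x) * sqdiff_integral s (\<psi> n) x \<partial>lborel) \<le> ennreal E" by simp
    qed
  qed
  have inc: "incseq (\<lambda>n x. ennreal (Y x * (\<psi> n x)\<^sup>2))"
  proof (intro incseq_SucI le_funI ennreal_leI mult_left_mono power_mono Y0)
    fix n and x :: 'a
    have "1 / real (Suc (Suc n)) \<le> 1 / real (Suc n)" by (simp add: field_simps)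
    then show "\<psi> n x \<le> \<psi> (Suc n) x" unfolding \<psi>_def by linarith
    show "0 \<le> \<psi> n x" by (simp add: \<psi>_def)
  qed
  have "(\<integral>\<^sup>+x. ennreal (Y x * (weight s R x)\<^sup>2) \<partial>lborel) = (\<integral>\<^sup>+x. (SUP n. ennreal (Y x * (\<psi> n x)\<^sup>2)) \<partial>lborel)"
  proof (rule nn_integral_cong)
    fix x :: 'a
    have "(\<lambda>n. \<psi> n x) \<longlonglongrightarrow> max (weight s R x - 0) 0"
      unfolding \<psi>_def by (intro tendsto_intros LIMSEQ_Suc[OF lim_1_over_n])
    then have "(\<lambda>n. \<psi> n x) \<longlonglongrightarrow> weight s R x" using weight_pos[OF R, of s x] by simp
    then have "(\<lambda>n. ennreal (Y x * (\<psi> n x)\<^sup>2)) \<longlonglongrightarrow> ennreal (Y x * (weight s R x)\<^sup>2)"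
      by (intro tendsto_intros tendsto_ennrealI)
    moreover have "(\<lambda>n. ennreal (Y x * (\<psi> n x)\<^sup>2)) \<longlonglongrightarrow> (SUP n. ennreal (Y x * (\<psi> n x)\<^sup>2))"
      using inc[THEN incseqD] by (intro LIMSEQ_SUP) (auto simp: incseq_def dest: le_funD)
    ultimately show "ennreal (Y x * (weight s R x)\<^sup>2) = (SUP n. ennreal (Y x * (\<psi> n x)\<^sup>2))"
      by (rule LIMSEQ_unique)
  qed
  also have "\<dots> = (SUP n. \<integral>\<^sup>+x. ennreal (Y x * (\<psi> n x)\<^sup>2) \<partial>lborel)"
    by (rule nn_integral_monotone_convergence_SUP[OF inc]) measurable
  also have "\<dots> \<le> ennreal (C0 * E)" by (rule SUP_least) (rule le)
  also have "\<dots> = ennreal (C0 * Cg) * J"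
    using C0 Cg by (subst J) (simp add: E_def mult.assoc flip: ennreal_mult)
  finally show ?thesis by (simp add: J_def)
qed

text \<open>The weighted integral of \<open>Y\<close> is at most half of itself plus a multiple of
  \<open>R powr (N - 2 * s / (1 - \<theta>))\<close>, where \<open>R powr N\<close> is the mass of
  the squared weight and the rest comes from \<open>l\<close> in Young's inequality. The exponent is
  negative by \<open>dim\<close>; since the weights increase with \<open>R\<close>, the integral for
  \<open>R = 1\<close> must vanish, against \<open>Y > 0\<close>.\<close>

lemma weighted_liouville:
  fixes Y F :: "'a::euclidean_space \<Rightarrow> real"
  assumes s: "0 < s" "s < 1"
    and Y [measurable]: "Y \<in> borel_measurable borel" and F [measurable]: "F \<in> borel_measurable borel"
    and Ypos: "\<And>x. 0 < Y x" and F0: "\<And>x. 0 \<le> F x" and FD: "\<And>x. F x \<le> D"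
    and FY: "\<And>x. F x \<le> C1 * Y x powr \<theta>" and C1: "0 \<le> C1"
    and \<theta>: "0 \<le> \<theta>" "\<theta> < 1" and dim: "real DIM('a) * (1 - \<theta>) < 2 * s"
    and C0: "0 \<le> C0"
    and test: "\<And>\<psi> R E. continuous_on UNIV \<psi> \<Longrightarrow> (\<And>x. norm x > R \<Longrightarrow> \<psi> x = 0) \<Longrightarrow> 0 \<le> E \<Longrightarrow>
       (\<integral>\<^sup>+x. ennreal (F x) * sqdiff_integral s \<psi> x \<partial>lborel) \<le> ennreal E \<Longrightarrow>
       (\<integral>\<^sup>+x. ennreal (Y x * (\<psi> x)\<^sup>2) \<partial>lborel) \<le> ennreal (C0 * E)"
  shows False
proof -
  define N where "N = real DIM('a)"
  define \<kappa> where "\<kappa> = 1 / (1 - \<theta>)"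
  have D0: "D \<ge> 0" using F0[of 0] FD[of 0] by simp
  obtain Cw where Cw: "Cw > 0" "\<And>R. R > 0 \<Longrightarrow> (\<integral>\<^sup>+x. ennreal ((weight s R (x::'a))\<^sup>2) \<partial>lborel) \<le> ennreal (Cw * R ^ DIM('a))"
    using nn_integral_weight_sq[OF s(1), where ?'a='a] by blast
  obtain Cg where Cg: "Cg > 0" "\<And>R (x::'a). R > 0 \<Longrightarrow>
     sqdiff_integral s (weight s R) x \<le> ennreal (Cg * R powr (- 2 * s) * (weight s R x)\<^sup>2)"
    using sqdiff_integral_weight[OF s, where ?'a='a] by blast
  define I where "I = (\<lambda>R. \<integral>\<^sup>+x. ennreal (Y x * (weight s R x)\<^sup>2) \<partial>lborel)"
  define A where "A = 2 * (2 * (C0 * Cg * C1)) powr \<kappa> * Cw"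
  have A: "A \<ge> 0" using Cw by (simp add: A_def)
  have IR: "I R \<le> ennreal (A * R powr (N - 2 * s * \<kappa>))" if R: "R > 0" for R
  proof -
    have wm [measurable]: "weight s R \<in> borel_measurable (borel :: 'a measure)"
      using weight_continuous[OF R] by (rule borel_measurable_continuous_onI)
    define W where "W = (\<integral>\<^sup>+x. ennreal ((weight s R (x::'a))\<^sup>2) \<partial>lborel)"
    define J where "J = (\<integral>\<^sup>+x. ennreal (F x * (weight s R x)\<^sup>2) \<partial>lborel)"
    define m where "m = C0 * (Cg * R powr (- 2 * s))"
    define l where "l = m * C1"
    have m: "m \<ge> 0" using C0 Cg by (simp add: m_def)
    have l: "l \<ge> 0" using m C1 by (simp add: l_def)
    have Wfin: "W < \<infinity>" using Cw(2)[OF R] by (simp add: W_def le_less_trans)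
    have "J \<le> (\<integral>\<^sup>+x. ennreal D * ennreal ((weight s R (x::'a))\<^sup>2) \<partial>lborel)"
      unfolding J_def using FD D0 F0 by (intro nn_integral_mono) (auto simp flip: ennreal_mult intro!: ennreal_leI mult_right_mono)
    also have "\<dots> = ennreal D * W" unfolding W_def by (rule nn_integral_cmult) measurable
    also have "\<dots> < \<infinity>" using Wfin by (simp add: ennreal_mult_less_top)
    finally have Jfin: "J < \<infinity>" .
    have IJ: "I R \<le> ennreal m * J"
      unfolding I_def J_def m_def
    proof (rule weighted_test[OF s(1) R _ Y F _ F0 _ _ C0 test])
      show "(\<integral>\<^sup>+x. ennreal (F x * (weight s R x)\<^sup>2) \<partial>lborel) < \<infinity>" using Jfin by (simp add: J_def)
    qed (use Cg R Ypos in \<open>auto simp: less_imp_le\<close>)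
    also have "\<dots> = (\<integral>\<^sup>+x. ennreal (m * (F x * (weight s R x)\<^sup>2)) \<partial>lborel)"
      unfolding J_def using m F0 by (subst nn_integral_cmult[symmetric]) (auto simp: ennreal_mult)
    also have "\<dots> \<le> (\<integral>\<^sup>+x. ennreal (1 / 2) * ennreal (Y x * (weight s R x)\<^sup>2) + ennreal ((2 * l) powr \<kappa>) * ennreal ((weight s R x)\<^sup>2) \<partial>lborel)"
    proof (rule nn_integral_mono)
      fix x :: 'a
      have "m * F x \<le> l * Y x powr \<theta>" using mult_left_mono[OF FY m] by (simp add: l_def mult.assoc)
      also have "\<dots> \<le> Y x / 2 + (2 * l) powr \<kappa>" unfolding \<kappa>_def by (rule young_powr[OF l Ypos \<theta>])
      finally have "m * F x * (weight s R x)\<^sup>2 \<le> (Y x / 2 + (2 * l) powr \<kappa>) * (weight s R x)\<^sup>2"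
        by (rule mult_right_mono) simp
      then have "ennreal (m * (F x * (weight s R x)\<^sup>2)) \<le> ennreal (1 / 2 * (Y x * (weight s R x)\<^sup>2) + (2 * l) powr \<kappa> * (weight s R x)\<^sup>2)"
        by (intro ennreal_leI) (simp add: algebra_simps)
      also have "\<dots> = ennreal (1 / 2) * ennreal (Y x * (weight s R x)\<^sup>2) + ennreal ((2 * l) powr \<kappa>) * ennreal ((weight s R x)\<^sup>2)"
      proof -
        have y0: "0 \<le> Y x * (weight s R x)\<^sup>2" using Ypos[of x] by simp
        have "ennreal (1 / 2 * (Y x * (weight s R x)\<^sup>2) + (2 * l) powr \<kappa> * (weight s R x)\<^sup>2)
           = ennreal (1 / 2 * (Y x * (weight s R x)\<^sup>2)) + ennreal ((2 * l) powr \<kappa> * (weight s R x)\<^sup>2)"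
          using y0 by (intro ennreal_plus) auto
        also have "\<dots> = ennreal (1 / 2) * ennreal (Y x * (weight s R x)\<^sup>2) + ennreal ((2 * l) powr \<kappa>) * ennreal ((weight s R x)\<^sup>2)"
          using y0 by (intro arg_cong2[of _ _ _ _ "(+)"] ennreal_mult) auto
        finally show ?thesis .
      qed
      finally show "ennreal (m * (F x * (weight s R x)\<^sup>2)) \<le> ennreal (1 / 2) * ennreal (Y x * (weight s R x)\<^sup>2) + ennreal ((2 * l) powr \<kappa>) * ennreal ((weight s R x)\<^sup>2)" .
    qed
    also have "\<dots> = ennreal (1 / 2) * I R + ennreal ((2 * l) powr \<kappa>) * W"
      unfolding I_def W_def by (subst nn_integral_add) (auto simp: nn_integral_cmult)
    finally have half: "I R \<le> ennreal (1 / 2) * I R + ennreal ((2 * l) powr \<kappa>) * W" .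
    \<comment> \<open>Finiteness, which comes from the boundedness of \<open>F\<close>, must be
      secured before half of \<open>I R\<close> can be subtracted.\<close>
    have Ifin: "I R < \<infinity>" using IJ Jfin by (simp add: ennreal_mult_less_top le_less_trans)
    obtain i where i: "I R = ennreal i" "0 \<le> i" using Ifin by (cases "I R") auto
    obtain v where v: "W = ennreal v" "0 \<le> v" using Wfin by (cases W) auto
    have "ennreal (1 / 2) * I R + ennreal ((2 * l) powr \<kappa>) * W = ennreal (1 / 2 * i + (2 * l) powr \<kappa> * v)"
    proof -
      have "ennreal (1 / 2 * i + (2 * l) powr \<kappa> * v) = ennreal (1 / 2 * i) + ennreal ((2 * l) powr \<kappa> * v)"
        using i(2) v(2) by (intro ennreal_plus) auto
      also have "\<dots> = ennreal (1 / 2) * ennreal i + ennreal ((2 * l) powr \<kappa>) * ennreal v"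
        using i(2) v(2) by (intro arg_cong2[of _ _ _ _ "(+)"] ennreal_mult) auto
      finally show ?thesis unfolding i(1) v(1) by (rule sym)
    qed
    then have "i \<le> 1 / 2 * i + (2 * l) powr \<kappa> * v"
      using half i v by (simp add: ennreal_le_iff del: ennreal_plus)
    then have "enn2real (I R) \<le> 1 / 2 * enn2real (I R) + (2 * l) powr \<kappa> * enn2real W"
      using i v by simp
    then have "enn2real (I R) \<le> 2 * ((2 * l) powr \<kappa> * enn2real W)" by simp
    also have "\<dots> \<le> 2 * ((2 * l) powr \<kappa> * (Cw * R ^ DIM('a)))"
      using Cw R by (intro mult_left_mono enn2real_leI) (auto simp: W_def)
    also have "(2 * l) powr \<kappa> = (2 * (C0 * Cg * C1)) powr \<kappa> * R powr (- 2 * s * \<kappa>)"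
    proof -
      have "2 * l = (2 * (C0 * Cg * C1)) * R powr (- 2 * s)" by (simp add: l_def m_def)
      then show ?thesis using C0 Cg C1 by (simp add: powr_mult powr_powr)
    qed
    also have "2 * ((2 * (C0 * Cg * C1)) powr \<kappa> * R powr (- 2 * s * \<kappa>) * (Cw * R ^ DIM('a))) = A * (R powr N * R powr (- 2 * s * \<kappa>))"
      using R by (simp add: A_def N_def powr_realpow)
    also have "R powr N * R powr (- 2 * s * \<kappa>) = R powr (N - 2 * s * \<kappa>)"
      by (simp add: powr_add[symmetric])
    finally have "enn2real (I R) \<le> A * R powr (N - 2 * s * \<kappa>)" .
    then have "ennreal (enn2real (I R)) \<le> ennreal (A * R powr (N - 2 * s * \<kappa>))" by (rule ennreal_leI)
    then show ?thesis using Ifin by simp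
  qed
  have neg: "N - 2 * s * \<kappa> < 0" using dim \<theta> by (simp add: \<kappa>_def N_def field_simps)
  have I1: "I 1 \<le> ennreal (A * R powr (N - 2 * s * \<kappa>))" if R: "R \<ge> 1" for R
  proof -
    have "I 1 \<le> I R" unfolding I_def
    proof (intro nn_integral_mono ennreal_leI mult_left_mono power_mono)
      fix x :: 'a show "weight s 1 x \<le> weight s R x" by (rule weight_mono) (use R s in auto)
      show "0 \<le> weight s 1 x" using weight_pos[of 1 s x] by simp
      show "0 \<le> Y x" using Ypos[of x] by simp
    qed
    also have "\<dots> \<le> ennreal (A * R powr (N - 2 * s * \<kappa>))" using R by (intro IR) auto
    finally show ?thesis .
  qed
  have "((\<lambda>R. A * R powr (N - 2 * s * \<kappa>)) \<longlongrightarrow> A * 0) at_top"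
    using neg by (intro tendsto_intros tendsto_neg_powr filterlim_ident)
  then have "((\<lambda>R. ennreal (A * R powr (N - 2 * s * \<kappa>))) \<longlongrightarrow> ennreal (A * 0)) at_top"
    by (rule tendsto_ennrealI)
  then have "I 1 \<le> ennreal (A * 0)"
    by (rule tendsto_lowerbound) (auto intro: I1 eventually_mono[OF eventually_ge_at_top[of 1]])
  then have "I 1 = 0" by simp
  moreover have wm [measurable]: "weight s 1 \<in> borel_measurable (borel :: 'a measure)"
    by (rule borel_measurable_continuous_onI[OF weight_continuous]) simp
  ultimately have "AE x::'a in lborel. ennreal (Y x * (weight s 1 x)\<^sup>2) = 0"
    unfolding I_def by (subst (asm) nn_integral_0_iff_AE) auto
  then have "AE x::'a in lborel. False"
  proof (rule AE_mp, intro AE_I2 impI)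
    fix x :: 'a assume "ennreal (Y x * (weight s 1 x)\<^sup>2) = 0"
    then show False using Ypos[of x] weight_pos[of 1 s x] by (simp add: ennreal_eq_0_iff mult_le_0_iff)
  qed
  then have "emeasure lborel (UNIV :: 'a set) = 0"
    using AE_iff_measurable[of UNIV "lborel :: 'a measure" "\<lambda>_. False"] by simp
  then show False by simp
qed

section \<open>The nonlinearity near zero\<close>

text \<open>Makes the relation \<open>(\<phi> a - \<phi> b)^2 \<le> (a - b) (K a - K b)\<close>
  additive over adjacent intervals, so that it can be proved separately on both sides of a gluing
  point. This is the Cauchy-Schwarz inequality for two pairs of numbers.\<close>

lemma add_sq_le:
  fixes x y p q X Y :: real
  assumes "x\<^sup>2 \<le> p * X" "y\<^sup>2 \<le> q * Y" "0 \<le> p" "0 \<le> q" "0 \<le> X" "0 \<le> Y"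
  shows "(x + y)\<^sup>2 \<le> (p + q) * (X + Y)"
proof -
  have "2 * (x * y) \<le> p * Y + q * X"
  proof (rule power2_le_imp_le)
    have "(2 * (x * y))\<^sup>2 = 4 * (x\<^sup>2 * y\<^sup>2)" by (simp add: power_mult_distrib)
    also have "\<dots> \<le> 4 * ((p * X) * (q * Y))" using assms by (intro mult_left_mono mult_mono) auto
    also have "\<dots> = 4 * (p * Y) * (q * X)" by simp
    also have "\<dots> \<le> (p * Y + q * X)\<^sup>2"
      using zero_le_power2[of "p * Y - q * X"] unfolding power2_sum power2_diff by linarith
    finally show "(2 * (x * y))\<^sup>2 \<le> (p * Y + q * X)\<^sup>2" .
  qed (use assms in auto)
  then show ?thesis using assms(1,2) by (simp add: power2_sum algebra_simps)
qed

text \<open>Cauchy-Schwarz without integrals: for the mean slope \<open>m\<close> of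
  \<open>\<phi>\<close>, the function \<open>K - 2 m \<phi> + m^2 t\<close> has derivative at least
  \<open>(\<phi>' - m)^2\<close>, hence is nondecreasing.\<close>

lemma sq_diff_le_from_derivative:
  fixes \<phi> K :: "real \<Rightarrow> real"
  assumes ba: "b \<le> a"
    and d: "\<And>x. b \<le> x \<Longrightarrow> x \<le> a \<Longrightarrow> (\<phi> has_real_derivative \<phi>' x) (at x)"
      "\<And>x. b \<le> x \<Longrightarrow> x \<le> a \<Longrightarrow> (K has_real_derivative K' x) (at x)"
    and le: "\<And>x. b \<le> x \<Longrightarrow> x \<le> a \<Longrightarrow> (\<phi>' x)\<^sup>2 \<le> K' x"
  shows "(\<phi> a - \<phi> b)\<^sup>2 \<le> (a - b) * (K a - K b)"
proof (cases "a = b")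
  case False
  then have ab: "a - b > 0" using ba by simp
  define m where "m = (\<phi> a - \<phi> b) / (a - b)"
  have m: "\<phi> a - \<phi> b = m * (a - b)" using ab by (simp add: m_def)
  have "K b - 2 * m * \<phi> b + m\<^sup>2 * b \<le> K a - 2 * m * \<phi> a + m\<^sup>2 * a"
  proof (rule DERIV_nonneg_imp_nondecreasing[OF ba])
    fix x assume x: "b \<le> x" "x \<le> a"
    have "((\<lambda>x. K x - 2 * m * \<phi> x + m\<^sup>2 * x) has_real_derivative K' x - 2 * m * \<phi>' x + m\<^sup>2) (at x)"
      using d[OF x] by (auto intro!: derivative_eq_intros)
    moreover have "0 \<le> K' x - 2 * m * \<phi>' x + m\<^sup>2"
      using le[OF x] zero_le_power2[of "\<phi>' x - m"] unfolding power2_diff by (simp add: mult_ac)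
    ultimately show "\<exists>y. ((\<lambda>x. K x - 2 * m * \<phi> x + m\<^sup>2 * x) has_real_derivative y) (at x) \<and> 0 \<le> y" by blast
  qed
  then have "2 * m * (\<phi> a - \<phi> b) - m\<^sup>2 * (a - b) \<le> K a - K b" by (simp add: algebra_simps)
  then have "m\<^sup>2 * (a - b) \<le> K a - K b" unfolding m by (simp add: power2_eq_square algebra_simps)
  then have "(a - b) * (m\<^sup>2 * (a - b)) \<le> (a - b) * (K a - K b)" using ab by (intro mult_left_mono) auto
  then show ?thesis unfolding m by (simp add: power2_eq_square mult_ac)
qed simp

section \<open>Convexity and power laws relating \<open>f\<close> and its derivative\<close>

locale convex_nonlinearity =
  fixes f :: "real \<Rightarrow> real"
  assumes f_cont: "continuous_on {0..} f"
    and f_C2: "C2_on {0<..} f"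
    and f_mono: "mono_on {0..} f"
    and f_convex: "convex_on {0..} f"
    and f_pos: "\<And>t. t > 0 \<Longrightarrow> f t > 0"
begin

lemma f_deriv: "t > 0 \<Longrightarrow> (f has_real_derivative deriv f t) (at t)"
  using f_C2 unfolding C2_on_def
  by (auto simp: differentiable_on_eq_differentiable_at DERIV_deriv_iff_real_differentiable)

lemma f_deriv2: "t > 0 \<Longrightarrow> (deriv f has_real_derivative deriv (deriv f) t) (at t)"
  using f_C2 unfolding C2_on_def
  by (auto simp: differentiable_on_eq_differentiable_at DERIV_deriv_iff_real_differentiable)

lemma deriv_f_cont: "continuous_on {0<..} (deriv f)"
  using f_C2 by (simp add: C2_on_def differentiable_imp_continuous_on)

lemma f_cont': "continuous_on {0<..} f"
  by (rule continuous_on_subset[OF f_cont]) auto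

lemma f_zero_nonneg: "0 \<le> f 0"
proof -
  have "(f \<longlongrightarrow> f 0) (at 0 within {0..})" using f_cont by (auto simp: continuous_on_def)
  then have "(f \<longlongrightarrow> f 0) (at_right 0)" by (rule tendsto_within_subset) auto
  then show ?thesis
    by (rule tendsto_lowerbound) (auto intro!: eventually_at_rightI[of 0 1] less_imp_le f_pos)
qed

lemma f_tangent: "0 < c \<Longrightarrow> 0 \<le> x \<Longrightarrow> deriv f c * (x - c) \<le> f x - f c"
  by (rule convex_on_imp_above_tangent[OF f_convex])
     (auto intro: has_field_derivative_at_within f_deriv simp: interior_real_atLeast)

lemma f_le: "0 \<le> a \<Longrightarrow> a \<le> b \<Longrightarrow> f a \<le> f b"
  using f_mono by (auto simp: mono_on_def)

lemma deriv_f_mono: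
  assumes "0 < a" "a \<le> b"
  shows "deriv f a \<le> deriv f b"
proof (cases "a = b")
  case False
  have "deriv f a * (b - a) \<le> f b - f a" using f_tangent[of a b] assms by simp
  also have "\<dots> \<le> deriv f b * (b - a)" using f_tangent[of b a] assms by (simp add: algebra_simps)
  finally show ?thesis using False assms by simp
qed simp

lemma deriv_f_nonneg: "0 < t \<Longrightarrow> 0 \<le> deriv f t"
  by (rule mono_on_imp_deriv_nonneg[OF f_mono f_deriv]) (auto simp: interior_real_atLeast)

lemma deriv2_f_nonneg: "0 < t \<Longrightarrow> 0 \<le> deriv (deriv f) t"
  by (rule mono_on_imp_deriv_nonneg[of "{0<..}", OF _ f_deriv2])
     (auto simp: interior_open intro!: mono_onI deriv_f_mono)

end

locale convex_nonlinearity_zero = convex_nonlinearity +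
  assumes f_zero: "f 0 = 0"
begin

lemma f_le_tangent: "0 < t \<Longrightarrow> f t \<le> t * deriv f t"
  using f_tangent[of t 0] f_zero by (simp add: algebra_simps)

lemma deriv_f_pos: "0 < t \<Longrightarrow> 0 < deriv f t"
  using less_le_trans[OF f_pos f_le_tangent, of t] by (simp add: zero_less_mult_iff)

lemma f_ratio_mono:
  assumes "0 < b" "b \<le> a"
  shows "f b * a \<le> f a * b"
proof -
  have "f ((1 - b / a) *\<^sub>R 0 + (b / a) *\<^sub>R a) \<le> (1 - b / a) * f 0 + (b / a) * f a"
    using assms by (intro convex_onD[OF f_convex]) auto
  then show ?thesis using assms f_zero by (simp add: field_simps)
qed

text \<open>The reciprocal of \<open>q_fun f t\<close> for \<open>t > 0\<close>, but real-valued
  throughout: \<open>deriv f t\<close> is positive because \<open>f 0 = 0\<close>, and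
  \<open>q = \<infinity>\<close> becomes the value 0.\<close>

definition ratio :: "real \<Rightarrow> real" where
  "ratio t = f t * deriv (deriv f) t / (deriv f t)\<^sup>2"

text \<open>\<open>f' f^(-\<gamma>)\<close> is monotone as long as \<open>ratio - \<gamma>\<close>
  keeps its sign. One-sided bounds on \<open>ratio\<close> near 0 thus become comparisons of
  \<open>f'\<close> with a power of \<open>f\<close>, the constant being the value at the end point
  \<open>T\<close>.\<close>

lemma deriv_f_powr_derivative:
  assumes "0 < t"
  shows "((\<lambda>t. deriv f t * f t powr (- \<gamma>)) has_real_derivative
     (deriv f t)\<^sup>2 * f t powr (- \<gamma> - 1) * (ratio t - \<gamma>)) (at t)"
proof -
  have p: "f t powr (- \<gamma>) = f t powr (- \<gamma> - 1) * f t"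
    using f_pos[OF assms] by (simp add: powr_diff)
  have "((\<lambda>t. deriv f t * f t powr (- \<gamma>)) has_real_derivative
     deriv (deriv f) t * f t powr (- \<gamma>) + (- \<gamma> * f t powr (- \<gamma> - 1) * deriv f t) * deriv f t) (at t)"
    using f_pos[OF assms] by (auto intro!: derivative_eq_intros f_deriv f_deriv2 assms)
  also have "deriv (deriv f) t * f t powr (- \<gamma>) + (- \<gamma> * f t powr (- \<gamma> - 1) * deriv f t) * deriv f t
     = (deriv f t)\<^sup>2 * f t powr (- \<gamma> - 1) * (ratio t - \<gamma>)"
    unfolding p ratio_def using deriv_f_pos[OF assms] by (simp add: field_simps power2_eq_square)
  finally show ?thesis .
qed

lemma deriv_f_lower:
  assumes "0 < T" and r: "\<And>t. 0 < t \<Longrightarrow> t \<le> T \<Longrightarrow> ratio t \<le> \<gamma>"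
  shows "\<exists>c>0. \<forall>t. 0 < t \<longrightarrow> t \<le> T \<longrightarrow> c * f t powr \<gamma> \<le> deriv f t"
proof (intro exI conjI allI impI)
  show "0 < deriv f T * f T powr (- \<gamma>)" using deriv_f_pos[OF assms(1)] f_pos[OF assms(1)] by simp
  fix t assume t: "0 < t" "t \<le> T"
  have "deriv f T * f T powr (- \<gamma>) \<le> deriv f t * f t powr (- \<gamma>)"
  proof (rule DERIV_nonpos_imp_nonincreasing[OF t(2)])
    fix x assume x: "t \<le> x" "x \<le> T"
    then have "ratio x - \<gamma> \<le> 0" using r[of x] t by simp
    then have "(deriv f x)\<^sup>2 * f x powr (- \<gamma> - 1) * (ratio x - \<gamma>) \<le> 0"
      by (intro mult_nonneg_nonpos) auto
    then show "\<exists>y. ((\<lambda>t. deriv f t * f t powr (- \<gamma>)) has_real_derivative y) (at x) \<and> y \<le> 0"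
      using deriv_f_powr_derivative[of x \<gamma>] x t by (intro exI conjI) auto
  qed
  then have "deriv f T * f T powr (- \<gamma>) * f t powr \<gamma> \<le> deriv f t * f t powr (- \<gamma>) * f t powr \<gamma>"
    by (rule mult_right_mono) simp
  also have "\<dots> = deriv f t" using f_pos[OF t(1)] by (simp add: mult.assoc flip: powr_add)
  finally show "deriv f T * f T powr (- \<gamma>) * f t powr \<gamma> \<le> deriv f t" .
qed

lemma deriv_f_upper:
  assumes "0 < T" and r: "\<And>t. 0 < t \<Longrightarrow> t \<le> T \<Longrightarrow> \<gamma> \<le> ratio t"
  shows "\<exists>c>0. \<forall>t. 0 < t \<longrightarrow> t \<le> T \<longrightarrow> deriv f t \<le> c * f t powr \<gamma>"
proof (intro exI conjI allI impI)
  show "0 < deriv f T * f T powr (- \<gamma>)" using deriv_f_pos[OF assms(1)] f_pos[OF assms(1)] by simp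
  fix t assume t: "0 < t" "t \<le> T"
  have "deriv f t * f t powr (- \<gamma>) \<le> deriv f T * f T powr (- \<gamma>)"
  proof (rule DERIV_nonneg_imp_nondecreasing[OF t(2)])
    fix x assume x: "t \<le> x" "x \<le> T"
    then have "0 \<le> ratio x - \<gamma>" using r[of x] t by simp
    then have "0 \<le> (deriv f x)\<^sup>2 * f x powr (- \<gamma> - 1) * (ratio x - \<gamma>)" by simp
    then show "\<exists>y. ((\<lambda>t. deriv f t * f t powr (- \<gamma>)) has_real_derivative y) (at x) \<and> 0 \<le> y"
      using deriv_f_powr_derivative[of x \<gamma>] x t by (intro exI conjI) auto
  qed
  then have "deriv f t * f t powr (- \<gamma>) * f t powr \<gamma> \<le> deriv f T * f T powr (- \<gamma>) * f t powr \<gamma>"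
    by (rule mult_right_mono) simp
  moreover have "deriv f t * f t powr (- \<gamma>) * f t powr \<gamma> = deriv f t"
    using f_pos[OF t(1)] by (simp add: mult.assoc flip: powr_add)
  ultimately show "deriv f t \<le> deriv f T * f T powr (- \<gamma>) * f t powr \<gamma>" by simp
qed

text \<open>For \<open>\<gamma> < 1\<close>, integrate \<open>c \<le> f' f^(-\<gamma>)\<close>. For
  \<open>\<gamma> > 1\<close>, which occurs when \<open>q0 = 1\<close>, the power
  \<open>f^(1 - \<gamma>)\<close> has a positive lower bound on \<open>(0, T]\<close>, whence the
  claim. At \<open>\<gamma> = 1\<close> integration would give a logarithm, hence the
  exclusion.\<close>

lemma le_f_powr:
  assumes T: "0 < T" and c: "0 < c" "\<And>t. 0 < t \<Longrightarrow> t \<le> T \<Longrightarrow> c * f t powr \<gamma> \<le> deriv f t" and \<gamma>: "\<gamma> \<noteq> 1"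
  shows "\<exists>C>0. \<forall>t. 0 < t \<longrightarrow> t \<le> T \<longrightarrow> t \<le> C * f t powr (1 - \<gamma>)"
proof (cases "\<gamma> < 1")
  case True
  have "t \<le> 1 / ((1 - \<gamma>) * c) * f t powr (1 - \<gamma>)" if t: "0 < t" "t \<le> T" for t
  proof -
    \<comment> \<open>The integration starts at \<open>e > 0\<close>, where \<open>f\<close> is
      differentiable and positive, and \<open>e\<close> is sent to 0 afterwards.\<close>
    have "(1 - \<gamma>) * c * (t - e) \<le> f t powr (1 - \<gamma>)" if e: "0 < e" "e < t" for e
    proof -
      define h where "h = (\<lambda>t. f t powr (1 - \<gamma>) - (1 - \<gamma>) * c * t)"
      have "h e \<le> h t"
      proof (rule DERIV_nonneg_imp_nondecreasing[of e t h])
        fix x assume x: "e \<le> x" "x \<le> t"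
        then have x0: "x > 0" using e by simp
        have "(h has_real_derivative (1 - \<gamma>) * f x powr (1 - \<gamma> - 1) * deriv f x - (1 - \<gamma>) * c) (at x)"
          unfolding h_def using f_pos[OF x0] by (auto intro!: derivative_eq_intros f_deriv x0)
        moreover have "0 \<le> (1 - \<gamma>) * f x powr (1 - \<gamma> - 1) * deriv f x - (1 - \<gamma>) * c"
        proof -
          have "f x powr (- \<gamma>) * (c * f x powr \<gamma>) \<le> f x powr (- \<gamma>) * deriv f x"
            using x x0 t by (intro mult_left_mono c) auto
          moreover have "f x powr (- \<gamma>) * (c * f x powr \<gamma>) = c"
            using f_pos[OF x0] by (simp add: powr_minus field_simps)
          ultimately have "(1 - \<gamma>) * c \<le> (1 - \<gamma>) * (f x powr (- \<gamma>) * deriv f x)"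
            using True by (intro mult_left_mono) auto
          then show ?thesis by (simp add: mult.assoc)
        qed
        ultimately show "\<exists>y. (h has_real_derivative y) (at x) \<and> 0 \<le> y" by blast
      qed (use e in auto)
      then have "f e powr (1 - \<gamma>) - (1 - \<gamma>) * c * e \<le> f t powr (1 - \<gamma>) - (1 - \<gamma>) * c * t"
        by (simp add: h_def)
      moreover have "0 \<le> f e powr (1 - \<gamma>)" by simp
      ultimately have "0 \<le> f t powr (1 - \<gamma>) - (1 - \<gamma>) * c * t + (1 - \<gamma>) * c * e" by linarith
      then show ?thesis by (simp add: algebra_simps)
    qed
    note * = this
    have "((\<lambda>e. (1 - \<gamma>) * c * (t - e)) \<longlongrightarrow> (1 - \<gamma>) * c * (t - 0)) (at_right 0)"
      by (intro tendsto_intros)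
    moreover have "\<forall>\<^sub>F e in at_right 0. (1 - \<gamma>) * c * (t - e) \<le> f t powr (1 - \<gamma>)"
      using eventually_at_right_real[OF t(1)] by eventually_elim (auto intro: *)
    ultimately have "(1 - \<gamma>) * c * (t - 0) \<le> f t powr (1 - \<gamma>)"
      by (rule tendsto_upperbound) simp
    then show ?thesis using True c by (simp add: field_simps)
  qed
  then show ?thesis using True c by (intro exI[of _ "1 / ((1 - \<gamma>) * c)"]) auto
next
  case False
  then have g: "\<gamma> > 1" using \<gamma> by simp
  show ?thesis
  proof (intro exI conjI allI impI)
    show "0 < T * f T powr (\<gamma> - 1)" using T f_pos[OF T] by simp
    fix t assume t: "0 < t" "t \<le> T"
    have "1 = f t powr (\<gamma> - 1) * f t powr (1 - \<gamma>)" using f_pos[OF t(1)] by (simp flip: powr_add)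
    also have "\<dots> \<le> f T powr (\<gamma> - 1) * f t powr (1 - \<gamma>)"
      using g f_le[of t T] t f_pos[OF t(1)] by (intro mult_right_mono powr_mono2) auto
    finally have "T * 1 \<le> T * (f T powr (\<gamma> - 1) * f t powr (1 - \<gamma>))" using T by (intro mult_left_mono) auto
    then have "t \<le> T * (f T powr (\<gamma> - 1) * f t powr (1 - \<gamma>))" using t(2) by linarith
    then show "t \<le> T * f T powr (\<gamma> - 1) * f t powr (1 - \<gamma>)" by (simp add: mult.assoc)
  qed
qed

end

text \<open>
  The ratio \<open>f f''/f'\<^sup>2\<close> is controlled only on \<open>(0, t\<^sub>0]\<close>. Beyond \<open>t\<^sub>0\<close> we continue with \<open>\<phi> = \<lambda> f\<close>: there
  \<open>f' \<phi>\<^sup>2/f - K\<close> is constant, so the strict gain obtained at \<open>t\<^sub>0\<close> persists on every bounded interval.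
\<close>

locale test_pair = convex_nonlinearity_zero +
  fixes t0 \<alpha> k :: real
  assumes t0: "0 < t0" and \<alpha>: "1 \<le> \<alpha>" and k: "0 < k" "k < 1"
    and ratio_ge: "\<And>t. 0 < t \<Longrightarrow> t \<le> t0 \<Longrightarrow> \<alpha>\<^sup>2 \<le> k * (2 * \<alpha> - 1 + ratio t)"
begin

text \<open>The factor that makes the two branches of \<open>phi\<close> meet at
  \<open>t0\<close>.\<close>

definition lam :: real where "lam = f t0 powr (\<alpha> - 1)"

definition phi :: "real \<Rightarrow> real" where
  "phi t = (if t \<le> t0 then f t powr \<alpha> else lam * f t)"

text \<open>Above \<open>t0\<close>, \<open>f f'\<close> is reduced by the constant for which the
  two branches meet at \<open>t0\<close>; the size of this constant relative to the largest value of
  \<open>f f'\<close> on the interval considered is the gain that survives there.\<close>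

definition K :: "real \<Rightarrow> real" where
  "K t = (if t \<le> t0 then k * (f t powr (2 * \<alpha> - 1) * deriv f t)
     else lam\<^sup>2 * (f t * deriv f t - (1 - k) * (f t0 * deriv f t0)))"

lemma lam_pos: "0 < lam" using f_pos[OF t0] by (simp add: lam_def)

lemma powr_t0: "f t0 powr \<alpha> = lam * f t0" "f t0 powr (2 * \<alpha> - 1) = lam\<^sup>2 * f t0"
proof -
  have "f t0 powr ((\<alpha> - 1) + 1) = lam * f t0" unfolding lam_def powr_add using f_pos[OF t0] by simp
  then show "f t0 powr \<alpha> = lam * f t0" by simp
  have "f t0 powr ((\<alpha> - 1) + (\<alpha> - 1) + 1) = lam\<^sup>2 * f t0"
    unfolding lam_def powr_add power2_eq_square using f_pos[OF t0] by simp
  moreover have "(\<alpha> - 1) + (\<alpha> - 1) + 1 = 2 * \<alpha> - 1" by simp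
  ultimately show "f t0 powr (2 * \<alpha> - 1) = lam\<^sup>2 * f t0" by simp
qed

lemma K_t0: "k * (f t0 powr (2 * \<alpha> - 1) * deriv f t0) = lam\<^sup>2 * (f t0 * deriv f t0 - (1 - k) * (f t0 * deriv f t0))"
  unfolding powr_t0 by (simp add: algebra_simps)

lemma phi_ge: "t0 \<le> t \<Longrightarrow> phi t = lam * f t"
  using powr_t0 by (auto simp: phi_def)

lemma K_ge: "t0 \<le> t \<Longrightarrow> K t = lam\<^sup>2 * (f t * deriv f t - (1 - k) * (f t0 * deriv f t0))"
  using K_t0 by (cases "t = t0") (simp_all add: K_def)

lemma phi_cont: "continuous_on {0<..} phi"
  unfolding phi_def[abs_def]
proof (rule continuous_on_cases_le)
  show "continuous_on {t \<in> {0<..}. t \<le> t0} (\<lambda>t. f t powr \<alpha>)"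
    using f_pos by (intro continuous_intros continuous_on_subset[OF f_cont']) (auto simp: less_imp_neq[symmetric])
  show "continuous_on {t \<in> {0<..}. t0 \<le> t} (\<lambda>t. lam * f t)"
    by (intro continuous_intros continuous_on_subset[OF f_cont']) auto
qed (auto simp: powr_t0)

lemma K_cont: "continuous_on {0<..} K"
  unfolding K_def[abs_def]
proof (rule continuous_on_cases_le)
  show "continuous_on {t \<in> {0<..}. t \<le> t0} (\<lambda>t. k * (f t powr (2 * \<alpha> - 1) * deriv f t))"
    using f_pos by (intro continuous_intros continuous_on_subset[OF f_cont'] continuous_on_subset[OF deriv_f_cont])
      (auto simp: less_imp_neq[symmetric])
  show "continuous_on {t \<in> {0<..}. t0 \<le> t} (\<lambda>t. lam\<^sup>2 * (f t * deriv f t - (1 - k) * (f t0 * deriv f t0)))"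
    by (intro continuous_intros continuous_on_subset[OF f_cont'] continuous_on_subset[OF deriv_f_cont]) auto
qed (use K_t0 in auto)

text \<open>Divided by \<open>f^(2\<alpha> - 2) f'^2\<close>, the condition
  \<open>\<phi>'^2 \<le> K'\<close> is exactly \<open>ratio_ge\<close>.\<close>

lemma sv_low:
  assumes "0 < b" "b \<le> a" "a \<le> t0"
  shows "(phi a - phi b)\<^sup>2 \<le> (a - b) * (K a - K b)"
proof -
  have "(f a powr \<alpha> - f b powr \<alpha>)\<^sup>2 \<le> (a - b) * (k * (f a powr (2 * \<alpha> - 1) * deriv f a) - k * (f b powr (2 * \<alpha> - 1) * deriv f b))"
  proof (rule sq_diff_le_from_derivative[OF assms(2), where \<phi>' = "\<lambda>x. \<alpha> * f x powr (\<alpha> - 1) * deriv f x"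
        and K' = "\<lambda>x. k * (((2 * \<alpha> - 1) * f x powr (2 * \<alpha> - 1 - 1) * deriv f x) * deriv f x + f x powr (2 * \<alpha> - 1) * deriv (deriv f) x)"])
    fix x assume x: "b \<le> x" "x \<le> a"
    then have x0: "x > 0" "x \<le> t0" using assms by auto
    show "((\<lambda>x. f x powr \<alpha>) has_real_derivative \<alpha> * f x powr (\<alpha> - 1) * deriv f x) (at x)"
      using f_pos[OF x0(1)] by (auto intro!: derivative_eq_intros f_deriv x0)
    show "((\<lambda>x. k * (f x powr (2 * \<alpha> - 1) * deriv f x)) has_real_derivative
       k * (((2 * \<alpha> - 1) * f x powr (2 * \<alpha> - 1 - 1) * deriv f x) * deriv f x + f x powr (2 * \<alpha> - 1) * deriv (deriv f) x)) (at x)"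
      using f_pos[OF x0(1)] by (auto intro!: derivative_eq_intros f_deriv f_deriv2 x0)
    have e: "f x powr (2 * \<alpha> - 1 - 1) = (f x powr (\<alpha> - 1))\<^sup>2" "f x powr (2 * \<alpha> - 1) = (f x powr (\<alpha> - 1))\<^sup>2 * f x"
    proof -
      have "f x powr ((\<alpha> - 1) + (\<alpha> - 1)) = (f x powr (\<alpha> - 1))\<^sup>2" unfolding powr_add power2_eq_square ..
      moreover have "(\<alpha> - 1) + (\<alpha> - 1) = 2 * \<alpha> - 1 - 1" by simp
      ultimately show *: "f x powr (2 * \<alpha> - 1 - 1) = (f x powr (\<alpha> - 1))\<^sup>2" by simp
      have "f x powr ((2 * \<alpha> - 1 - 1) + 1) = (f x powr (\<alpha> - 1))\<^sup>2 * f x"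
        unfolding powr_add * using f_pos[OF x0(1)] by simp
      then show "f x powr (2 * \<alpha> - 1) = (f x powr (\<alpha> - 1))\<^sup>2 * f x" by simp
    qed
    have "\<alpha>\<^sup>2 * ((f x powr (\<alpha> - 1))\<^sup>2 * (deriv f x)\<^sup>2)
        \<le> k * (2 * \<alpha> - 1 + ratio x) * ((f x powr (\<alpha> - 1))\<^sup>2 * (deriv f x)\<^sup>2)"
      by (intro mult_right_mono ratio_ge x0) auto
    also have "\<dots> = k * (((2 * \<alpha> - 1) * f x powr (2 * \<alpha> - 1 - 1) * deriv f x) * deriv f x + f x powr (2 * \<alpha> - 1) * deriv (deriv f) x)"
      unfolding e ratio_def using deriv_f_pos[OF x0(1)] by (simp add: field_simps power2_eq_square)
    finally show "(\<alpha> * f x powr (\<alpha> - 1) * deriv f x)\<^sup>2 \<le>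
       k * (((2 * \<alpha> - 1) * f x powr (2 * \<alpha> - 1 - 1) * deriv f x) * deriv f x + f x powr (2 * \<alpha> - 1) * deriv (deriv f) x)"
      by (simp add: power_mult_distrib mult.assoc)
  qed
  then show ?thesis using assms by (simp add: phi_def K_def)
qed

text \<open>Here \<open>K' - \<phi>'^2 = lam^2 f f''\<close>, which convexity makes nonnegative;
  this is why the continuation takes \<open>\<phi>\<close> proportional to \<open>f\<close>.\<close>

lemma sv_high:
  assumes "t0 \<le> b" "b \<le> a"
  shows "(phi a - phi b)\<^sup>2 \<le> (a - b) * (K a - K b)"
proof -
  have "(lam * f a - lam * f b)\<^sup>2 \<le> (a - b) * (lam\<^sup>2 * (f a * deriv f a - (1 - k) * (f t0 * deriv f t0)) - lam\<^sup>2 * (f b * deriv f b - (1 - k) * (f t0 * deriv f t0)))"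
  proof (rule sq_diff_le_from_derivative[OF assms(2), where \<phi>' = "\<lambda>x. lam * deriv f x"
        and K' = "\<lambda>x. lam\<^sup>2 * (deriv f x * deriv f x + f x * deriv (deriv f) x)"])
    fix x assume "b \<le> x" "x \<le> a"
    then have x0: "x > 0" using assms t0 by auto
    show "((\<lambda>x. lam * f x) has_real_derivative lam * deriv f x) (at x)"
      by (auto intro!: derivative_eq_intros f_deriv x0)
    show "((\<lambda>x. lam\<^sup>2 * (f x * deriv f x - (1 - k) * (f t0 * deriv f t0))) has_real_derivative
        lam\<^sup>2 * (deriv f x * deriv f x + f x * deriv (deriv f) x)) (at x)"
      by (auto intro!: derivative_eq_intros f_deriv f_deriv2 x0)
    show "(lam * deriv f x)\<^sup>2 \<le> lam\<^sup>2 * (deriv f x * deriv f x + f x * deriv (deriv f) x)"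
    proof -
      have "(lam * deriv f x)\<^sup>2 = lam\<^sup>2 * (deriv f x * deriv f x)" by (simp add: power_mult_distrib power2_eq_square)
      also have "\<dots> \<le> lam\<^sup>2 * (deriv f x * deriv f x + f x * deriv (deriv f) x)"
        using f_pos[OF x0] deriv2_f_nonneg[OF x0] by (intro mult_left_mono) auto
      finally show ?thesis .
    qed
  qed
  then show ?thesis using assms by (simp add: phi_ge K_ge)
qed

lemma sv_ordered:
  assumes "0 < b" "b \<le> a"
  shows "(phi a - phi b)\<^sup>2 \<le> (a - b) * (K a - K b)"
proof -
  consider "a \<le> t0" | "t0 \<le> b" | "b < t0" "t0 < a" by linarith
  then show ?thesis
  proof cases
    case 3
    have 1: "(phi a - phi t0)\<^sup>2 \<le> (a - t0) * (K a - K t0)" using 3 by (intro sv_high) auto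
    have 2: "(phi t0 - phi b)\<^sup>2 \<le> (t0 - b) * (K t0 - K b)" using 3 assms by (intro sv_low) auto
    have nn: "0 \<le> Y" if "x\<^sup>2 \<le> p * Y" "0 < p" for x p Y :: real
    proof -
      have "0 \<le> p * Y" by (rule order_trans[OF zero_le_power2 that(1)])
      then show ?thesis using that(2) by (simp add: zero_le_mult_iff)
    qed
    have "((phi a - phi t0) + (phi t0 - phi b))\<^sup>2 \<le> ((a - t0) + (t0 - b)) * ((K a - K t0) + (K t0 - K b))"
      using 3 nn[OF 1] nn[OF 2] by (intro add_sq_le 1 2) auto
    then show ?thesis by simp
  qed (use assms sv_low sv_high in auto)
qed

lemma sv:
  assumes "0 < a" "0 < b"
  shows "(phi a - phi b)\<^sup>2 \<le> (a - b) * (K a - K b)"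
proof (cases "b \<le> a")
  case False
  then have "(phi b - phi a)\<^sup>2 \<le> (b - a) * (K b - K a)" using assms by (intro sv_ordered) auto
  also have "(b - a) * (K b - K a) = (a - b) * (K a - K b)" by (simp add: algebra_simps)
  finally show ?thesis by (simp add: power2_commute)
qed (use assms sv_ordered in auto)

text \<open>\<open>K(t)/t\<close> is \<open>k\<close> times the product of
  \<open>f^(2\<alpha> - 2)\<close>, \<open>f'\<close> and \<open>f/t\<close>, each nonnegative and
  nondecreasing: the first because \<open>\<alpha> \<ge> 1\<close>, the others by convexity and
  \<open>f 0 = 0\<close>.\<close>

lemma star_low:
  assumes "0 < b" "b \<le> a" "a \<le> t0"
  shows "K b * a \<le> K a * b"
proof -
  have a0: "0 < a" using assms by simp
  have e: "f t powr (2 * \<alpha> - 1) = f t powr (2 * \<alpha> - 2) * f t" if "t > 0" for t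
  proof -
    have "f t powr ((2 * \<alpha> - 2) + 1) = f t powr (2 * \<alpha> - 2) * f t" unfolding powr_add using f_pos[OF that] by simp
    then show ?thesis by simp
  qed
  have "f b powr (2 * \<alpha> - 2) * deriv f b * (f b * a) \<le> f a powr (2 * \<alpha> - 2) * deriv f a * (f a * b)"
    using \<alpha> f_pos[OF assms(1)] f_le[of b a] deriv_f_pos[OF assms(1)] deriv_f_pos[OF a0] assms a0
    by (intro mult_mono powr_mono2 deriv_f_mono f_ratio_mono) auto
  then have "k * (f b powr (2 * \<alpha> - 2) * deriv f b * (f b * a)) \<le> k * (f a powr (2 * \<alpha> - 2) * deriv f a * (f a * b))"
    using k by (intro mult_left_mono) auto
  moreover have "K t = k * (f t powr (2 * \<alpha> - 2) * f t * deriv f t)" if "0 < t" "t \<le> t0" for t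
    using that by (simp add: K_def e)
  ultimately show ?thesis using assms a0 by (simp add: mult_ac)
qed

text \<open>\<open>f' f/t\<close> is nondecreasing as before, and subtracting \<open>c/t\<close>
  with \<open>c \<ge> 0\<close> preserves this.\<close>

lemma star_high:
  assumes "t0 \<le> b" "b \<le> a"
  shows "K b * a \<le> K a * b"
proof -
  have b0: "0 < b" "0 < a" using assms t0 by auto
  define c where "c = (1 - k) * (f t0 * deriv f t0)"
  have c: "c \<ge> 0" unfolding c_def using k f_pos[OF t0] deriv_f_pos[OF t0] by simp
  have "deriv f b * (f b * a) \<le> deriv f a * (f a * b)"
    using f_pos[OF b0(1)] deriv_f_pos[OF b0(2)] assms b0 by (intro mult_mono deriv_f_mono f_ratio_mono) auto
  moreover have "c * b \<le> c * a" using c assms by (intro mult_left_mono) auto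
  ultimately have "(f b * deriv f b - c) * a \<le> (f a * deriv f a - c) * b" by (simp add: algebra_simps)
  then have "lam\<^sup>2 * ((f b * deriv f b - c) * a) \<le> lam\<^sup>2 * ((f a * deriv f a - c) * b)" by (intro mult_left_mono) auto
  then show ?thesis using assms by (simp add: K_ge c_def mult.assoc)
qed

lemma star:
  assumes "0 < b" "b \<le> a"
  shows "K b * a \<le> K a * b"
proof -
  consider "a \<le> t0" | "t0 \<le> b" | "b < t0" "t0 < a" by linarith
  then show ?thesis
  proof cases
    case 3
    have 1: "K b * t0 \<le> K t0 * b" using 3 assms by (intro star_low) auto
    have 2: "K t0 * a \<le> K a * t0" using 3 by (intro star_high) auto
    have "(K b * a) * t0 \<le> (K t0 * a) * b" using mult_right_mono[OF 1, of a] assms by (simp add: mult_ac)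
    also have "\<dots> \<le> (K a * b) * t0" using mult_right_mono[OF 2, of b] assms by (simp add: mult_ac)
    finally show ?thesis using t0 by simp
  qed (use assms star_low star_high in auto)
qed

lemma K_nonneg:
  assumes "0 < a"
  shows "0 \<le> K a"
proof (cases "a \<le> t0")
  case True
  then show ?thesis using k deriv_f_pos[OF assms] by (simp add: K_def)
next
  case False
  \<comment> \<open>The upper branch contains a negative constant, so its sign is read off from the
    monotonicity of \<open>K(t)/t\<close> beyond \<open>t0\<close>.\<close>
  have "0 \<le> K t0" using k deriv_f_pos[OF t0] by (simp add: K_def)
  then have "0 \<le> K t0 * a" using assms by simp
  also have "\<dots> \<le> K a * t0" using False by (intro star t0) auto
  finally show ?thesis using t0 by (simp add: zero_le_mult_iff)
qed

text \<open>Let \<open>b\<close> tend to 0 in \<open>sv_ordered\<close>: \<open>phi b\<close> tends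
  to 0 since \<open>f 0 = 0\<close>, and \<open>K b \<ge> 0\<close> may be dropped.\<close>

lemma phi_sq_le:
  assumes "0 < a"
  shows "(phi a)\<^sup>2 \<le> a * K a"
proof -
  have f0: "(f \<longlongrightarrow> 0) (at_right 0)"
  proof -
    have "(f \<longlongrightarrow> f 0) (at 0 within {0..})" using f_cont by (auto simp: continuous_on_def)
    then show ?thesis using f_zero by (auto intro: tendsto_within_subset)
  qed
  have "((\<lambda>b. f b powr \<alpha>) \<longlongrightarrow> 0) (at_right 0)"
    using \<alpha> f0 by (intro tendsto_zero_powrI[where b=\<alpha>]) (auto intro!: eventually_at_rightI[of 0 1] less_imp_le f_pos)
  moreover have "\<forall>\<^sub>F b in at_right 0. f b powr \<alpha> = phi b"
    using eventually_at_right_real[OF t0] by eventually_elim (auto simp: phi_def)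
  ultimately have lim: "(phi \<longlongrightarrow> 0) (at_right 0)" by (rule Lim_transform_eventually)
  have "((\<lambda>b. (phi a - phi b)\<^sup>2) \<longlongrightarrow> (phi a - 0)\<^sup>2) (at_right 0)" by (intro tendsto_intros lim)
  moreover have "\<forall>\<^sub>F b in at_right 0. (phi a - phi b)\<^sup>2 \<le> a * K a"
    using eventually_at_right_real[OF assms]
  proof eventually_elim
    case (elim b)
    then have b: "0 < b" "b < a" by auto
    have "(phi a - phi b)\<^sup>2 \<le> (a - b) * (K a - K b)" using b by (intro sv_ordered) auto
    also have "\<dots> \<le> (a - b) * K a" using b K_nonneg[OF b(1)] by (intro mult_left_mono) auto
    also have "\<dots> \<le> a * K a" using b K_nonneg[OF assms] by (intro mult_right_mono) auto
    finally show ?case .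
  qed
  ultimately have "(phi a - 0)\<^sup>2 \<le> a * K a" by (rule tendsto_upperbound) simp
  then show ?thesis by simp
qed

text \<open>Below \<open>t0\<close> the gain is \<open>1 - k\<close>. Above,
  \<open>f' \<phi>^2 / f - K\<close> is constant while \<open>f f'\<close> grows, so the relative
  gain is smallest at the upper end, which fixes \<open>\<delta>\<close>; hence the restriction to
  \<open>t \<le> M\<close>.\<close>

lemma gain:
  assumes M: "0 < M"
  shows "\<exists>\<delta>. 0 < \<delta> \<and> \<delta> < 1 \<and> (\<forall>t. 0 < t \<longrightarrow> t \<le> M \<longrightarrow> f t * K t \<le> (1 - \<delta>) * deriv f t * (phi t)\<^sup>2)"
proof -
  \<comment> \<open>Taking the maximum with \<open>t0\<close> ensures \<open>c0 \<le> cT\<close>,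
    hence \<open>\<delta> \<le> 1 - k\<close>, so that one \<open>\<delta>\<close> serves both
    branches.\<close>
  define T where "T = max M t0"
  have T: "0 < T" "t0 \<le> T" "M \<le> T" using t0 by (auto simp: T_def)
  define c0 where "c0 = f t0 * deriv f t0"
  define cT where "cT = f T * deriv f T"
  have c0: "c0 > 0" unfolding c0_def using f_pos[OF t0] deriv_f_pos[OF t0] by simp
  have mono: "f a * deriv f a \<le> f b * deriv f b" if "0 < a" "a \<le> b" for a b
    using that f_le[of a b] f_pos[of b] deriv_f_pos[of a] deriv_f_mono[of a b] by (intro mult_mono) auto
  have c0T: "c0 \<le> cT" unfolding c0_def cT_def using mono t0 T by auto
  define \<delta> where "\<delta> = (1 - k) * c0 / cT"
  have cT: "cT > 0" using c0 c0T by simp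
  have \<delta>0: "\<delta> > 0" unfolding \<delta>_def using k c0 cT by simp
  have \<delta>k: "\<delta> \<le> 1 - k"
    unfolding \<delta>_def using k c0T cT by (simp add: divide_le_eq mult_left_mono)
  have "f t * K t \<le> (1 - \<delta>) * deriv f t * (phi t)\<^sup>2" if t: "0 < t" "t \<le> M" for t
  proof (cases "t \<le> t0")
    case True
    have p: "f t * f t powr (2 * \<alpha> - 1) = (f t powr \<alpha>)\<^sup>2"
    proof -
      have "f t powr (1 + (2 * \<alpha> - 1)) = f t powr (\<alpha> + \<alpha>)" by simp
      then show ?thesis unfolding powr_add power2_eq_square using f_pos[OF t(1)] by simp
    qed
    have "f t * K t = k * (deriv f t * (phi t)\<^sup>2)"
      using True by (simp add: K_def phi_def p[symmetric])
    also have "\<dots> \<le> (1 - \<delta>) * (deriv f t * (phi t)\<^sup>2)"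
      using \<delta>k deriv_f_pos[OF t(1)] by (intro mult_right_mono) auto
    finally show ?thesis by (simp add: mult.assoc)
  next
    case False
    have "\<delta> * (f t * deriv f t) \<le> \<delta> * cT"
      unfolding cT_def using \<delta>0 t T by (intro mult_left_mono mono) auto
    also have "\<dots> = (1 - k) * c0" using cT by (simp add: \<delta>_def)
    finally have "f t * deriv f t - (1 - k) * c0 \<le> (1 - \<delta>) * (f t * deriv f t)" by (simp add: algebra_simps)
    then have "(f t * lam\<^sup>2) * (f t * deriv f t - (1 - k) * c0) \<le> (f t * lam\<^sup>2) * ((1 - \<delta>) * (f t * deriv f t))"
      using f_pos[OF t(1)] by (intro mult_left_mono) auto
    then show ?thesis using False by (simp add: K_ge phi_ge c0_def power_mult_distrib power2_eq_square mult_ac)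
  qed
  then show ?thesis using \<delta>0 \<delta>k k by (intro exI[of _ \<delta>]) auto
qed

text \<open>Below \<open>t0\<close>, the bounds \<open>t \<le> C f^(1 - \<gamma>)\<close> and
  \<open>f' \<le> C f^\<gamma>'\<close> give
  \<open>t K(t) \<le> C f^(2\<alpha> - \<gamma> + \<gamma>')\<close>, whereas
  \<open>f' \<phi>^2 \<ge> c f^(2\<alpha> + \<gamma>)\<close>; the power in the claim is the
  quotient of the exponents. Above \<open>t0\<close> the left side is bounded and the right side is
  bounded away from 0.\<close>

lemma growth:
  assumes M: "0 < M" and \<gamma>: "\<gamma> \<noteq> 1" "0 \<le> 2 * \<alpha> - \<gamma> + \<gamma>'" "0 < 2 * \<alpha> + \<gamma>"
    and r: "\<And>t. 0 < t \<Longrightarrow> t \<le> t0 \<Longrightarrow> ratio t \<le> \<gamma>" "\<And>t. 0 < t \<Longrightarrow> t \<le> t0 \<Longrightarrow> \<gamma>' \<le> ratio t"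
  shows "\<exists>C\<ge>0. \<forall>t. 0 < t \<longrightarrow> t \<le> M \<longrightarrow>
     t * K t \<le> C * (deriv f t * (phi t)\<^sup>2) powr ((2 * \<alpha> - \<gamma> + \<gamma>') / (2 * \<alpha> + \<gamma>))"
proof -
  define \<theta> where "\<theta> = (2 * \<alpha> - \<gamma> + \<gamma>') / (2 * \<alpha> + \<gamma>)"
  have \<theta>0: "\<theta> \<ge> 0" using \<gamma> by (simp add: \<theta>_def)
  obtain c where c: "c > 0" "\<And>t. 0 < t \<Longrightarrow> t \<le> t0 \<Longrightarrow> c * f t powr \<gamma> \<le> deriv f t"
    using deriv_f_lower[OF t0 r(1)] by blast
  obtain C1 where C1: "C1 > 0" "\<And>t. 0 < t \<Longrightarrow> t \<le> t0 \<Longrightarrow> deriv f t \<le> C1 * f t powr \<gamma>'"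
    using deriv_f_upper[OF t0 r(2)] by blast
  obtain C2 where C2: "C2 > 0" "\<And>t. 0 < t \<Longrightarrow> t \<le> t0 \<Longrightarrow> t \<le> C2 * f t powr (1 - \<gamma>)"
    using le_f_powr[OF t0 c \<gamma>(1)] by blast
  define A where "A = C2 * k * C1 / c powr \<theta>"
  define B where "B = M * K (max M t0) / (deriv f t0 * (lam * f t0)\<^sup>2) powr \<theta>"
  have A0: "A \<ge> 0" using C1 C2 k by (simp add: A_def)
  have KT: "0 \<le> K (max M t0)" using t0 by (intro K_nonneg) auto
  have B0: "B \<ge> 0" using M KT by (simp add: B_def)
  have "t * K t \<le> (A + B) * (deriv f t * (phi t)\<^sup>2) powr \<theta>" if t: "0 < t" "t \<le> M" for t
  proof (cases "t \<le> t0")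
    case True
    note ft = f_pos[OF t(1)]
    have "t * K t = t * (k * (f t powr (2 * \<alpha> - 1) * deriv f t))" using True by (simp add: K_def)
    also have "\<dots> \<le> (C2 * f t powr (1 - \<gamma>)) * (k * (f t powr (2 * \<alpha> - 1) * (C1 * f t powr \<gamma>')))"
      using t True k C1(1) C2(1) deriv_f_pos[OF t(1)] by (intro mult_mono C1(2) C2(2)) auto
    also have "\<dots> = C2 * k * C1 * (f t powr (1 - \<gamma>) * f t powr (2 * \<alpha> - 1) * f t powr \<gamma>')" by simp
    also have "f t powr (1 - \<gamma>) * f t powr (2 * \<alpha> - 1) * f t powr \<gamma>' = f t powr (2 * \<alpha> - \<gamma> + \<gamma>')"
      unfolding powr_add[symmetric] by (rule arg_cong[where f="\<lambda>x. f t powr x"]) simp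
    also have "f t powr (2 * \<alpha> - \<gamma> + \<gamma>') = (f t powr (2 * \<alpha> + \<gamma>)) powr \<theta>"
      using \<gamma> by (simp add: \<theta>_def powr_powr)
    also have "C2 * k * C1 * (f t powr (2 * \<alpha> + \<gamma>)) powr \<theta> = A * (c * f t powr (2 * \<alpha> + \<gamma>)) powr \<theta>"
      using c(1) by (simp add: A_def powr_mult)
    also have "\<dots> \<le> A * (deriv f t * (phi t)\<^sup>2) powr \<theta>"
    proof (intro mult_left_mono powr_mono2 \<theta>0 A0)
      have "f t powr (2 * \<alpha> + \<gamma>) = f t powr (\<gamma> + (\<alpha> + \<alpha>))" by (rule arg_cong[where f="\<lambda>x. f t powr x"]) simp
      then have "c * f t powr (2 * \<alpha> + \<gamma>) = c * f t powr \<gamma> * (phi t)\<^sup>2"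
        using True unfolding powr_add by (simp add: phi_def power2_eq_square)
      also have "\<dots> \<le> deriv f t * (phi t)\<^sup>2" using c t True by (intro mult_right_mono) auto
      finally show "c * f t powr (2 * \<alpha> + \<gamma>) \<le> deriv f t * (phi t)\<^sup>2" .
    qed (use c in auto)
    also have "\<dots> \<le> (A + B) * (deriv f t * (phi t)\<^sup>2) powr \<theta>" using B0 by (intro mult_right_mono) auto
    finally show ?thesis .
  next
    case False
    define P where "P = deriv f t0 * (lam * f t0)\<^sup>2"
    have P: "P > 0" unfolding P_def using deriv_f_pos[OF t0] lam_pos f_pos[OF t0] by simp
    have "K t * max M t0 \<le> K (max M t0) * t" using t by (intro star) auto
    also have "\<dots> \<le> K (max M t0) * max M t0" using KT t by (intro mult_left_mono) auto
    finally have "K t \<le> K (max M t0)" using M by (simp add: mult_le_cancel_right less_max_iff_disj)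
    then have "t * K t \<le> M * K (max M t0)"
      using t K_nonneg[OF t(1)] by (intro mult_mono) auto
    also have "\<dots> = B * P powr \<theta>" using P unfolding B_def P_def[symmetric] by simp
    also have "\<dots> \<le> B * (deriv f t * (phi t)\<^sup>2) powr \<theta>"
    proof (intro mult_left_mono powr_mono2 \<theta>0 B0)
      have "(lam * f t0)\<^sup>2 \<le> (phi t)\<^sup>2"
        using False lam_pos f_pos[OF t0] f_le[of t0 t] t0 by (intro power_mono) (auto simp: phi_ge intro!: mult_left_mono)
      then show "P \<le> deriv f t * (phi t)\<^sup>2"
        unfolding P_def using False deriv_f_mono[OF t0, of t] deriv_f_pos[OF t(1)] by (intro mult_mono) auto
    qed (use P in auto)
    also have "\<dots> \<le> (A + B) * (deriv f t * (phi t)\<^sup>2) powr \<theta>" using A0 by (intro mult_right_mono) auto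
    finally show ?thesis .
  qed
  then show ?thesis unfolding \<theta>_def using A0 B0 by (intro exI[of _ "A + B"]) auto
qed

lemma phi_pos: "0 < t \<Longrightarrow> 0 < phi t"
  using f_pos[of t] lam_pos by (auto simp: phi_def)

end

section \<open>Proof of the theorem\<close>

context positive_solution
begin

text \<open>With \<open>F = sqrt u\<close> and \<open>Y = g / sqrt u\<close> the lower bound on
  \<open>g\<close> reads \<open>Y \<ge> a u^(1/2 + e)\<close>, so
  \<open>\<theta> = (1/2) / (1/2 + e)\<close> and \<open>1 - \<theta> \<le> 2 e\<close>: the
  condition of \<open>weighted_liouville\<close> holds in any dimension once \<open>e\<close> is
  small enough.\<close>

lemma supersolution_contradiction:
  assumes a: "0 < a" and e: "0 < e" and dim: "real DIM('a) * (2 * e) < 2 * s"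
    and g: "\<And>x. a * u x powr (1 + e) \<le> g x"
  shows False
proof -
  define \<theta> where "\<theta> = (1 / 2) / (1 / 2 + e)"
  have \<theta>: "0 \<le> \<theta>" "\<theta> < 1" using e by (auto simp: \<theta>_def)
  have e\<theta>: "(1 / 2 + e) * \<theta> = 1 / 2" using e by (simp add: \<theta>_def field_simps)
  have "1 - \<theta> = e / (1 / 2 + e)" using e by (simp add: \<theta>_def field_simps)
  also have "\<dots> \<le> 2 * e" using e by (simp add: field_simps)
  finally have "real DIM('a) * (1 - \<theta>) \<le> real DIM('a) * (2 * e)" by (intro mult_left_mono) auto
  then have dim': "real DIM('a) * (1 - \<theta>) < 2 * s" using dim by linarith
  have Ylow: "a * u x powr (1 / 2 + e) \<le> g x / sqrt (u x)" for x
  proof -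
    have "a * u x powr (1 / 2 + e) * sqrt (u x) = a * (u x powr (1 / 2 + e) * u x powr (1 / 2))"
      using u_pos[of x] by (simp add: powr_half_sqrt)
    also have "\<dots> = a * u x powr (1 + e)" unfolding powr_add[symmetric] by (simp add: add.commute)
    also have "\<dots> \<le> g x" by (rule g)
    finally show ?thesis using u_pos[of x] by (simp add: pos_le_divide_eq)
  qed
  have cY: "continuous_on UNIV (\<lambda>x. g x / sqrt (u x))"
    using u_pos by (intro continuous_intros g_cont u_cont) (auto simp: less_imp_neq[symmetric])
  have cF: "continuous_on UNIV (\<lambda>x. sqrt (u x))" by (intro continuous_intros u_cont)
  show False
  proof (rule weighted_liouville[OF s, where Y="\<lambda>x. g x / sqrt (u x)" and F="\<lambda>x. sqrt (u x)" and \<theta>=\<theta>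
        and D="sqrt M" and ?C1.0="a powr (- \<theta>)" and ?C0.0=1])
    show "0 < g x / sqrt (u x)" for x
    proof -
      have "0 < a * u x powr (1 / 2 + e)" using a u_pos[of x] by simp
      then show ?thesis using Ylow[of x] by linarith
    qed
    show "sqrt (u x) \<le> a powr (- \<theta>) * (g x / sqrt (u x)) powr \<theta>" for x
    proof -
      have "sqrt (u x) = u x powr (1 / 2)" using u_pos[of x] by (simp add: powr_half_sqrt)
      also have "\<dots> = (u x powr (1 / 2 + e)) powr \<theta>" unfolding powr_powr e\<theta> ..
      also have "\<dots> = a powr (- \<theta>) * (a * u x powr (1 / 2 + e)) powr \<theta>"
        using a u_pos[of x] by (simp add: powr_mult powr_minus)
      also have "\<dots> \<le> a powr (- \<theta>) * (g x / sqrt (u x)) powr \<theta>"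
        using a \<theta> Ylow by (intro mult_left_mono powr_mono2) auto
      finally show ?thesis .
    qed
    show "(\<integral>\<^sup>+x. ennreal (g x / sqrt (u x) * (\<psi> x)\<^sup>2) \<partial>lborel) \<le> ennreal (1 * E)"
      if "continuous_on UNIV \<psi>" "\<And>x. norm x > R \<Longrightarrow> \<psi> x = 0" "0 \<le> E"
        "(\<integral>\<^sup>+x. ennreal (sqrt (u x)) * sqdiff_integral s \<psi> x \<partial>lborel) \<le> ennreal E" for \<psi> R E
      using supersolution_test[OF that(1,2,4,3)] by simp
  qed (use \<theta> dim' cY cF u_le u_pos in \<open>auto simp: less_imp_le intro: borel_measurable_continuous_onI\<close>)
qed

text \<open>Here \<open>1 - \<theta> = (2\<gamma> - \<gamma>') / (2\<alpha> + \<gamma>)\<close>, so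
  \<open>dim\<close> is the dimension condition of \<open>weighted_liouville\<close> for the power
  found in \<open>growth\<close>.\<close>

lemma stable_contradiction:
  fixes f :: "real \<Rightarrow> real"
  assumes tp: "test_pair f t0 \<alpha> k"
    and c: "0 < c" and gf: "\<And>x. c * g x = f (u x)"
    and stab: "\<And>\<xi>. \<xi> \<in> test_functions \<Longrightarrow> (LINT x|lebesgue. deriv f (u x) * (\<xi> x)\<^sup>2) \<le>
       c / 2 * (LINT x|lebesgue. LINT y|lebesgue. (\<xi> x - \<xi> y)\<^sup>2 / norm (x - y) powr (real DIM('a) + 2 * s))"
    and \<gamma>: "\<gamma> \<noteq> 1" "0 \<le> 2 * \<alpha> - \<gamma> + \<gamma>'" "0 < 2 * \<gamma> - \<gamma>'" "0 < 2 * \<alpha> + \<gamma>"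
    and r: "\<And>t. 0 < t \<Longrightarrow> t \<le> t0 \<Longrightarrow> convex_nonlinearity_zero.ratio f t \<le> \<gamma>"
      "\<And>t. 0 < t \<Longrightarrow> t \<le> t0 \<Longrightarrow> \<gamma>' \<le> convex_nonlinearity_zero.ratio f t"
    and dim: "real DIM('a) * (2 * \<gamma> - \<gamma>') < 2 * s * (2 * \<alpha> + \<gamma>)"
  shows False
proof -
  interpret test_pair f t0 \<alpha> k by (rule tp)
  define \<theta> where "\<theta> = (2 * \<alpha> - \<gamma> + \<gamma>') / (2 * \<alpha> + \<gamma>)"
  have \<theta>: "0 \<le> \<theta>" using \<gamma> by (simp add: \<theta>_def)
  have \<theta>1: "1 - \<theta> = (2 * \<gamma> - \<gamma>') / (2 * \<alpha> + \<gamma>)" using \<gamma> by (simp add: \<theta>_def field_simps)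
  then have \<theta>2: "\<theta> < 1" using \<gamma> by (smt (verit) divide_pos_pos)
  have dim': "real DIM('a) * (1 - \<theta>) < 2 * s" unfolding \<theta>1 using dim \<gamma> by (simp add: divide_less_eq)
  obtain C1 where C1: "C1 \<ge> 0" "\<And>t. 0 < t \<Longrightarrow> t \<le> M \<Longrightarrow> t * K t \<le> C1 * (deriv f t * (phi t)\<^sup>2) powr \<theta>"
    using growth[OF M_pos \<gamma>(1,2,4) r] unfolding \<theta>_def by blast
  obtain \<delta> where \<delta>: "0 < \<delta>" "\<delta> < 1" "\<And>t. 0 < t \<Longrightarrow> t \<le> M \<Longrightarrow> f t * K t \<le> (1 - \<delta>) * deriv f t * (phi t)\<^sup>2"
    using gain[OF M_pos] by blast
  have u0: "u x \<in> {0<..}" for x using u_pos by simp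
  have cV: "continuous_on UNIV (\<lambda>x. deriv f (u x))"
    by (rule continuous_on_compose2[OF deriv_f_cont u_cont]) (use u0 in auto)
  have c\<phi>: "continuous_on UNIV (\<lambda>x. phi (u x))"
    by (rule continuous_on_compose2[OF phi_cont u_cont]) (use u0 in auto)
  have cK: "continuous_on UNIV (\<lambda>x. K (u x))"
    by (rule continuous_on_compose2[OF K_cont u_cont]) (use u0 in auto)
  have gain': "c * g x * K (u x) \<le> (1 - \<delta>) * deriv f (u x) * (phi (u x))\<^sup>2" for x
    unfolding gf by (rule \<delta>(3)[OF u_pos u_le])
  have "\<exists>C\<ge>0. \<forall>\<psi> R E. continuous_on UNIV \<psi> \<longrightarrow> (\<forall>x. norm x > R \<longrightarrow> \<psi> x = 0) \<longrightarrow> 0 \<le> E \<longrightarrow>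
     (\<integral>\<^sup>+x. ennreal (u x * K (u x)) * sqdiff_integral s \<psi> x \<partial>lborel) \<le> ennreal E \<longrightarrow>
     (\<integral>\<^sup>+x. ennreal (deriv f (u x) * (phi (u x))\<^sup>2 * (\<psi> x)\<^sup>2) \<partial>lborel) \<le> ennreal (C * E)"
    by (rule stable_test[OF stab c cV deriv_f_nonneg[OF u_pos] phi_cont K_cont sv star K_nonneg phi_sq_le gain' \<delta>(1,2)]) assumption+
  then obtain C0 where C0: "C0 \<ge> 0" and test: "\<forall>\<psi> R E. continuous_on UNIV \<psi> \<longrightarrow> (\<forall>x. norm x > R \<longrightarrow> \<psi> x = 0) \<longrightarrow> 0 \<le> E \<longrightarrow>
     (\<integral>\<^sup>+x. ennreal (u x * K (u x)) * sqdiff_integral s \<psi> x \<partial>lborel) \<le> ennreal E \<longrightarrow>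
     (\<integral>\<^sup>+x. ennreal (deriv f (u x) * (phi (u x))\<^sup>2 * (\<psi> x)\<^sup>2) \<partial>lborel) \<le> ennreal (C0 * E)"
    by (elim exE conjE)
  show False
  proof (rule weighted_liouville[OF s, where Y="\<lambda>x. deriv f (u x) * (phi (u x))\<^sup>2" and F="\<lambda>x. u x * K (u x)" and \<theta>=\<theta>
        and D="M * K M" and ?C1.0=C1 and ?C0.0=C0])
    show "(\<lambda>x. deriv f (u x) * (phi (u x))\<^sup>2) \<in> borel_measurable borel" "(\<lambda>x. u x * K (u x)) \<in> borel_measurable borel"
      by (auto intro!: borel_measurable_continuous_onI continuous_intros cV c\<phi> cK u_cont)
    show "0 < deriv f (u x) * (phi (u x))\<^sup>2" for x using deriv_f_pos[OF u_pos, of x] phi_pos[OF u_pos, of x] by simp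
    show "0 \<le> u x * K (u x)" for x using K_nonneg[OF u_pos, of x] u_pos[of x] by simp
    show "u x * K (u x) \<le> M * K M" for x
    proof -
      have "K (u x) * M \<le> K M * u x" by (rule star[OF u_pos u_le])
      also have "\<dots> \<le> K M * M" using K_nonneg[OF M_pos] u_le by (intro mult_left_mono)
      finally have "K (u x) \<le> K M" using M_pos by simp
      then show ?thesis using u_le[of x] u_pos[of x] K_nonneg[OF u_pos, of x] M_pos by (intro mult_mono) auto
    qed
    show "u x * K (u x) \<le> C1 * (deriv f (u x) * (phi (u x))\<^sup>2) powr \<theta>" for x
      by (rule C1(2)[OF u_pos u_le])
    show "(\<integral>\<^sup>+x. ennreal (deriv f (u x) * (phi (u x))\<^sup>2 * (\<psi> x)\<^sup>2) \<partial>lborel) \<le> ennreal (C0 * E)"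
      if "continuous_on UNIV \<psi>" "\<And>x. norm x > R \<Longrightarrow> \<psi> x = 0" "0 \<le> E"
        "(\<integral>\<^sup>+x. ennreal (u x * K (u x)) * sqdiff_integral s \<psi> x \<partial>lborel) \<le> ennreal E" for \<psi> R E
      using test that by blast
  qed (fact C0 C1(1) \<theta> \<theta>2 dim')+
qed

end

section \<open>Positivity, the critical exponent and the choice of parameters\<close>

lemma frac_const_pos:
  assumes "0 < s" "s < 1"
  shows "0 < frac_const n s"
  using assms by (auto simp: frac_const_def intro!: divide_pos_pos mult_pos_pos Gamma_real_pos add_nonneg_pos)

text \<open>The strong maximum principle by direct evaluation. At a zero \<open>x0\<close> the
  truncated operator is minus the integral of \<open>u\<close> against the kernel, and the values of
  \<open>u\<close> near \<open>y0\<close> push it below \<open>- (m * B)\<close> for all small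
  holes; its limit is \<open>f 0 / c\<close>, which is nonnegative.\<close>

lemma (in convex_nonlinearity) solution_positive:
  fixes u :: "'a::euclidean_space \<Rightarrow> real"
  assumes s: "0 < s" and u_cont: "continuous_on UNIV u" and u_nonneg: "\<And>x. 0 \<le> u x" and u_le: "\<And>x. u x \<le> M"
    and lim: "\<And>x. (\<lambda>n. trunc_lap s u (1 / real (Suc n)) x) \<longlonglongrightarrow> f (u x) / c" and c: "0 < c"
    and nz: "u y0 \<noteq> 0"
  shows "0 < u x0"
proof (rule ccontr)
  assume "\<not> 0 < u x0"
  then have ux0: "u x0 = 0" using u_nonneg[of x0] by simp
  have [measurable]: "u \<in> borel_measurable borel" using u_cont by (rule borel_measurable_continuous_onI)
  define v where "v = u y0"
  have v: "v > 0" using nz u_nonneg[of y0] by (simp add: v_def)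
  define d where "d = norm (y0 - x0)"
  have d: "d > 0" using ux0 nz by (auto simp: d_def)
  have "isCont u y0" using u_cont by (simp add: continuous_on_eq_continuous_at)
  then obtain r0 where r0: "r0 > 0" "\<And>y. dist y y0 < r0 \<Longrightarrow> dist (u y) (u y0) < v / 2"
    using v unfolding continuous_at_eps_delta by (metis half_gt_zero)
  \<comment> \<open>At most half of \<open>d\<close>, so that the ball around \<open>y0\<close>
    avoids holes of radius below \<open>d / 2\<close> and stays within distance \<open>2 * d\<close>
    of \<open>x0\<close>.\<close>
  define r where "r = min r0 (d / 2)"
  have r: "r > 0" "r \<le> r0" "r \<le> d / 2" using r0 d by (auto simp: r_def)
  define m where "m = 1 / (2 * d) powr (real DIM('a) + 2 * s) * (v / 2)"
  have m: "m > 0" using d v by (simp add: m_def)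
  define B where "B = measure lborel (ball y0 r)"
  have B: "B > 0"
    using r(1) unit_ball_vol_pos[of "real DIM('a)"] by (simp add: B_def content_ball)
  have le: "trunc_lap s u (1 / real (Suc n)) x0 \<le> - (m * B)" if n: "1 / real (Suc n) < d / 2" for n
  proof -
    define \<epsilon> where "\<epsilon> = 1 / real (Suc n)"
    have e: "\<epsilon> > 0" "\<epsilon> < d / 2" using n by (auto simp: \<epsilon>_def)
    have int: "integrable lborel (\<lambda>y. trunc_kern s \<epsilon> (y - x0) * u y)"
    proof (rule Bochner_Integration.integrable_bound)
      show "integrable lborel (\<lambda>y. trunc_kern s \<epsilon> (y - x0) * M)"
        using integrable_lborel_translate(3)[OF integrable_trunc_kern[OF s e(1)], of x0] by simp
      show "AE y in lborel. norm (trunc_kern s \<epsilon> (y - x0) * u y) \<le> norm (trunc_kern s \<epsilon> (y - x0) * M)"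
        using u_le u_nonneg by (intro AE_I2) (auto simp: abs_mult intro!: mult_left_mono order_trans[OF _ abs_ge_self])
    qed measurable
    have "m * B = (LINT y|lborel. m * indicator (ball y0 r) y)" by (simp add: B_def)
    also have "\<dots> \<le> (LINT y|lborel. trunc_kern s \<epsilon> (y - x0) * u y)"
    proof (rule integral_mono)
      have "integrable lborel (\<lambda>y::'a. indicator (ball y0 r) y *\<^sub>R m)"
        by (rule integrable_indicator) (auto simp: emeasure_lborel_ball_finite[unfolded infinity_ennreal_def])
      then show "integrable lborel (\<lambda>y. m * indicator (ball y0 r) y)" by (simp add: mult.commute)
      fix y :: 'a
      show "m * indicator (ball y0 r) y \<le> trunc_kern s \<epsilon> (y - x0) * u y"
      proof (cases "y \<in> ball y0 r")
        case True
        then have yy: "norm (y - y0) < r" by (simp add: dist_norm norm_minus_commute)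
        have n1: "d - norm (y - y0) \<le> norm (y - x0)"
          using norm_triangle_ineq2[of "y0 - x0" "y0 - y"] by (simp add: d_def norm_minus_commute)
        have n2: "norm (y - x0) \<le> norm (y - y0) + d"
          using norm_triangle_ineq[of "y - y0" "y0 - x0"] by (simp add: d_def)
        have b: "\<epsilon> < norm (y - x0)" "norm (y - x0) \<le> 2 * d" using n1 n2 yy r e d by linarith+
        have "1 / (2 * d) powr (real DIM('a) + 2 * s) \<le> kern s (y - x0)"
        proof -
          have "0 < norm (y - x0)" using b e by linarith
          then show ?thesis unfolding kern_def using b d s
            by (intro divide_left_mono powr_mono2 mult_pos_pos) auto
        qed
        also have "\<dots> = trunc_kern s \<epsilon> (y - x0)" using b by (simp add: trunc_kern_def)
        finally have k: "1 / (2 * d) powr (real DIM('a) + 2 * s) \<le> trunc_kern s \<epsilon> (y - x0)" .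
        have "\<bar>u y - v\<bar> < v / 2" using r0(2)[of y] yy r by (simp add: dist_norm dist_real_def v_def)
        then have "v / 2 \<le> u y" by linarith
        then have "m \<le> trunc_kern s \<epsilon> (y - x0) * u y"
          unfolding m_def using k v by (intro mult_mono) auto
        then show ?thesis using True by simp
      next
        case False
        then show ?thesis using u_nonneg[of y] by simp
      qed
    qed (rule int)
    also have "\<dots> = - trunc_lap s u \<epsilon> x0" by (simp add: trunc_lap_def ux0)
    finally show ?thesis by (simp add: \<epsilon>_def)
  qed
  have "\<forall>\<^sub>F n in sequentially. 1 / real (Suc n) < d / 2"
    by (rule order_tendstoD(2)[OF LIMSEQ_Suc[OF lim_1_over_n]]) (use d in simp)
  then have "\<forall>\<^sub>F n in sequentially. trunc_lap s u (1 / real (Suc n)) x0 \<le> - (m * B)"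
    by eventually_elim (rule le)
  from tendsto_upperbound[OF lim this] have "f (u x0) / c \<le> - (m * B)" by simp
  moreover have "0 \<le> f (u x0) / c" using c ux0 f_zero_nonneg by simp
  moreover have "0 < m * B" using m B by simp
  ultimately show False by linarith
qed

context convex_nonlinearity_zero
begin

text \<open>A limit below 1 would force \<open>ratio \<ge> 1\<close> near 0, hence
  \<open>f' \<le> c f\<close> there. Together with \<open>f \<le> t f'\<close>, which is convexity
  with \<open>f 0 = 0\<close>, this gives \<open>f \<le> c t f\<close>, absurd for small
  \<open>t\<close>.\<close>

lemma q_limit_ge_one:
  assumes q: "(q_fun f \<longlongrightarrow> q0) (at_right 0)"
  shows "1 \<le> q0"
proof (rule ccontr)
  assume "\<not> 1 \<le> q0"
  then have "\<forall>\<^sub>F t in at_right 0. q_fun f t < 1" using order_tendstoD(2)[OF q] by simp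
  then obtain b where b: "b > 0" "\<And>t. 0 < t \<Longrightarrow> t < b \<Longrightarrow> q_fun f t < 1"
    by (auto simp: eventually_at_right_field)
  have "1 \<le> ratio t" if t: "0 < t" "t \<le> b / 2" for t
  proof -
    have q1: "q_fun f t < 1" using b t by auto
    then have nz: "f t * deriv (deriv f) t \<noteq> 0" by (auto simp: q_fun_def split: if_splits)
    then have pos: "f t * deriv (deriv f) t > 0" using f_pos[OF t(1)] deriv2_f_nonneg[OF t(1)] by (simp add: less_le)
    have "(deriv f t)\<^sup>2 / (f t * deriv (deriv f) t) < 1" using q1 nz by (simp add: q_fun_def)
    then have "(deriv f t)\<^sup>2 < f t * deriv (deriv f) t" using pos by (simp add: divide_less_eq)
    then show ?thesis using deriv_f_pos[OF t(1)] by (simp add: ratio_def)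
  qed
  then obtain c where c: "c > 0" "\<And>t. 0 < t \<Longrightarrow> t \<le> b / 2 \<Longrightarrow> deriv f t \<le> c * f t powr 1"
    using deriv_f_upper[of "b / 2" 1] b by auto
  define t where "t = min (b / 2) (1 / (2 * c))"
  have t: "0 < t" "t \<le> b / 2" "t \<le> 1 / (2 * c)" using b c by (auto simp: t_def)
  have "f t \<le> t * deriv f t" by (rule f_le_tangent[OF t(1)])
  also have "\<dots> \<le> t * (c * f t)" using c(2)[OF t(1,2)] f_pos[OF t(1)] t by (intro mult_left_mono) auto
  also have "\<dots> \<le> (1 / (2 * c)) * (c * f t)" using t c f_pos[OF t(1)] by (intro mult_right_mono) auto
  also have "\<dots> = f t / 2" using c by simp
  finally show False using f_pos[OF t(1)] by simp
qed

text \<open>Passing to reciprocals in \<open>ereal\<close> puts \<open>f'' = 0\<close> on the same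
  footing: there \<open>q_fun\<close> is \<open>\<infinity>\<close> and its inverse is 0, the value
  of \<open>ratio\<close>.\<close>

lemma ratio_tendsto:
  assumes q: "(q_fun f \<longlongrightarrow> q0) (at_right 0)"
  shows "((\<lambda>t. ereal (ratio t)) \<longlongrightarrow> inverse q0) (at_right 0)"
proof -
  have inv: "inverse (q_fun f t) = ereal (ratio t)" and nn: "0 \<le> q_fun f t" if t: "0 < t" for t
  proof -
    have "f t * deriv (deriv f) t \<ge> 0" using f_pos[OF t] deriv2_f_nonneg[OF t] by simp
    then show "0 \<le> q_fun f t" by (simp add: q_fun_def)
    show "inverse (q_fun f t) = ereal (ratio t)"
      using deriv_f_pos[OF t] f_pos[OF t] by (auto simp: q_fun_def ratio_def)
  qed
  have "((\<lambda>t. inverse (q_fun f t)) \<longlongrightarrow> inverse q0) (at_right 0)"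
    using nn by (intro Extended_Real.tendsto_inverse_ereal[OF q]) (auto intro!: eventually_at_rightI[of 0 1])
  then show ?thesis
    by (rule Lim_transform_eventually) (auto intro!: eventually_at_rightI[of 0 1] inv)
qed

end

text \<open>Put \<open>r = sqrt (N / s - 1)\<close>, that is \<open>N = s (r^2 + 1)\<close>. Then
  \<open>p_c\<close> simplifies to \<open>(r - 1)^2 / ((r - 3) (r + 1))\<close>, and as
  \<open>(r - 3) (r + 1) = (r - 1)^2 - 4\<close>, the inequality \<open>q / (q - 1) < p_c\<close>
  becomes \<open>(r - 1)^2 < 4 q\<close>. Squaring \<open>r < 2 sqrt q + 1\<close> gives the claim.
  The threshold \<open>10 * s\<close> is the value of the bound at \<open>q = 1\<close>, and
  \<open>p0 < \<infinity>\<close> excludes equality there.\<close>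

lemma dimension_condition:
  fixes s q :: real
  assumes s: "0 < s" and q: "1 \<le> q" and p0: "p0 = conjugate_exponent (ereal q)"
    and cond: "real n < 10 * s \<or> (real n = 10 * s \<and> p0 < \<infinity>) \<or> (real n > 10 * s \<and> p0 < ereal (p_c n s))"
  shows "real n < 2 * s * (2 * q + 2 * sqrt q + 1)"
proof -
  have sq: "1 \<le> sqrt q" using q by simp
  have five: "5 \<le> 2 * q + 2 * sqrt q + 1" using q sq by linarith
  have base: "10 * s \<le> 2 * s * (2 * q + 2 * sqrt q + 1)"
    using mult_left_mono[OF five, of "2 * s"] s by simp
  have p0': "q \<noteq> 1 \<and> p0 = ereal (q / (q - 1))" if "p0 < \<infinity>"
  proof -
    have "q \<noteq> 1" using that p0 conjugate_exponent_1 by (auto simp: one_ereal_def)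
    then show ?thesis using p0 q by (simp add: conjugate_exponent_real)
  qed
  consider "real n < 10 * s" | "real n = 10 * s" "p0 < \<infinity>" | "real n > 10 * s" "p0 < ereal (p_c n s)"
    using cond by blast
  then show ?thesis
  proof cases
    case 1
    then show ?thesis using base by linarith
  next
    case 2
    then have "q > 1" using p0' q by auto
    then have "5 < 2 * q + 2 * sqrt q + 1" using sq by linarith
    then show ?thesis using mult_strict_left_mono[of 5 "2 * q + 2 * sqrt q + 1" "2 * s"] s 2 by simp
  next
    case 3
    then have "p0 < \<infinity>" using less_trans[of p0 "ereal (p_c n s)" \<infinity>] by simp
    then have q1: "q > 1" and pq: "q / (q - 1) < p_c n s" using p0' q 3 by auto
    define r where "r = sqrt (real n / s - 1)"
    have ns: "real n / s > 10" using 3 s by (simp add: field_simps)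
    have r2: "r\<^sup>2 = real n / s - 1" unfolding r_def using ns by (intro real_sqrt_pow2) simp
    have n: "real n = s * (r\<^sup>2 + 1)" unfolding r2 using s by simp
    have r3: "r > 3"
      using ns unfolding r_def by (intro real_less_rsqrt) (simp add: power2_eq_square)
    have sr: "sqrt (s * (real n - s)) = s * r"
    proof -
      have "s * (real n - s) = (s * r)\<^sup>2" by (simp add: n power2_eq_square algebra_simps)
      then show ?thesis using s r3 by simp
    qed
    have pc: "p_c n s = (r - 1)\<^sup>2 / ((r - 3) * (r + 1))"
    proof -
      have a: "real n - 2 * s = s * (r\<^sup>2 - 1)" "real n - 10 * s = s * (r\<^sup>2 - 9)"
        by (simp_all add: n algebra_simps)
      \<comment> \<open>Numerator and denominator share the factor
        \<open>s^2 (r - 1) (r + 3)\<close>, positive since \<open>r > 3\<close>; both are written so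
        that it cancels.\<close>
      have num: "(real n - 2 * s)\<^sup>2 - 4 * s * real n + 8 * s * sqrt (s * (real n - s)) = (r - 1)\<^sup>2 * (s\<^sup>2 * ((r - 1) * (r + 3)))"
        unfolding a sr unfolding n by (simp add: power2_eq_square algebra_simps)
      have den: "(real n - 10 * s) * (real n - 2 * s) = ((r - 3) * (r + 1)) * (s\<^sup>2 * ((r - 1) * (r + 3)))"
        unfolding a by (simp add: power2_eq_square algebra_simps)
      have "s\<^sup>2 * ((r - 1) * (r + 3)) \<noteq> 0" using s r3 by simp
      then show ?thesis unfolding p_c_def num den by simp
    qed
    have "q * ((r - 3) * (r + 1)) < (r - 1)\<^sup>2 * (q - 1)"
      using pq q1 r3 unfolding pc by (simp add: divide_simps mult.commute split: if_splits)
    then have "(r - 1)\<^sup>2 < 4 * q" by (simp add: power2_eq_square algebra_simps)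
    also have "4 * q = (2 * sqrt q)\<^sup>2" using q by (simp add: power_mult_distrib)
    finally have "r - 1 < 2 * sqrt q" using q by (intro power2_less_imp_less[of "r - 1" "2 * sqrt q"]) auto
    then have "r\<^sup>2 < (2 * sqrt q + 1)\<^sup>2" using r3 by (intro power_strict_mono) auto
    also have "\<dots> = 4 * q + 4 * sqrt q + 1" using q by (simp add: power2_sum power_mult_distrib)
    finally have "r\<^sup>2 + 1 < 2 * (2 * q + 2 * sqrt q + 1)" by simp
    then have "s * (r\<^sup>2 + 1) < s * (2 * (2 * q + 2 * sqrt q + 1))" using s by (intro mult_strict_left_mono)
    also have "\<dots> = 2 * s * (2 * q + 2 * sqrt q + 1)" by (simp only: mult.assoc[symmetric] mult.commute[of s 2])
    finally show ?thesis unfolding n .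
  qed
qed

lemma (in convex_nonlinearity) solution_imp_positive_solution:
  fixes u :: "'a::euclidean_space \<Rightarrow> real"
  assumes s: "0 < s" "s < 1" and sol: "is_solution s f u"
    and u: "\<And>x. 0 \<le> u x" "\<And>x. u x \<le> M" "u \<noteq> (\<lambda>x. 0)"
  shows "positive_solution s u (\<lambda>x. f (u x) / frac_const DIM('a) s) M"
proof -
  define c where "c = frac_const DIM('a) s"
  have c: "0 < c" unfolding c_def by (rule frac_const_pos[OF s])
  obtain \<sigma> where \<sigma>: "s < \<sigma>" "u \<in> C_real (2 * \<sigma>)" and lap: "\<And>x. has_frac_laplacian s u x (f (u x))"
    using sol unfolding is_solution_def by blast
  have cu: "continuous_on UNIV u" using \<sigma>(2) unfolding C_real_def by (auto intro: C_k_imp_continuous)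
  obtain b where b: "b > 2 * s" and bd: "\<And>R. \<exists>C\<ge>0. \<forall>x h. norm x \<le> R \<longrightarrow> norm h \<le> 1 \<longrightarrow>
           \<bar>2 * u x - u (x + h) - u (x - h)\<bar> \<le> C * norm h powr b"
    using C_real_second_difference[OF \<sigma>(2) s \<sigma>(1)] by blast
  have lim: "(\<lambda>n. trunc_lap s u (1 / real (Suc n)) x) \<longlonglongrightarrow> f (u x) / c" for x
  proof -
    have "(\<lambda>n. (c * trunc_lap s u (1 / real (Suc n)) x) / c) \<longlonglongrightarrow> f (u x) / c"
      unfolding c_def using c by (intro tendsto_divide has_frac_laplacian_trunc_lap[OF lap cu] tendsto_const) (simp add: c_def)
    then show ?thesis using c by simp
  qed
  obtain y0 where "u y0 \<noteq> 0" using u(3) by auto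
  then have pos: "0 < u x" for x
    by (rule solution_positive[OF s(1) cu u(1,2) lim c])
  show ?thesis
  proof (unfold_locales, unfold c_def[symmetric])
    show "continuous_on UNIV (\<lambda>x. f (u x) / c)"
      using c u(1) by (intro continuous_intros continuous_on_compose2[OF f_cont cu]) auto
    show "0 \<le> f (u x) / c" for x using f_pos[OF pos, of x] c by simp
    show "\<exists>B. \<forall>x \<epsilon>. norm x \<le> R \<longrightarrow> 0 < \<epsilon> \<longrightarrow> \<bar>trunc_lap s u \<epsilon> x\<bar> \<le> B" for R
    proof -
      obtain C where C: "C \<ge> 0" "\<And>x h. norm x \<le> R \<Longrightarrow> norm h \<le> 1 \<Longrightarrow>
           \<bar>2 * u x - u (x + h) - u (x - h)\<bar> \<le> C * norm h powr b" using bd by blast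
      have "\<bar>u x\<bar> \<le> M" for x using u(1,2)[of x] by simp
      then show ?thesis by (rule trunc_lap_bounded[OF cu _ s(1) b C(2,1)])
    qed
  qed (fact s cu pos u(2) lim)+
qed

text \<open>\<open>ratio\<close> tends to 0, so \<open>f' \<ge> c f^\<gamma>\<close> near 0 for any
  \<open>\<gamma> > 0\<close>, and integration gives \<open>t \<le> C f^(1 - \<gamma>)\<close>. The
  value \<open>\<gamma> = e / (1 + e)\<close> makes \<open>1 / (1 - \<gamma>) = 1 + e\<close>. From
  \<open>T\<close> to \<open>M\<close> the monotonicity of \<open>f\<close> suffices, with a smaller
  constant.\<close>

lemma (in convex_nonlinearity_zero) superlinear_lower_bound:
  assumes q: "(q_fun f \<longlongrightarrow> \<infinity>) (at_right 0)" and e: "0 < e"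
  shows "\<exists>a>0. \<forall>t. 0 < t \<longrightarrow> t \<le> M \<longrightarrow> a * t powr (1 + e) \<le> f t"
proof -
  define \<gamma> where "\<gamma> = e / (1 + e)"
  have \<gamma>: "0 < \<gamma>" "\<gamma> < 1" and \<gamma>e: "(1 - \<gamma>) * (1 + e) = 1" using e by (auto simp: \<gamma>_def field_simps)
  have "(ratio \<longlongrightarrow> 0) (at_right 0)" using ratio_tendsto[OF q] by (simp add: zero_ereal_def)
  then have "\<forall>\<^sub>F t in at_right 0. ratio t < \<gamma>" using \<gamma>(1) by (rule order_tendstoD)
  then obtain b where b: "b > 0" "\<And>t. 0 < t \<Longrightarrow> t < b \<Longrightarrow> ratio t < \<gamma>"
    by (auto simp: eventually_at_right_field)
  define T where "T = b / 2"
  have T: "T > 0" "\<And>t. 0 < t \<Longrightarrow> t \<le> T \<Longrightarrow> ratio t \<le> \<gamma>" using b by (auto simp: T_def intro!: less_imp_le)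
  obtain c where c: "c > 0" "\<And>t. 0 < t \<Longrightarrow> t \<le> T \<Longrightarrow> c * f t powr \<gamma> \<le> deriv f t"
    using deriv_f_lower[OF T] by blast
  have "\<gamma> \<noteq> 1" using \<gamma> by simp
  then obtain C where C: "C > 0" "\<And>t. 0 < t \<Longrightarrow> t \<le> T \<Longrightarrow> t \<le> C * f t powr (1 - \<gamma>)"
    using le_f_powr[OF T(1) c] by blast
  define a where "a = min (1 / C powr (1 + e)) (f T / (max M T) powr (1 + e))"
  have a: "a > 0" using C f_pos[OF T(1)] T(1) by (simp add: a_def)
  have "a * t powr (1 + e) \<le> f t" if t: "0 < t" "t \<le> M" for t
  proof (cases "t \<le> T")
    case True
    have "t powr (1 + e) \<le> (C * f t powr (1 - \<gamma>)) powr (1 + e)"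
      using e t C(2)[OF t(1) True] by (intro powr_mono2) auto
    also have "\<dots> = C powr (1 + e) * f t"
      using C f_pos[OF t(1)] by (simp add: powr_mult powr_powr \<gamma>e)
    finally have "t powr (1 + e) / C powr (1 + e) \<le> f t" using C by (simp add: divide_le_eq mult.commute)
    moreover have "a * t powr (1 + e) \<le> 1 / C powr (1 + e) * t powr (1 + e)"
      unfolding a_def by (intro mult_right_mono) auto
    ultimately show ?thesis by simp
  next
    case False
    have "a * t powr (1 + e) \<le> f T / (max M T) powr (1 + e) * (max M T) powr (1 + e)"
      using t e f_pos[OF T(1)] unfolding a_def by (intro mult_mono powr_mono2) auto
    also have "\<dots> = f T" using T(1) by simp
    also have "\<dots> \<le> f t" using False T(1) by (intro f_le) auto
    finally show ?thesis .
  qed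
  then show ?thesis using a by blast
qed

text \<open>In the limiting case \<open>\<alpha> = 1 + sqrt \<rho>\<close>,
  \<open>\<gamma> = \<gamma>' = \<rho>\<close> with \<open>\<rho> = 1/q\<close>, the dimension
  condition is the hypothesis \<open>dim\<close> multiplied by \<open>\<rho>\<close>. Being strict,
  it survives a small perturbation \<open>e\<close>, which in turn makes
  \<open>(\<alpha> - 1)^2 < \<rho>\<close> strict and leaves room for \<open>ratio\<close> between
  \<open>\<gamma>'\<close> and \<open>\<gamma>\<close>.\<close>

lemma (in convex_nonlinearity_zero) exists_test_pair:
  assumes q: "(q_fun f \<longlongrightarrow> ereal q) (at_right 0)" and q1: "1 \<le> q"
    and dim: "d < 2 * s * (2 * q + 2 * sqrt q + 1)"
  obtains t0 \<alpha> k \<gamma> \<gamma>' where "test_pair f t0 \<alpha> k" "\<gamma> \<noteq> 1" "0 \<le> 2 * \<alpha> - \<gamma> + \<gamma>'" "0 < 2 * \<gamma> - \<gamma>'" "0 < 2 * \<alpha> + \<gamma>"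
    "\<And>t. 0 < t \<Longrightarrow> t \<le> t0 \<Longrightarrow> ratio t \<le> \<gamma>" "\<And>t. 0 < t \<Longrightarrow> t \<le> t0 \<Longrightarrow> \<gamma>' \<le> ratio t"
    "d * (2 * \<gamma> - \<gamma>') < 2 * s * (2 * \<alpha> + \<gamma>)"
proof -
  define x where "x = 1 / sqrt q"
  have x: "0 < x" "x \<le> 1" using q1 by (auto simp: x_def)
  have sx: "sqrt q = 1 / x" by (simp add: x_def)
  have q_x: "q = 1 / x\<^sup>2" using q1 by (simp add: x_def power_divide)
  define \<rho> where "\<rho> = x\<^sup>2"
  have \<rho>: "0 < \<rho>" "\<rho> \<le> 1" using x by (auto simp: \<rho>_def power_le_one)
  have dim0: "0 < 2 * s * (2 + 2 * x + \<rho>) - d * \<rho>"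
  proof -
    have "d * \<rho> < 2 * s * (2 * q + 2 * sqrt q + 1) * \<rho>" using dim \<rho> by (intro mult_strict_right_mono)
    also have "(2 * q + 2 * sqrt q + 1) * \<rho> = 2 + 2 * x + \<rho>"
      using x unfolding sx unfolding q_x \<rho>_def by (simp add: field_simps power2_eq_square)
    then have "2 * s * (2 * q + 2 * sqrt q + 1) * \<rho> = 2 * s * (2 + 2 * x + \<rho>)" by (simp only: mult.assoc)
    finally show ?thesis by simp
  qed
  have "((\<lambda>e. 2 * s * (2 * (1 + x - e) + (\<rho> + e)) - d * (2 * (\<rho> + e) - (\<rho> - e))) \<longlongrightarrow>
      2 * s * (2 * (1 + x - 0) + (\<rho> + 0)) - d * (2 * (\<rho> + 0) - (\<rho> - 0))) (at_right 0)"
    by (intro tendsto_intros)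
  moreover have "0 < 2 * s * (2 * (1 + x - 0) + (\<rho> + 0)) - d * (2 * (\<rho> + 0) - (\<rho> - 0))" using dim0 by simp
  ultimately have ev1: "\<forall>\<^sub>F e in at_right 0. 0 < 2 * s * (2 * (1 + x - e) + (\<rho> + e)) - d * (2 * (\<rho> + e) - (\<rho> - e))"
    by (rule order_tendstoD)
  have ev2: "\<forall>\<^sub>F e in at_right 0. e \<in> {0<..<x / 2}" using x by (intro eventually_at_right_real) auto
  \<comment> \<open>The value \<open>\<gamma> = 1\<close> is avoided because of the logarithm it
    would cause in \<open>le_f_powr\<close>.\<close>
  have ev3: "\<forall>\<^sub>F e in at_right 0. \<rho> + e \<noteq> 1"
  proof (cases "\<rho> = 1")
    case True
    then show ?thesis by (auto intro!: eventually_at_rightI[of 0 1])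
  next
    case False
    then have "\<forall>\<^sub>F e in at_right 0. e \<in> {0<..<1 - \<rho>}" using \<rho> by (intro eventually_at_right_real) auto
    then show ?thesis by eventually_elim auto
  qed
  have "\<forall>\<^sub>F e in at_right 0. (0 < 2 * s * (2 * (1 + x - e) + (\<rho> + e)) - d * (2 * (\<rho> + e) - (\<rho> - e))) \<and> e \<in> {0<..<x / 2} \<and> \<rho> + e \<noteq> 1"
    by (intro eventually_conj ev1 ev2 ev3)
  from eventually_happens'[OF trivial_limit_at_right_real this] obtain e where e: "0 < 2 * s * (2 * (1 + x - e) + (\<rho> + e)) - d * (2 * (\<rho> + e) - (\<rho> - e))"
    "0 < e" "e < x / 2" "\<rho> + e \<noteq> 1" by auto
  define \<alpha> where "\<alpha> = 1 + x - e"
  define \<gamma> where "\<gamma> = \<rho> + e"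
  define \<gamma>' where "\<gamma>' = \<rho> - e"
  have \<alpha>: "1 \<le> \<alpha>" using e by (simp add: \<alpha>_def)
  have "(\<alpha> - 1)\<^sup>2 < \<rho>"
    unfolding \<rho>_def \<alpha>_def using e x by (intro power_strict_mono) auto
  then have \<alpha>\<rho>: "\<alpha>\<^sup>2 < 2 * \<alpha> - 1 + \<rho>" by (simp add: power2_eq_square algebra_simps)
  \<comment> \<open>Halfway between 1 and the fraction, which is below 1 as
    \<open>(\<alpha> - 1)^2 < \<rho>\<close>: the inequality for \<open>k\<close> is then strict at
    the limit \<open>\<rho>\<close> and persists for \<open>ratio t\<close> with \<open>t\<close>
    near 0.\<close>
  define k where "k = (\<alpha>\<^sup>2 / (2 * \<alpha> - 1 + \<rho>) + 1) / 2"
  have pos: "2 * \<alpha> - 1 + \<rho> > 0" using \<alpha> \<rho> by linarith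
  have fr: "\<alpha>\<^sup>2 / (2 * \<alpha> - 1 + \<rho>) < 1" "0 < \<alpha>\<^sup>2 / (2 * \<alpha> - 1 + \<rho>)" using \<alpha>\<rho> pos \<alpha> by auto
  have halfway: "0 < (z + 1) / 2 \<and> (z + 1) / 2 < 1 \<and> z < (z + 1) / 2" if "0 < z" "z < 1" for z :: real
    using that by auto
  have k: "0 < k" "k < 1" "\<alpha>\<^sup>2 / (2 * \<alpha> - 1 + \<rho>) < k" using halfway[OF fr(2,1)] by (simp_all only: k_def)
  have k\<alpha>: "\<alpha>\<^sup>2 < k * (2 * \<alpha> - 1 + \<rho>)" using k(3) pos by (simp add: divide_less_eq)
  have iq: "inverse (ereal q) = ereal \<rho>" using q1 x by (simp add: q_x \<rho>_def)
  have lim: "(ratio \<longlongrightarrow> \<rho>) (at_right 0)" using ratio_tendsto[OF q] unfolding iq by simp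
  have "((\<lambda>t. k * (2 * \<alpha> - 1 + ratio t)) \<longlongrightarrow> k * (2 * \<alpha> - 1 + \<rho>)) (at_right 0)"
    by (intro tendsto_intros lim)
  then have "\<forall>\<^sub>F t in at_right 0. \<alpha>\<^sup>2 < k * (2 * \<alpha> - 1 + ratio t)" using k\<alpha> by (rule order_tendstoD)
  moreover have "\<forall>\<^sub>F t in at_right 0. ratio t < \<gamma>" using e by (intro order_tendstoD[OF lim]) (simp add: \<gamma>_def)
  moreover have "\<forall>\<^sub>F t in at_right 0. \<gamma>' < ratio t" using e by (intro order_tendstoD[OF lim]) (simp add: \<gamma>'_def)
  ultimately have "\<forall>\<^sub>F t in at_right 0. \<alpha>\<^sup>2 < k * (2 * \<alpha> - 1 + ratio t) \<and> ratio t < \<gamma> \<and> \<gamma>' < ratio t"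
    by eventually_elim auto
  then obtain b where b: "b > 0" "\<And>t. 0 < t \<Longrightarrow> t < b \<Longrightarrow> \<alpha>\<^sup>2 < k * (2 * \<alpha> - 1 + ratio t) \<and> ratio t < \<gamma> \<and> \<gamma>' < ratio t"
    by (auto simp: eventually_at_right_field)
  show thesis
  proof (rule that[of "b / 2" \<alpha> k \<gamma> \<gamma>'])
    show "test_pair f (b / 2) \<alpha> k"
    proof unfold_locales
      show "\<alpha>\<^sup>2 \<le> k * (2 * \<alpha> - 1 + ratio t)" if "0 < t" "t \<le> b / 2" for t
        using b(2)[of t] that by auto
    qed (use b \<alpha> k in auto)
    show "ratio t \<le> \<gamma>" "\<gamma>' \<le> ratio t" if "0 < t" "t \<le> b / 2" for t
      using b(2)[of t] that by auto
  qed (use e x \<rho> \<alpha> in \<open>auto simp: \<gamma>_def \<gamma>'_def \<alpha>_def\<close>)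
qed

theorem theorem1p1:
  fixes s :: real and f :: "real \<Rightarrow> real" and q0 p0 :: ereal
  assumes s: "0 < s" "s < 1"
    and f_cont: "continuous_on {0..} f"
    and f_C2: "C2_on {0<..} f"
    and f_mono: "mono_on {0..} f"
    and f_convex: "convex_on {0..} f"
    and f_pos: "\<And>t. t > 0 \<Longrightarrow> f t > 0"
    and q0: "(q_fun f \<longlongrightarrow> q0) (at_right 0)"
    and p0: "p0 = conjugate_exponent q0"
    and cond:
      "real CARD('n) < 10 * s \<or>
       (real CARD('n) = 10 * s \<and> p0 < \<infinity>) \<or>
       (real CARD('n) > 10 * s \<and> p0 < ereal (p_c CARD('n) s))"
  shows "\<not> (\<exists>u :: real ^ 'n \<Rightarrow> real.
           is_solution s f u \<and> is_stable s f u \<and>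
           (\<forall>x. 0 \<le> u x) \<and> bounded (range u) \<and> u \<noteq> (\<lambda>x. 0))"
proof
  assume "\<exists>u :: real ^ 'n \<Rightarrow> real.
           is_solution s f u \<and> is_stable s f u \<and>
           (\<forall>x. 0 \<le> u x) \<and> bounded (range u) \<and> u \<noteq> (\<lambda>x. 0)"
  then obtain u :: "real ^ 'n \<Rightarrow> real" where sol: "is_solution s f u" and stab: "is_stable s f u"
    and u0: "\<And>x. 0 \<le> u x" and bd: "bounded (range u)" and nz: "u \<noteq> (\<lambda>x. 0)" by blast
  obtain M where "\<And>x. \<bar>u x\<bar> \<le> M" using bd by (auto simp: bounded_iff)
  then have uM: "u x \<le> M" for x using abs_le_D1 by blast
  interpret f: convex_nonlinearity f by unfold_locales (fact f_cont f_C2 f_mono f_convex f_pos)+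
  define c where "c = frac_const CARD('n) s"
  have c: "0 < c" unfolding c_def by (rule frac_const_pos[OF s])
  have "positive_solution s u (\<lambda>x. f (u x) / frac_const DIM(real ^ 'n) s) M"
    by (rule f.solution_imp_positive_solution[OF s sol u0 uM nz])
  then interpret positive_solution s u "\<lambda>x. f (u x) / c" M by (simp add: c_def)
  \<comment> \<open>Small enough for the supersolution argument:
    \<open>N * (2 * e) = s < 2 * s\<close>.\<close>
  define e where "e = s / (2 * real CARD('n))"
  have e: "0 < e" using s by (simp add: e_def)
  have dim_e: "real DIM(real ^ 'n) * (2 * e) < 2 * s" using s by (simp add: e_def)
  have super: False if a: "0 < a" "\<And>t. 0 < t \<Longrightarrow> t \<le> M \<Longrightarrow> a * t powr (1 + e) \<le> f t" for a
  proof (rule supersolution_contradiction[OF _ e dim_e])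
    show "0 < a / c" using a c by simp
    show "a / c * u x powr (1 + e) \<le> f (u x) / c" for x
      using a(2)[OF u_pos u_le, of x] c by (simp add: divide_right_mono)
  qed
  show False
  proof (cases "f 0 = 0")
    \<comment> \<open>\<open>f\<close> is bounded below by \<open>f 0 > 0\<close>, and on
      \<open>t \<le> M\<close> this constant dominates a multiple of the power
      \<open>t powr (1 + e)\<close>.\<close>
    case False
    then have f0: "0 < f 0" using f.f_zero_nonneg by simp
    show False
    proof (rule super)
      show "0 < f 0 / M powr (1 + e)" using f0 M_pos by simp
      fix t assume t: "0 < t" "t \<le> M"
      have "f 0 / M powr (1 + e) * t powr (1 + e) \<le> f 0 / M powr (1 + e) * M powr (1 + e)"
        using t f0 e by (intro mult_left_mono powr_mono2) auto
      also have "\<dots> = f 0" using M_pos by simp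
      also have "\<dots> \<le> f t" using t by (intro f.f_le) auto
      finally show "f 0 / M powr (1 + e) * t powr (1 + e) \<le> f t" .
    qed
  next
    case True
    interpret f: convex_nonlinearity_zero f by unfold_locales (fact True)
    have q1: "1 \<le> q0" by (rule f.q_limit_ge_one[OF q0])
    show False
    proof (cases q0)
      case (real q)
      have q: "1 \<le> q" using q1 real by (simp add: one_ereal_def)
      have "real CARD('n) < 2 * s * (2 * q + 2 * sqrt q + 1)"
        by (rule dimension_condition[OF s(1) q _ cond]) (simp add: p0 real)
      then have dim: "real DIM(real ^ 'n) < 2 * s * (2 * q + 2 * sqrt q + 1)" by simp
      obtain t0 \<alpha> k \<gamma> \<gamma>' where tp: "test_pair f t0 \<alpha> k" and
        par: "\<gamma> \<noteq> 1" "0 \<le> 2 * \<alpha> - \<gamma> + \<gamma>'" "0 < 2 * \<gamma> - \<gamma>'" "0 < 2 * \<alpha> + \<gamma>"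
        and r: "\<And>t. 0 < t \<Longrightarrow> t \<le> t0 \<Longrightarrow> f.ratio t \<le> \<gamma>" "\<And>t. 0 < t \<Longrightarrow> t \<le> t0 \<Longrightarrow> \<gamma>' \<le> f.ratio t"
        and d: "real DIM(real ^ 'n) * (2 * \<gamma> - \<gamma>') < 2 * s * (2 * \<alpha> + \<gamma>)"
        using f.exists_test_pair[OF q0[unfolded real] q dim] by metis
      show False
      proof (rule stable_contradiction[OF tp c _ _ par r d])
        show "c * (f (u x) / c) = f (u x)" for x using c by simp
        show "(LINT x|lebesgue. deriv f (u x) * (\<xi> x)\<^sup>2) \<le>
           c / 2 * (LINT x|lebesgue. LINT y|lebesgue. (\<xi> x - \<xi> y)\<^sup>2 / norm (x - y) powr (real DIM(real ^ 'n) + 2 * s))"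
          if "\<xi> \<in> test_functions" for \<xi>
          using stab that unfolding is_stable_def c_def by simp
      qed
    next
      case PInf
      then obtain a where "a > 0" "\<forall>t. 0 < t \<longrightarrow> t \<le> M \<longrightarrow> a * t powr (1 + e) \<le> f t"
        using f.superlinear_lower_bound[OF q0[unfolded PInf] e] by blast
      then show False using super by blast
    next
      case MInf
      then show False using q1 by simp
    qed
  qed
qed

end
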